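(* Let $n\ge3$. The module $\mathcal P_{n,-1}$ of polynomial relative first-order differential projective invariants of weight $-1$ is finitely generated over the algebra $\mathcal A_n$ of polynomial absolute invariants. More precisely, $$\mathcal P_{n,-1}=\sum_{(\boldsymbol b,\boldsymbol a)\in\mathfrak R_n}\mathcal A_n\,P_{\boldsymbol b,\boldsymbol a},$$ where $\mathfrak R_n$ is the (finite) set of reduced admissible pairs.
   Context: Let $R_n=\mathbb R[x_i,y_i,p_i,q_i\mid i=1,\dots,n]$. For $T=\begin{pmatrix} a_1 & a_2 & a_3 \\ b_1 & b_2 & b_3 \\ c_1 & c_2 & c_3 \end{pmatrix}\in GL(3,\mathbb R)$ and $g=[T]\in PGL(3,\mathbb R)$, put $s_i=c_1x_i+c_2y_i+c_3$. The element $g$ acts (where all $s_i\ne0$) diagonally on $z=(x_i,y_i,p_i,q_i)_{i=1}^n$ by $(x_i,y_i)\mapsto\left(\frac{a_1x_i+a_2y_i+a_3}{s_i},\frac{b_1x_i+b_2y_i+b_3}{s_i}\right)$, with $(p_i,q_i)$ transforming as the first-order partial derivatives of a scalar function at $(x_i,y_i)$. Equivalently, with $A_i=(x_i,y_i,1)^T$ (column) and $\ell_i=(p_i,q_i,-p_ix_i-q_iy_i)$ (row), the action is $A_i\mapsto TA_i/s_i$, $\ell_i\mapsto s_i\ell_iT^{-1}$. Put $J(g)=\frac{(\det T)^n}{\prod_{i=1}^n s_i^3}$. $\mathcal A_n$ (resp. $\mathcal P_{n,-1}$) is the set of all $F\in R_n$ with $F(g\cdot z)=F(z)$ (resp. $F(g\cdot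 z)=J(g)^{-1}F(z)$) for all $g\in PGL(3,\mathbb R)$ and $z$ for which the action is defined. Put $C_{ij}=\ell_iA_j=p_i(x_j-x_i)+q_i(y_j-y_i)$ and, for a triple $I=\{i<j<k\}$, $D_I=\det(\ell_i,\ell_j,\ell_k)$. Let $\mathcal T_n=\{I\subset\{1,\dots,n\}\mid|I|=3\}$. Consider vectors $\boldsymbol b=(b_I)_{I\in\mathcal T_n}$ with $b_I\in\mathbb Z_{\ge0}$ and $n\times n$ matrices $\boldsymbol a=(a_{ij})$ with $a_{ij}\in\mathbb Z_{\ge0}$, $a_{ii}=0$. Put $|\boldsymbol b|=\sum_I b_I$, $d_{\boldsymbol b}(i)=\sum_{I\ni i}b_I$, $\partial_{\boldsymbol a}(i)=\sum_{j}a_{ij}-\sum_{j}a_{ji}$. The pair $(\boldsymbol b,\boldsymbol a)$ is admissible if $|\boldsymbol b|=n$ and $d_{\boldsymbol b}(i)+\partial_{\boldsymbol a}(i)=3$ for all $i$. For an admissible pair, $P_{\boldsymbol b,\boldsymbol a}=\prod_{I\in\mathcal T_n}D_I^{b_I}\prod_{i\ne j}C_{ij}^{a_{ij}}$. For a cycle $\gamma=(i_1\,\dots\,i_r)\in S_n$, $r\ge2$, let $Z_\gamma=C_{i_1i_2}C_{i_2i_3}\cdots C_{i_ri_1}$. An admissible pair is reduced if the monomial $\prod_{i\ne j}C_{ij}^{a_{ij}}$ is not divisible (as a monomial in the symbols $C_{ij}$) by any $Z_\gamma$; i.e. there are no distinct indices $i_1,\dots,i_r$, $r\ge2$, with $a_{i_1i_2},\dots,a_{i_ri_1}$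 all positive. *)

theory Defs
  imports "HOL-Analysis.Analysis" "HOL-Library.Poly_Mapping"
begin

datatype jvar = JX nat | JY nat | JP nat | JQ nat

text \<open>
  A monomial is a finitely supported exponent function \<open>jvar \<Rightarrow>\<^sub>0 nat\<close>, a polynomial a finitely
  supported coefficient function on monomials; the type below is thus the real polynomial ring in
  all the variables \<open>jvar\<close>, with the library's convolution product.
\<close>

type_synonym jpoly = "(jvar \<Rightarrow>\<^sub>0 nat) \<Rightarrow>\<^sub>0 real"

definition pvar :: "jvar \<Rightarrow> jpoly" where
  "pvar v = Poly_Mapping.single (Poly_Mapping.single v 1) 1"

definition peval :: "(jvar \<Rightarrow> real) \<Rightarrow> jpoly \<Rightarrow> real" where
  "peval z F = (\<Sum>m\<in>Poly_Mapping.keys F. Poly_Mapping.lookup F m *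
     (\<Prod>v\<in>Poly_Mapping.keys m. z v ^ Poly_Mapping.lookup m v))"

definition jvars :: "nat \<Rightarrow> jvar set" where
  "jvars n = (\<Union>i\<in>{1..n}. {JX i, JY i, JP i, JQ i})"

definition Rpoly :: "nat \<Rightarrow> jpoly set" where
  "Rpoly n = {F. \<forall>m\<in>Poly_Mapping.keys F. Poly_Mapping.keys m \<subseteq> jvars n}"

text \<open>
  The column \<open>A\<^sub>i\<close> and the row \<open>\<ell>\<^sub>i\<close>, with entries read off from \<open>z\<close>. They are used both for
  real points \<open>z\<close> and, with \<open>z = pvar\<close>, for the generic point with polynomial entries.
\<close>

definition Acol :: "(jvar \<Rightarrow> 'a::comm_ring_1) \<Rightarrow> nat \<Rightarrow> 'a^3" where
  "Acol z i = vector [z (JX i), z (JY i), 1]"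

definition lrow :: "(jvar \<Rightarrow> 'a::comm_ring_1) \<Rightarrow> nat \<Rightarrow> 'a^3" where
  "lrow z i = vector [z (JP i), z (JQ i), - z (JP i) * z (JX i) - z (JQ i) * z (JY i)]"

definition sden :: "real^3^3 \<Rightarrow> (jvar \<Rightarrow> real) \<Rightarrow> nat \<Rightarrow> real" where
  "sden T z i = T$3$1 * z (JX i) + T$3$2 * z (JY i) + T$3$3"

text \<open>
  The new \<open>(p\<^sub>i, q\<^sub>i)\<close> are the first two entries of \<open>s\<^sub>i \<ell>\<^sub>i T\<inverse>\<close>, which is the chain rule for
  the gradient of a scalar function; \<open>lrow_act\<close> below shows that the third entry is then the
  one required by the shape of \<open>\<ell>\<^sub>i\<close>. Only points with all \<open>sden T z i \<noteq> 0\<close> are ever used.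
\<close>

definition act :: "real^3^3 \<Rightarrow> (jvar \<Rightarrow> real) \<Rightarrow> jvar \<Rightarrow> real" where
  "act T z v = (case v of
       JX i \<Rightarrow> (T$1$1 * z (JX i) + T$1$2 * z (JY i) + T$1$3) / sden T z i
     | JY i \<Rightarrow> (T$2$1 * z (JX i) + T$2$2 * z (JY i) + T$2$3) / sden T z i
     | JP i \<Rightarrow> (sden T z i *\<^sub>R (lrow z i v* matrix_inv T)) $ 1
     | JQ i \<Rightarrow> (sden T z i *\<^sub>R (lrow z i v* matrix_inv T)) $ 2)"

definition Jfac :: "nat \<Rightarrow> real^3^3 \<Rightarrow> (jvar \<Rightarrow> real) \<Rightarrow> real" where
  "Jfac n T z = det T ^ n / (\<Prod>i\<in>{1..n}. sden T z i ^ 3)"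

text \<open>
  \<open>act\<close> and \<open>Jfac\<close> do not change when \<open>T\<close> is rescaled (see \<open>act_scale\<close> and \<open>Jfac_scale\<close> below), so
  quantifying over invertible \<open>T\<close> is quantifying over \<open>PGL(3,\<real>)\<close>.
\<close>

definition absolute_invariants :: "nat \<Rightarrow> jpoly set" where
  "absolute_invariants n = {F \<in> Rpoly n. \<forall>T z. invertible T \<longrightarrow> (\<forall>i\<in>{1..n}. sden T z i \<noteq> 0) \<longrightarrow>
     peval (act T z) F = peval z F}"

definition relative_invariants :: "nat \<Rightarrow> int \<Rightarrow> jpoly set" where
  "relative_invariants n w = {F \<in> Rpoly n. \<forall>T z. invertible T \<longrightarrow> (\<forall>i\<in>{1..n}. sden T z i \<noteq> 0) \<longrightarrow>
     peval (act T z) F = Jfac n T z powi w * peval z F}"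

definition Cpol :: "nat \<Rightarrow> nat \<Rightarrow> jpoly" where
  "Cpol i j = (\<Sum>k\<in>UNIV. lrow pvar i $ k * Acol pvar j $ k)"

definition triples :: "nat \<Rightarrow> nat set set" where
  "triples n = {I. I \<subseteq> {1..n} \<and> card I = 3}"

definition Dpol :: "nat set \<Rightarrow> jpoly" where
  "Dpol I = (let l = sorted_list_of_set I in
     det (vector [lrow pvar (l!0), lrow pvar (l!1), lrow pvar (l!2)] :: jpoly^3^3))"

definition bdeg :: "nat \<Rightarrow> (nat set \<Rightarrow> nat) \<Rightarrow> nat \<Rightarrow> nat" where
  "bdeg n b i = (\<Sum>I\<in>{I\<in>triples n. i \<in> I}. b I)"

definition adiff :: "nat \<Rightarrow> (nat \<Rightarrow> nat \<Rightarrow> nat) \<Rightarrow> nat \<Rightarrow> int" where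
  "adiff n a i = int (\<Sum>j\<in>{1..n}. a i j) - int (\<Sum>j\<in>{1..n}. a j i)"

text \<open>
  The vector \<open>b\<close> and the matrix \<open>a\<close> are total functions; the first two conditions make them vanish
  outside \<open>triples n\<close> and \<open>{1..n} \<times> {1..n}\<close>, so that a pair is determined by its entries.
\<close>

definition admissible :: "nat \<Rightarrow> (nat set \<Rightarrow> nat) \<times> (nat \<Rightarrow> nat \<Rightarrow> nat) \<Rightarrow> bool" where
  "admissible n = (\<lambda>(b, a).
     (\<forall>I. I \<notin> triples n \<longrightarrow> b I = 0) \<and>
     (\<forall>i j. i \<notin> {1..n} \<or> j \<notin> {1..n} \<longrightarrow> a i j = 0) \<and>
     (\<forall>i. a i i = 0) \<and>
     (\<Sum>I\<in>triples n. b I) = n \<and>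
     (\<forall>i\<in>{1..n}. int (bdeg n b i) + adiff n a i = 3))"

definition has_cycle :: "nat \<Rightarrow> (nat \<Rightarrow> nat \<Rightarrow> nat) \<Rightarrow> bool" where
  "has_cycle n a \<longleftrightarrow> (\<exists>c. distinct c \<and> 2 \<le> length c \<and> set c \<subseteq> {1..n} \<and>
     (\<forall>k<length c. 0 < a (c ! k) (c ! (Suc k mod length c))))"

definition reduced_pairs :: "nat \<Rightarrow> ((nat set \<Rightarrow> nat) \<times> (nat \<Rightarrow> nat \<Rightarrow> nat)) set" where
  "reduced_pairs n = {(b, a). admissible n (b, a) \<and> \<not> has_cycle n a}"

definition Ppol :: "nat \<Rightarrow> (nat set \<Rightarrow> nat) \<times> (nat \<Rightarrow> nat \<Rightarrow> nat) \<Rightarrow> jpoly" where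
  "Ppol n = (\<lambda>(b, a). (\<Prod>I\<in>triples n. Dpol I ^ b I) *
     (\<Prod>(i, j)\<in>{(i, j). i \<in> {1..n} \<and> j \<in> {1..n} \<and> i \<noteq> j}. Cpol i j ^ a i j))"

text \<open>For finite \<open>K\<close> this is the sum of the \<open>A g\<^sub>k\<close>, \<open>k \<in> K\<close>.\<close>

definition sum_module :: "'a::comm_ring_1 set \<Rightarrow> 'k set \<Rightarrow> ('k \<Rightarrow> 'a) \<Rightarrow> 'a set" where
  "sum_module A K g = {\<Sum>k\<in>K. h k * g k | h. \<forall>k\<in>K. h k \<in> A}"

definition finitely_generated_over :: "'a::comm_ring_1 set \<Rightarrow> 'a set \<Rightarrow> bool" where
  "finitely_generated_over A M \<longleftrightarrow> (\<exists>G. finite G \<and> G \<subseteq> M \<and> M = sum_module A G (\<lambda>g. g))"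

lemma peval_superset:
  assumes "finite S" "Poly_Mapping.keys F \<subseteq> S"
  shows "peval z F = (\<Sum>m\<in>S. Poly_Mapping.lookup F m *
     (\<Prod>v\<in>Poly_Mapping.keys m. z v ^ Poly_Mapping.lookup m v))"
  unfolding peval_def using assms
  by (intro sum.mono_neutral_left) (auto simp: in_keys_iff)

lemma peval_add: "peval z (F + G) = peval z F + peval z G"
  using Poly_Mapping.keys_add[of F G]
  by (simp add: peval_superset[of "Poly_Mapping.keys F \<union> Poly_Mapping.keys G"] lookup_add
      distrib_right sum.distrib)

lemma peval_single: "peval z (Poly_Mapping.single m c) =
    c * (\<Prod>v\<in>Poly_Mapping.keys m. z v ^ Poly_Mapping.lookup m v)"
  by (simp add: peval_superset[of "{m}"])

lemma peval_const: "peval z (Poly_Mapping.single 0 c) = c"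
  by (simp add: peval_single)

lemma peval_pvar: "peval z (pvar v) = z v"
  by (simp add: pvar_def peval_single)

lemma monom_eval_add:
  fixes m m' :: "jvar \<Rightarrow>\<^sub>0 nat" and z :: "jvar \<Rightarrow> real"
  defines "e \<equiv> \<lambda>m. \<Prod>v\<in>Poly_Mapping.keys m. z v ^ Poly_Mapping.lookup m v"
  shows "e (m + m') = e m * e m'"
proof -
  let ?S = "Poly_Mapping.keys m \<union> Poly_Mapping.keys m'"
  have "e k = (\<Prod>v\<in>?S. z v ^ Poly_Mapping.lookup k v)" if "Poly_Mapping.keys k \<subseteq> ?S" for k
    unfolding e_def using that by (intro prod.mono_neutral_left) (auto simp: in_keys_iff)
  with Poly_Mapping.keys_add[of m m'] show ?thesis
    by (simp add: lookup_add power_add prod.distrib)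
qed

lemma jpoly_induct [case_names single sum]:
  fixes F :: jpoly
  assumes single: "\<And>m c. P (Poly_Mapping.single m c)"
    and sum: "\<And>F G. P F \<Longrightarrow> P G \<Longrightarrow> P (F + G)"
  shows "P F"
proof (induction F rule: update_induct)
  case const
  show ?case using single[of 0 0] by simp
next
  case (update f a b)
  have "Poly_Mapping.update a b f = f + Poly_Mapping.single a b"
    using update.hyps(1)
    by (intro poly_mapping_eqI) (auto simp: lookup_update lookup_add lookup_single in_keys_iff)
  with update.IH single sum show ?case by simp
qed

lemma peval_mult: "peval z (F * G) = peval z F * peval z G"
proof -
  have single: "peval z (Poly_Mapping.single m c * G) = peval z (Poly_Mapping.single m c) * peval z G"
    for m c
  proof (induction G rule: jpoly_induct)
    case (single m' c')
    then show ?case by (simp add: mult_single peval_single monom_eval_add)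
  next
    case (sum G H)
    then show ?case by (simp add: distrib_left peval_add)
  qed
  show ?thesis
    by (induction F rule: jpoly_induct) (simp_all add: single distrib_right peval_add)
qed

lemma matrix_inv_inverse:
  fixes T :: "real^3^3"
  assumes "invertible T"
  shows "matrix_inv T ** T = mat 1" "T ** matrix_inv T = mat 1"
  using someI_ex[OF assms[unfolded invertible_def]] by (simp_all add: matrix_inv_def)

lemma sden_eq: "sden T z i = (T *v Acol z i) $ 3"
  by (simp add: sden_def Acol_def matrix_vector_mult_def sum_3)

lemma Acol_act: "sden T z i \<noteq> 0 \<Longrightarrow> Acol (act T z) i = (1 / sden T z i) *\<^sub>R (T *v Acol z i)"
  by (simp add: vec_eq_iff forall_3 Acol_def act_def matrix_vector_mult_def sum_3 sden_def)

lemma lrow_Acol: "(\<Sum>k\<in>UNIV. lrow z i $ k * Acol z i $ k) = 0"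
  by (simp add: sum_3 lrow_def Acol_def)

lemma lrow_act:
  assumes T: "invertible T" and s0: "sden T z i \<noteq> 0"
  shows "lrow (act T z) i = sden T z i *\<^sub>R (lrow z i v* matrix_inv T)"
proof -
  let ?A = "Acol (act T z) i" and ?l = "sden T z i *\<^sub>R (lrow z i v* matrix_inv T)"
  have TT: "matrix_inv T ** T = mat 1"
    using T by (rule matrix_inv_inverse)
  have "?l \<bullet> ?A = (lrow z i v* matrix_inv T) \<bullet> (T *v Acol z i)"
    using s0 by (simp add: Acol_act)
  also have "\<dots> = lrow z i \<bullet> (matrix_inv T *v (T *v Acol z i))"
    by (simp add: dot_lmul_matrix)
  also have "\<dots> = 0"
    using lrow_Acol[of z i] by (simp add: matrix_vector_mul_assoc TT inner_vec_def)
  finally have "?l $ 3 = - ?l $ 1 * ?A $ 1 - ?l $ 2 * ?A $ 2"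
    by (simp add: inner_vec_def sum_3 Acol_def)
  moreover have "?A $ 1 = act T z (JX i)" "?A $ 2 = act T z (JY i)"
    "act T z (JP i) = ?l $ 1" "act T z (JQ i) = ?l $ 2"
    by (simp_all add: Acol_def act_def)
  ultimately show ?thesis
    by (simp only: vec_eq_iff forall_3 lrow_def vector_3 simp_thms)
qed

lemma sden_scale: "sden (r *\<^sub>R T) z i = r * sden T z i"
  by (simp add: sden_def algebra_simps)

lemma act_scale:
  assumes T: "invertible T" and r: "r \<noteq> 0"
  shows "act (r *\<^sub>R T) z = act T z"
proof -
  let ?S = "r *\<^sub>R T"
  have "invertible ?S"
    using T r by (simp add: invertible_det_nz det_3 algebra_simps) algebra
  then have "matrix_inv ?S ** ?S = mat 1"
    by (rule matrix_inv_inverse)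
  then have left: "(r *\<^sub>R matrix_inv ?S) ** T = mat 1"
    by (simp add: matrix_matrix_mult_def vec_eq_iff sum_3 algebra_simps)
  have "r *\<^sub>R matrix_inv ?S = (r *\<^sub>R matrix_inv ?S) ** (T ** matrix_inv T)"
    using T by (simp add: matrix_inv_inverse)
  also have "\<dots> = matrix_inv T"
    by (simp only: matrix_mul_assoc left matrix_mul_lid)
  finally have "matrix_inv T = r *\<^sub>R matrix_inv ?S" by simp
  then show ?thesis
    using r by (auto simp: fun_eq_iff act_def sden_scale vector_matrix_mult_def sum_3 divide_simps
      algebra_simps split: jvar.split)
qed

lemma Jfac_scale: "r \<noteq> 0 \<Longrightarrow> Jfac n (r *\<^sub>R T) z = Jfac n T z"
proof -
  assume r: "r \<noteq> 0"
  have d: "det (r *\<^sub>R T) = r ^ 3 * det T"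
    by (simp add: det_3 algebra_simps power3_eq_cube)
  show ?thesis
    using r by (simp add: Jfac_def d sden_scale power_mult_distrib prod.distrib)
qed

lemma Cpol_eq: "Cpol i j =
    pvar (JP i) * (pvar (JX j) - pvar (JX i)) + pvar (JQ i) * (pvar (JY j) - pvar (JY i))"
  by (simp add: Cpol_def lrow_def Acol_def sum_3 algebra_simps)

end

(* Write F homogeneous of degree k_i in each (p_i, q_i), and put l_i = A_i x v_i. In the coordinates
   (A_i, v_i) the invariant F becomes a polynomial f: its homogenization could only have poles where
   the last coordinate of some A_i vanishes, and the group moves that locus. The polynomial f is
   SL(3)-invariant, so Cayley's Omega process (apply Omega repeatedly to f(TA, Tv) = det(T)^p f(A, v))
   writes it in 3x3 brackets of the A_i and v_i. As f does not change under v_i -> v_i + t A_i,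
   Capelli's identity reproduces f from l_i . (d/dA_i x d/dv_i) f up to a nonzero factor, and
   iterating this operator replaces all v_i by l_i. This leaves words in the brackets [A A A], [l l l]
   and the contractions l_i A_j; since [A A A] [l l l] = det (l_i A_j) and the weight -1 forces n more
   brackets of the second kind than of the first, the brackets [A A A] can be eliminated. Comparing
   degrees, each remaining word is an admissible product up to sign. Splitting off cycles, which are
   absolute invariants, makes it reduced; a reduced pair has bounded entries because the divergence
   of a is bounded. *)

theory Submission
  imports Defs
begin

section \<open>Polynomials over an arbitrary set of variables\<close>

text \<open>The obstacle is the relation l_i A_i = 0: the pairs (A_i, l_i) fill only a quadric,
  where Cayley's process does not apply directly. The auxiliary vectors replace this quadric by a
  free vector space, at the price that v_i is determined only modulo A_i, and Capelli's identity is
  what removes them again. The weight fixes the numbers: p_i and q_i have degree 2 in A_i and 1 in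
  v_i, and the cubes in J lower the degree in A_i by 3, so f has degrees 2k_i - 3 and k_i. If f is
  not 0, then k_i >= 2; this one inequality makes the power of det(T) nonnegative and all Capelli
  factors nonzero. In the formal part the l_i are independent variables, and l_i = A_i x v_i is
  imposed only on points of evaluation. Identities that involve substitutions are checked through
  values at positive points, where no coordinate vanishes.\<close>

type_synonym 'v mpoly = "('v \<Rightarrow>\<^sub>0 nat) \<Rightarrow>\<^sub>0 real"

definition mev :: "('v \<Rightarrow> real) \<Rightarrow> ('v \<Rightarrow>\<^sub>0 nat) \<Rightarrow> real" where
  "mev z m = (\<Prod>v\<in>Poly_Mapping.keys m. z v ^ Poly_Mapping.lookup m v)"

definition pev :: "('v \<Rightarrow> real) \<Rightarrow> 'v mpoly \<Rightarrow> real" where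
  "pev z F = (\<Sum>m\<in>Poly_Mapping.keys F. Poly_Mapping.lookup F m * mev z m)"

definition PX :: "'v \<Rightarrow> 'v mpoly" where
  "PX v = Poly_Mapping.single (Poly_Mapping.single v 1) 1"

definition PC :: "real \<Rightarrow> 'v mpoly" where
  "PC c = Poly_Mapping.single 0 c"

lemma peval_eq_pev: "peval z F = pev z F"
  by (simp add: peval_def pev_def mev_def)

lemma pvar_eq_PX: "pvar v = PX v"
  by (simp add: pvar_def PX_def)

lemma mev_superset:
  assumes "finite S" "Poly_Mapping.keys m \<subseteq> S"
  shows "mev z m = (\<Prod>v\<in>S. z v ^ Poly_Mapping.lookup m v)"
  unfolding mev_def using assms
  by (intro prod.mono_neutral_left) (auto simp: in_keys_iff)

lemma mev_add: "mev z (m + m') = mev z m * mev z m'"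
proof -
  let ?S = "Poly_Mapping.keys m \<union> Poly_Mapping.keys m'"
  have "Poly_Mapping.keys (m + m') \<subseteq> ?S"
    by (rule Poly_Mapping.keys_add)
  then show ?thesis
    by (simp add: mev_superset[of ?S] lookup_add power_add prod.distrib)
qed

lemma mev_0 [simp]: "mev z 0 = 1"
  by (simp add: mev_def)

lemma mev_single [simp]: "mev z (Poly_Mapping.single v k) = z v ^ k"
  by (simp add: mev_superset[of "{v}"])

lemma mev_times: "mev (\<lambda>v. w v * z v) m = mev w m * mev z m"
  by (simp add: mev_def power_mult_distrib prod.distrib)

lemma pev_superset:
  assumes "finite S" "Poly_Mapping.keys F \<subseteq> S"
  shows "pev z F = (\<Sum>m\<in>S. Poly_Mapping.lookup F m * mev z m)"
  unfolding pev_def using assms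
  by (intro sum.mono_neutral_left) (auto simp: in_keys_iff)

lemma pev_add [simp]: "pev z (F + G) = pev z F + pev z G"
  using Poly_Mapping.keys_add[of F G]
  by (simp add: pev_superset[of "Poly_Mapping.keys F \<union> Poly_Mapping.keys G"] lookup_add
      distrib_right sum.distrib)

lemma pev_single: "pev z (Poly_Mapping.single m c) = c * mev z m"
  by (simp add: pev_superset[of "{m}"])

lemma pev_PC [simp]: "pev z (PC c) = c"
  by (simp add: PC_def pev_single)

lemma pev_PX [simp]: "pev z (PX v) = z v"
  by (simp add: PX_def pev_single)

lemma PC_0: "PC 0 = 0" and PC_1: "PC 1 = 1"
  by (simp_all add: PC_def)

lemma PC_add: "PC (a + b) = PC a + PC b"
  by (simp add: PC_def single_add)

lemma PC_mult: "PC (a * b) = PC a * PC b"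
  by (simp add: PC_def mult_single)

lemma PC_uminus: "PC (- a) = - PC a"
  by (simp add: PC_def single_uminus)

lemma PC_of_nat: "PC (of_nat k) = of_nat k"
  by (simp add: PC_def)

lemma PC_numeral: "PC (numeral k) = numeral k"
  by (simp add: PC_def)

lemma PC_of_int: "PC (of_int k) = of_int k"
  by (simp add: PC_def)

lemma pev_0 [simp]: "pev z 0 = 0"
  using pev_PC[of z 0] by (simp add: PC_0)

lemma pev_1 [simp]: "pev z 1 = 1"
  using pev_PC[of z 1] by (simp add: PC_1)

lemma pev_of_nat [simp]: "pev z (of_nat k) = of_nat k"
  by (induction k) auto

lemma mpoly_single_sum_induct [case_names single sum]:
  fixes F :: "'v mpoly"
  assumes single: "\<And>m c. P (Poly_Mapping.single m c)"
    and sum: "\<And>F G. P F \<Longrightarrow> P G \<Longrightarrow> P (F + G)"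
  shows "P F"
proof (induction F rule: update_induct)
  case const
  show ?case using single[of 0 0] by simp
next
  case (update f a b)
  have "Poly_Mapping.update a b f = f + Poly_Mapping.single a b"
    using update.hyps(1)
    by (intro poly_mapping_eqI) (auto simp: lookup_update lookup_add lookup_single in_keys_iff)
  with update.IH single sum show ?case by simp
qed

lemma pev_mult [simp]: "pev z (F * G) = pev z F * pev z G"
proof -
  have single: "pev z (Poly_Mapping.single m c * G) = pev z (Poly_Mapping.single m c) * pev z G"
    for m c
    by (induction G rule: mpoly_single_sum_induct)
      (simp_all add: mult_single pev_single mev_add distrib_left)
  show ?thesis
    by (induction F rule: mpoly_single_sum_induct) (simp_all add: single distrib_right)
qed

lemma pev_uminus [simp]: "pev z (- F) = - pev z F"
  using pev_add[of z F "- F"] by simp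

lemma pev_diff [simp]: "pev z (F - G) = pev z F - pev z G"
  using pev_add[of z F "- G"] by simp

lemma pev_numeral [simp]: "pev z (numeral k) = numeral k"
  using pev_of_nat[of z "numeral k"] by simp

lemma pev_power [simp]: "pev z (F ^ k) = pev z F ^ k"
  by (induction k) simp_all

lemma pev_sum [simp]: "pev z (sum F S) = (\<Sum>x\<in>S. pev z (F x))"
  by (induction S rule: infinite_finite_induct) simp_all

lemma pev_prod [simp]: "pev z (prod F S) = (\<Prod>x\<in>S. pev z (F x))"
  by (induction S rule: infinite_finite_induct) simp_all

lemma mpoly_monom_induct [case_names const mult]:
  fixes m :: "'v \<Rightarrow>\<^sub>0 nat"
  assumes const: "P (PC c)"
    and mult: "\<And>v F. v \<in> Poly_Mapping.keys m \<Longrightarrow> P F \<Longrightarrow> P (PX v * F)"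
  shows "P (Poly_Mapping.single m c)"
proof -
  have "Poly_Mapping.keys m' \<subseteq> Poly_Mapping.keys m \<Longrightarrow> P (Poly_Mapping.single m' c)" for m'
  proof (induction "\<Sum>v\<in>Poly_Mapping.keys m. Poly_Mapping.lookup m' v" arbitrary: m')
    case 0
    then have "\<forall>v\<in>Poly_Mapping.keys m. Poly_Mapping.lookup m' v = 0" by simp
    then have "Poly_Mapping.lookup m' v = 0" for v
      using "0.prems" in_keys_iff[of v m'] by blast
    then have "m' = 0" by (intro poly_mapping_eqI) simp
    then show ?case using const by (simp add: PC_def)
  next
    case (Suc k)
    then obtain v where v: "v \<in> Poly_Mapping.keys m" "Poly_Mapping.lookup m' v \<noteq> 0"
      by (metis Zero_not_Suc sum.neutral)
    define m'' where "m'' = m' - Poly_Mapping.single v 1"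
    have m': "m' = Poly_Mapping.single v 1 + m''"
      using v by (intro poly_mapping_eqI)
        (auto simp: m''_def lookup_add lookup_minus lookup_single when_def)
    have "k = (\<Sum>v\<in>Poly_Mapping.keys m. Poly_Mapping.lookup m'' v)"
      using Suc.hyps(2) v
      by (simp add: m' lookup_add sum.distrib lookup_single when_def)
    moreover have "Poly_Mapping.keys m'' \<subseteq> Poly_Mapping.keys m"
      using Suc.prems by (auto simp: m' in_keys_iff lookup_add)
    ultimately have "P (Poly_Mapping.single m'' c)"
      using Suc.hyps(1) by blast
    from mult[OF v(1) this] show ?case
      by (simp add: m' PX_def mult_single)
  qed
  then show ?thesis by simp
qed

lemma mpoly_induct [case_names const var add]:
  fixes F :: "'v mpoly"
  assumes "\<And>c. P (PC c)" "\<And>v F. P F \<Longrightarrow> P (PX v * F)" "\<And>F G. P F \<Longrightarrow> P G \<Longrightarrow> P (F + G)"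
  shows "P F"
  by (induction F rule: mpoly_single_sum_induct) (auto intro: mpoly_monom_induct assms)

text \<open>Evaluation uses only ring operations, so a class of functions closed under them contains
  the composite as soon as it contains the substituted variables that occur in \<open>F\<close>.
  With a suitable \<open>Q\<close> this yields a polynomial that represents a substitution, or the
  numerator of one.\<close>

lemma pev_closed:
  fixes F :: "'v mpoly" and \<sigma> :: "'z \<Rightarrow> 'v \<Rightarrow> real"
  assumes const: "\<And>c. Q (\<lambda>_. c)"
    and add: "\<And>g h. Q g \<Longrightarrow> Q h \<Longrightarrow> Q (\<lambda>\<zeta>. g \<zeta> + h \<zeta>)"
    and mult: "\<And>g h. Q g \<Longrightarrow> Q h \<Longrightarrow> Q (\<lambda>\<zeta>. g \<zeta> * h \<zeta>)"
    and var: "\<And>m v. m \<in> Poly_Mapping.keys F \<Longrightarrow> v \<in> Poly_Mapping.keys m \<Longrightarrow> Q (\<lambda>\<zeta>. \<sigma> \<zeta> v)"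
  shows "Q (\<lambda>\<zeta>. pev (\<sigma> \<zeta>) F)"
proof -
  have sums: "Q (\<lambda>\<zeta>. \<Sum>x\<in>S. g x \<zeta>)" if "finite S" "\<And>x. x \<in> S \<Longrightarrow> Q (g x)" for S :: "('v \<Rightarrow>\<^sub>0 nat) set" and g
    using that by (induction S) (auto intro: const[of 0] add)
  have pow: "Q (\<lambda>\<zeta>. g \<zeta> ^ k)" if "Q g" for g and k :: nat
    using that by (induction k) (auto intro: const[of 1] mult)
  have prods: "Q (\<lambda>\<zeta>. \<Prod>x\<in>S. g x \<zeta>)" if "finite S" "\<And>x. x \<in> S \<Longrightarrow> Q (g x)" for S :: "'v set" and g
    using that by (induction S) (auto intro: const[of 1] mult)
  have monom: "Q (\<lambda>\<zeta>. Poly_Mapping.lookup F m * (\<Prod>v\<in>Poly_Mapping.keys m. \<sigma> \<zeta> v ^ Poly_Mapping.lookup m v))"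
    if m: "m \<in> Poly_Mapping.keys F" for m
  proof -
    have "Q (\<lambda>\<zeta>. \<sigma> \<zeta> v ^ Poly_Mapping.lookup m v)" if "v \<in> Poly_Mapping.keys m" for v
      using var[OF m that] by (rule pow)
    then have "Q (\<lambda>\<zeta>. \<Prod>v\<in>Poly_Mapping.keys m. \<sigma> \<zeta> v ^ Poly_Mapping.lookup m v)"
      by (rule prods[OF finite_keys])
    with const show ?thesis by (rule mult)
  qed
  show ?thesis unfolding pev_def mev_def by (rule sums[OF finite_keys monom])
qed

section \<open>Values at positive points determine a polynomial\<close>

lemma pev_cong:
  assumes "\<And>m v. m \<in> Poly_Mapping.keys F \<Longrightarrow> v \<in> Poly_Mapping.keys m \<Longrightarrow> z v = z' v"
  shows "pev z F = pev z' F"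
  unfolding pev_def mev_def using assms by (intro sum.cong refl arg_cong2[of _ _ _ _ "(*)"] prod.cong) auto

text \<open>Distinct monomials are distinct characters of the multiplicative group of positive
  points, so this is the linear independence of characters.\<close>

lemma pev_positive_eq_0:
  fixes F :: "'v mpoly"
  assumes "\<And>z. (\<And>v. z v > 0) \<Longrightarrow> pev z F = 0"
  shows "F = 0"
  using assms
proof (induction "card (Poly_Mapping.keys F)" arbitrary: F rule: less_induct)
  case less
  show ?case
  proof (rule ccontr)
    assume "F \<noteq> 0"
    then obtain m where m: "m \<in> Poly_Mapping.keys F" by fastforce
    show False
    proof (cases "Poly_Mapping.keys F = {m}")
      case True
      then have "Poly_Mapping.lookup F m = 0"
        using less.prems[of "\<lambda>_. 1"] by (simp add: pev_def mev_def)
      with m show False by (simp add: in_keys_iff)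
    next
      case False
      then obtain m' where m': "m' \<in> Poly_Mapping.keys F" "m' \<noteq> m" using m by blast
      then obtain v where v: "Poly_Mapping.lookup m' v \<noteq> Poly_Mapping.lookup m v"
        by (metis poly_mapping_eqI)
      define w where "w = (\<lambda>u. if u = v then 2 else (1::real))"
      have mw: "mev w k = 2 ^ Poly_Mapping.lookup k v" for k
      proof -
        have "mev w k = (\<Prod>u\<in>insert v (Poly_Mapping.keys k). w u ^ Poly_Mapping.lookup k u)"
          by (rule mev_superset) auto
        also have "\<dots> = (\<Prod>u\<in>insert v (Poly_Mapping.keys k). if u = v then 2 ^ Poly_Mapping.lookup k v else 1)"
          by (rule prod.cong) (auto simp: w_def)
        finally show ?thesis by simp
      qed
      \<comment> \<open>\<open>G\<close> represents F(wz) - w(m) F(z). It vanishes at all positive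
        points like \<open>F\<close>, loses the monomial \<open>m\<close>, and keeps
        \<open>m'\<close> because the exponents of \<open>v\<close> differ.\<close>
      define G where "G = (\<Sum>k\<in>Poly_Mapping.keys F.
        Poly_Mapping.single k (Poly_Mapping.lookup F k * (mev w k - mev w m)))"
      have lG: "Poly_Mapping.lookup G k = Poly_Mapping.lookup F k * (mev w k - mev w m)" for k
        by (simp add: G_def lookup_sum lookup_single when_def in_keys_iff)
      have kG: "Poly_Mapping.keys G \<subseteq> Poly_Mapping.keys F - {m}"
        by (auto simp: in_keys_iff lG)
      have "card (Poly_Mapping.keys G) < card (Poly_Mapping.keys F)"
        using m kG by (intro psubset_card_mono) auto
      moreover have "pev z G = 0" if z: "\<And>v. z v > 0" for z
      proof -
        have "pev z G = pev (\<lambda>v. w v * z v) F - mev w m * pev z F"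
          unfolding pev_superset[OF finite_keys kG[THEN subset_trans, OF Diff_subset]] lG
          by (simp add: pev_def mev_times algebra_simps sum_subtractf sum_distrib_left)
        also have "\<dots> = 0"
          using z by (simp add: less.prems w_def)
        finally show ?thesis .
      qed
      ultimately have "G = 0" by (rule less.hyps)
      then have "Poly_Mapping.lookup F m' * (mev w m' - mev w m) = 0"
        using lG[of m'] by simp
      with m' v show False by (simp add: mw in_keys_iff)
    qed
  qed
qed

lemma pev_positive_eqI:
  fixes F G :: "'v mpoly"
  assumes "\<And>z. (\<And>v. z v > 0) \<Longrightarrow> pev z F = pev z G"
  shows "F = G"
  using pev_positive_eq_0[of "F - G"] assms by simp

subsection \<open>Homogeneity\<close>

definition hdeg :: "'v set \<Rightarrow> ('v \<Rightarrow>\<^sub>0 nat) \<Rightarrow> nat" where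
  "hdeg S m = (\<Sum>v\<in>S. Poly_Mapping.lookup m v)"

text \<open>The degree is an integer because weights such as 2k - 3 are computed before they are
  known to be nonnegative; a polynomial that is homogeneous of negative degree is 0.\<close>

definition homog :: "'v set \<Rightarrow> int \<Rightarrow> 'v mpoly \<Rightarrow> bool" where
  "homog S k F \<longleftrightarrow> (\<forall>m\<in>Poly_Mapping.keys F. int (hdeg S m) = k)"

lemma hdeg_add: "hdeg S (m + m') = hdeg S m + hdeg S m'"
  by (simp add: hdeg_def lookup_add sum.distrib)

lemma homog_0 [simp]: "homog S k 0"
  by (simp add: homog_def)

lemma homog_add: "homog S k F \<Longrightarrow> homog S k G \<Longrightarrow> homog S k (F + G)"
  using Poly_Mapping.keys_add[of F G] by (fastforce simp: homog_def)

lemma homog_uminus: "homog S k F \<Longrightarrow> homog S k (- F)"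
  by (simp add: homog_def)

lemma homog_diff: "homog S k F \<Longrightarrow> homog S k G \<Longrightarrow> homog S k (F - G)"
  using homog_add[of S k F "- G"] homog_uminus by auto

lemma homog_mult: "homog S k F \<Longrightarrow> homog S l G \<Longrightarrow> homog S (k + l) (F * G)"
  using keys_mult[of F G] by (fastforce simp: homog_def hdeg_add)

lemma homog_PC: "homog S 0 (PC c)"
  by (simp add: homog_def PC_def hdeg_def)

lemma homog_1: "homog S 0 1"
  using homog_PC[of S 1] by (simp add: PC_1)

lemma homog_PX: "finite S \<Longrightarrow> homog S (if v \<in> S then 1 else 0) (PX v)"
  by (simp add: homog_def PX_def hdeg_def lookup_single when_def)

text \<open>Powers of 2 are distinct, so the single scaling factor 2 detects the degree. The factor
  \<open>2 ^ a\<close> on the left is for polynomials that arise as a quotient by something of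
  degree \<open>a\<close>.\<close>

lemma homog_scaling:
  assumes S: "finite S"
    and eq: "\<And>z. (\<And>v. z v > 0) \<Longrightarrow>
      2 ^ a * pev (\<lambda>v. (if v \<in> S then 2 else 1) * z v) F = 2 ^ b * pev z F"
  shows "homog S (int b - int a) F"
proof -
  define w where "w = (\<lambda>v. if v \<in> S then 2 else (1::real))"
  have mw: "mev w m = 2 ^ hdeg S m" for m
  proof -
    have "mev w m = (\<Prod>v\<in>Poly_Mapping.keys m \<union> S. w v ^ Poly_Mapping.lookup m v)"
      using S by (intro mev_superset) auto
    also have "\<dots> = (\<Prod>v\<in>S. w v ^ Poly_Mapping.lookup m v)"
      using S by (intro prod.mono_neutral_right) (auto simp: w_def)
    finally show ?thesis by (simp add: w_def hdeg_def power_sum)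
  qed
  define G where "G = (\<Sum>m\<in>Poly_Mapping.keys F.
    Poly_Mapping.single m (Poly_Mapping.lookup F m * (2 ^ a * 2 ^ hdeg S m - 2 ^ b)))"
  have lG: "Poly_Mapping.lookup G m = Poly_Mapping.lookup F m * (2 ^ a * 2 ^ hdeg S m - 2 ^ b)" for m
    by (simp add: G_def lookup_sum lookup_single when_def in_keys_iff)
  have "G = 0"
  proof (rule pev_positive_eq_0)
    fix z :: "'a \<Rightarrow> real" assume z: "\<And>v. z v > 0"
    have kG: "Poly_Mapping.keys G \<subseteq> Poly_Mapping.keys F" by (auto simp: in_keys_iff lG)
    have "pev z G = 2 ^ a * pev (\<lambda>v. w v * z v) F - 2 ^ b * pev z F"
      unfolding pev_superset[OF finite_keys kG] lG
      by (simp add: pev_def mev_times mw algebra_simps sum_subtractf sum_distrib_left)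
    with eq[OF z] show "pev z G = 0" by (simp add: w_def)
  qed
  then have "2 ^ (a + hdeg S m) = (2 ^ b :: real)" if "m \<in> Poly_Mapping.keys F" for m
    using that lG[of m] by (simp add: in_keys_iff power_add)
  then show ?thesis by (force simp: homog_def)
qed

text \<open>A coefficient at a monomial of degree \<open>k\<close> receives contributions only from
  summands of that degree. Summands of other degrees cancel in total and may be dropped, although
  single ones need not vanish.\<close>

lemma homog_select:
  assumes "finite K" and "homog S k F" and F: "F = (\<Sum>x\<in>K. G x)" and G: "\<And>x. x \<in> K \<Longrightarrow> homog S (d x) (G x)"
  shows "F = (\<Sum>x\<in>{x\<in>K. d x = k}. G x)"
proof (rule poly_mapping_eqI)
  fix m
  have zero: "Poly_Mapping.lookup (G x) m = 0" if "x \<in> K" "int (hdeg S m) \<noteq> d x" for x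
    using G[OF that(1)] that(2) by (auto simp: homog_def in_keys_iff)
  show "Poly_Mapping.lookup F m = Poly_Mapping.lookup (\<Sum>x\<in>{x\<in>K. d x = k}. G x) m"
  proof (cases "int (hdeg S m) = k")
    case True
    with zero have "(\<Sum>x\<in>K. Poly_Mapping.lookup (G x) m) = (\<Sum>x\<in>{x\<in>K. d x = k}. Poly_Mapping.lookup (G x) m)"
      using \<open>finite K\<close> by (intro sum.mono_neutral_right) force+
    then show ?thesis by (simp add: F lookup_sum)
  next
    case False
    with \<open>homog S k F\<close> have "Poly_Mapping.lookup F m = 0" by (auto simp: homog_def in_keys_iff)
    then show ?thesis using zero False by (auto simp: lookup_sum)
  qed
qed

subsection \<open>Partial derivatives\<close>

lift_definition pd :: "'v \<Rightarrow> 'v mpoly \<Rightarrow> 'v mpoly" is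
  "\<lambda>v F m. real (Poly_Mapping.lookup m v + 1) * F (m + Poly_Mapping.single v 1)"
proof -
  fix v :: 'v and F :: "('v \<Rightarrow>\<^sub>0 nat) \<Rightarrow> real"
  assume "finite {m. F m \<noteq> 0}"
  then have "finite ((\<lambda>m. m + Poly_Mapping.single v 1) -` {m. F m \<noteq> 0})"
    by (rule finite_vimageI) (simp add: inj_on_def)
  then show "finite {m. real (Poly_Mapping.lookup m v + 1) * F (m + Poly_Mapping.single v 1) \<noteq> 0}"
    by (rule rev_finite_subset) auto
qed

lemma pd_add [simp]: "pd v (F + G) = pd v F + pd v G"
  by (rule poly_mapping_eqI) (simp add: pd.rep_eq lookup_add algebra_simps)

lemma pd_commute: "pd u (pd v F) = pd v (pd u F)"
  by (rule poly_mapping_eqI) (auto simp: pd.rep_eq lookup_add lookup_single when_def ac_simps)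

lemma pd_0 [simp]: "pd v 0 = 0"
  by (rule poly_mapping_eqI) (simp add: pd.rep_eq)

lemma pd_PC [simp]: "pd v (PC c) = 0"
proof (rule poly_mapping_eqI)
  fix m :: "'a \<Rightarrow>\<^sub>0 nat"
  have "m + Poly_Mapping.single v 1 \<noteq> 0"
  proof
    assume "m + Poly_Mapping.single v 1 = 0"
    then have "Poly_Mapping.lookup (m + Poly_Mapping.single v 1) v = 0" by simp
    then show False by (simp add: lookup_add)
  qed
  then show "Poly_Mapping.lookup (pd v (PC c)) m = Poly_Mapping.lookup 0 m"
    by (simp add: pd.rep_eq PC_def lookup_single when_def)
qed

lemma pd_single: "pd v (Poly_Mapping.single m c) =
  Poly_Mapping.single (m - Poly_Mapping.single v 1) (real (Poly_Mapping.lookup m v) * c)"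
proof (rule poly_mapping_eqI)
  fix k :: "'a \<Rightarrow>\<^sub>0 nat"
  show "Poly_Mapping.lookup (pd v (Poly_Mapping.single m c)) k =
    Poly_Mapping.lookup (Poly_Mapping.single (m - Poly_Mapping.single v 1) (real (Poly_Mapping.lookup m v) * c)) k"
  proof (cases "Poly_Mapping.lookup m v = 0")
    case True
    then have "m \<noteq> k + Poly_Mapping.single v 1" by (auto simp: lookup_add)
    with True show ?thesis by (simp add: pd.rep_eq lookup_single when_def)
  next
    case False
    then have "m - Poly_Mapping.single v 1 = k \<longleftrightarrow> m = k + Poly_Mapping.single v 1"
      by (auto simp: poly_mapping_eq_iff fun_eq_iff lookup_add lookup_minus lookup_single when_def)
    then show ?thesis by (auto simp: pd.rep_eq lookup_single when_def lookup_add)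
  qed
qed

lemma pd_PX_mult: "pd v (PX u * F) = (if u = v then F else 0) + PX u * pd v F"
proof (induction F rule: mpoly_single_sum_induct)
  case (single m c)
  show ?case
  proof (cases "u = v")
    case True
    show ?thesis
    proof (cases "Poly_Mapping.lookup m v = 0")
      case t: True
      with True show ?thesis by (simp add: PX_def mult_single pd_single lookup_add)
    next
      case False
      then have "Poly_Mapping.single v 1 + (m - Poly_Mapping.single v 1) = m"
        by (intro poly_mapping_eqI) (auto simp: lookup_add lookup_minus lookup_single when_def)
      with True show ?thesis
        by (simp add: PX_def mult_single pd_single lookup_add algebra_simps flip: single_add)
    qed
  next
    case False
    have "Poly_Mapping.single u 1 + m - Poly_Mapping.single v 1 =
      Poly_Mapping.single u 1 + (m - Poly_Mapping.single v 1)"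
      using False by (intro poly_mapping_eqI) (auto simp: lookup_add lookup_minus lookup_single when_def)
    then show ?thesis using False
      by (simp add: PX_def mult_single pd_single lookup_add lookup_single when_def)
  qed
next
  case (sum F G)
  then show ?case by (simp add: algebra_simps)
qed

lemma pd_PX: "pd v (PX u) = (if u = v then 1 else 0)"
  using pd_PX_mult[of v u "PC 1"] pd_PC[of v 1] by (simp add: PC_1 split: if_splits)

lemma pd_PC_mult: "pd v (PC c * G) = PC c * pd v G"
  by (induction G rule: mpoly_single_sum_induct)
    (simp_all add: PC_def mult_single pd_single algebra_simps)

lemma pd_mult [simp]: "pd v (F * G) = pd v F * G + F * pd v G"
  by (induction F rule: mpoly_induct)
    (simp_all add: pd_PX_mult pd_PC_mult distrib_left distrib_right mult.assoc add.assoc)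

lemma pd_uminus [simp]: "pd v (- F) = - pd v F"
  using pd_add[of v F "- F"] by (simp add: eq_neg_iff_add_eq_0 add.commute)

lemma pd_diff [simp]: "pd v (F - G) = pd v F - pd v G"
  using pd_add[of v F "- G"] by simp

lemma pd_of_nat [simp]: "pd v (of_nat k) = 0"
  by (simp flip: PC_of_nat)

lemma pd_1 [simp]: "pd v 1 = 0"
  using pd_of_nat[of v 1] by simp

lemma pd_numeral [simp]: "pd v (numeral k) = 0"
  using pd_of_nat[of v "numeral k"] by simp

lemma pd_sum: "pd v (sum F S) = (\<Sum>x\<in>S. pd v (F x))"
  by (induction S rule: infinite_finite_induct) simp_all

lemma pd_Suc_power: "pd v (F ^ Suc k) = of_nat (Suc k) * F ^ k * pd v F"
  by (induction k) (simp_all add: algebra_simps)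

lemma homog_pd:
  assumes S: "finite S" and F: "homog S k F"
  shows "homog S (if v \<in> S then k - 1 else k) (pd v F)"
  unfolding homog_def
proof
  fix m assume "m \<in> Poly_Mapping.keys (pd v F)"
  then have "m + Poly_Mapping.single v 1 \<in> Poly_Mapping.keys F"
    by (auto simp: in_keys_iff pd.rep_eq)
  with F have "int (hdeg S (m + Poly_Mapping.single v 1)) = k" by (simp add: homog_def)
  then show "int (hdeg S m) = (if v \<in> S then k - 1 else k)"
    using S by (auto simp: hdeg_def lookup_add sum.distrib lookup_single when_def split: if_splits)
qed

lemma pd_eq_0_if_homog:
  assumes "finite S" "homog S 0 F" "v \<in> S"
  shows "pd v F = 0"
  using homog_pd[OF assms(1,2), of v] assms(3) by (auto simp: homog_def)

lemma PX_mult_pd_single: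
  "PX v * pd v (Poly_Mapping.single m c) = Poly_Mapping.single m (real (Poly_Mapping.lookup m v) * c)"
proof (cases "Poly_Mapping.lookup m v = 0")
  case False
  then have "Poly_Mapping.single v 1 + (m - Poly_Mapping.single v 1) = m"
    by (intro poly_mapping_eqI) (auto simp: lookup_add lookup_minus lookup_single when_def)
  then show ?thesis by (simp add: PX_def pd_single mult_single)
qed (simp add: pd_single)

lemma euler:
  assumes "finite S" "homog S k F"
  shows "(\<Sum>v\<in>S. PX v * pd v F) = of_int k * F"
proof -
  have F: "F = (\<Sum>m\<in>Poly_Mapping.keys F. Poly_Mapping.single m (Poly_Mapping.lookup F m))"
    by (rule poly_mapping_eqI) (simp add: lookup_sum lookup_single when_def in_keys_iff)
  have "(\<Sum>v\<in>S. PX v * pd v F) = (\<Sum>v\<in>S. \<Sum>m\<in>Poly_Mapping.keys F.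
      PX v * pd v (Poly_Mapping.single m (Poly_Mapping.lookup F m)))"
    unfolding sum_distrib_left[symmetric] pd_sum[symmetric] F[symmetric] ..
  also have "\<dots> = (\<Sum>m\<in>Poly_Mapping.keys F. \<Sum>v\<in>S.
      Poly_Mapping.single m (real (Poly_Mapping.lookup m v) * Poly_Mapping.lookup F m))"
    unfolding PX_mult_pd_single by (rule sum.swap)
  also have "\<dots> = (\<Sum>m\<in>Poly_Mapping.keys F. Poly_Mapping.single m (of_int k * Poly_Mapping.lookup F m))"
  proof (rule sum.cong[OF refl])
    fix m assume m: "m \<in> Poly_Mapping.keys F"
    have "(\<Sum>v\<in>S. Poly_Mapping.single m (real (Poly_Mapping.lookup m v) * Poly_Mapping.lookup F m))
      = Poly_Mapping.single m (\<Sum>v\<in>S. real (Poly_Mapping.lookup m v) * Poly_Mapping.lookup F m)"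
      by (induction S rule: infinite_finite_induct) (simp_all add: single_add)
    also have "(\<Sum>v\<in>S. real (Poly_Mapping.lookup m v) * Poly_Mapping.lookup F m)
      = real (hdeg S m) * Poly_Mapping.lookup F m"
      by (simp add: hdeg_def sum_distrib_right)
    also have "real (hdeg S m) = of_int k"
      using m assms(2) by (auto simp: homog_def)
    finally show "(\<Sum>v\<in>S. Poly_Mapping.single m (real (Poly_Mapping.lookup m v) * Poly_Mapping.lookup F m))
      = Poly_Mapping.single m (of_int k * Poly_Mapping.lookup F m)" .
  qed
  also have "\<dots> = (\<Sum>m\<in>Poly_Mapping.keys F. PC (of_int k) * Poly_Mapping.single m (Poly_Mapping.lookup F m))"
    by (simp add: PC_def mult_single del: single_of_int)
  also have "\<dots> = PC (of_int k) * (\<Sum>m\<in>Poly_Mapping.keys F. Poly_Mapping.single m (Poly_Mapping.lookup F m))"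
    by (simp only: sum_distrib_left)
  also have "\<dots> = of_int k * F"
    by (simp only: F[symmetric] PC_of_int)
  finally show ?thesis .
qed

text \<open>Links formal derivatives with real ones, in order to turn invariance under a
  one-parameter group of translations into a differential equation.\<close>

lemma pev_has_derivative:
  assumes S: "finite S" "\<And>v. v \<notin> S \<Longrightarrow> \<eta> v = 0"
  shows "((\<lambda>t. pev (\<lambda>v. z v + t * \<eta> v) F) has_real_derivative (\<Sum>v\<in>S. \<eta> v * pev z (pd v F))) (at 0)"
proof (induction F rule: mpoly_induct)
  case (var u F)
  have "(\<Sum>v\<in>S. \<eta> v * pev z (pd v (PX u * F))) =
    \<eta> u * pev z F + z u * (\<Sum>v\<in>S. \<eta> v * pev z (pd v F))"
  proof -
    have "(\<Sum>v\<in>S. \<eta> v * pev z (pd v (PX u * F))) =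
      (\<Sum>v\<in>S. if v = u then \<eta> v * pev z F else 0) + z u * (\<Sum>v\<in>S. \<eta> v * pev z (pd v F))"
      unfolding sum_distrib_left sum.distrib[symmetric]
      by (rule sum.cong) (auto simp: pd_PX algebra_simps)
    also have "(\<Sum>v\<in>S. if v = u then \<eta> v * pev z F else 0) = \<eta> u * pev z F"
      using S by (cases "u \<in> S") auto
    finally show ?thesis .
  qed
  moreover have "((\<lambda>t. (z u + t * \<eta> u) * pev (\<lambda>v. z v + t * \<eta> v) F) has_real_derivative
    \<eta> u * pev z F + z u * (\<Sum>v\<in>S. \<eta> v * pev z (pd v F))) (at 0)"
    using var by (auto intro!: derivative_eq_intros simp: algebra_simps)
  ultimately show ?case by simp
next
  case (add F G)
  then show ?case by (auto intro!: derivative_eq_intros simp: algebra_simps sum.distrib)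
qed simp

section \<open>Brackets and contractions\<close>

text \<open>One ring contains the coordinates of points, auxiliary vectors and covectors and the
  entries of a generic 3 x 3 matrix; the second index counts coordinates from 0. The covectors
  \<open>GL\<close> carry no relation to \<open>GA\<close> and \<open>GV\<close>.\<close>

datatype gvar = GA nat nat | GV nat nat | GL nat nat | GT nat nat

instance gvar :: countable
  by countable_datatype

text \<open>The order itself is irrelevant: the library proves that the polynomial ring is a domain
  only for linearly ordered variables.\<close>

instantiation gvar :: linorder
begin

definition "less_eq_gvar (x :: gvar) (y :: gvar) \<longleftrightarrow> to_nat x \<le> to_nat y"
definition "less_gvar (x :: gvar) (y :: gvar) \<longleftrightarrow> to_nat x < to_nat y"

instance
  by standard (auto simp: less_eq_gvar_def less_gvar_def)

end

type_synonym gpoly = "gvar mpoly"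

definition dot3 :: "(nat \<Rightarrow> 'a::comm_ring_1) \<Rightarrow> (nat \<Rightarrow> 'a) \<Rightarrow> 'a" where
  "dot3 u w = u 0 * w 0 + u 1 * w 1 + u 2 * w 2"

definition crs :: "(nat \<Rightarrow> 'a::comm_ring_1) \<Rightarrow> (nat \<Rightarrow> 'a) \<Rightarrow> nat \<Rightarrow> 'a" where
  "crs u w c = (if c = 0 then u 1 * w 2 - u 2 * w 1
     else if c = 1 then u 2 * w 0 - u 0 * w 2 else u 0 * w 1 - u 1 * w 0)"

definition br :: "(nat \<Rightarrow> 'a::comm_ring_1) \<Rightarrow> (nat \<Rightarrow> 'a) \<Rightarrow> (nat \<Rightarrow> 'a) \<Rightarrow> 'a" where
  "br u v w = dot3 u (crs v w)"

lemmas vec_defs = br_def dot3_def crs_def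

datatype sym = SA nat | SV nat

fun sidx :: "sym \<Rightarrow> nat" where
  "sidx (SA i) = i"
| "sidx (SV i) = i"

fun svar :: "sym \<Rightarrow> nat \<Rightarrow> gvar" where
  "svar (SA i) c = GA i c"
| "svar (SV i) c = GV i c"

definition sv :: "sym \<Rightarrow> nat \<Rightarrow> gpoly" where "sv W c = PX (svar W c)"
definition lv :: "nat \<Rightarrow> nat \<Rightarrow> gpoly" where "lv i c = PX (GL i c)"
definition tv :: "nat \<Rightarrow> nat \<Rightarrow> gpoly" where "tv r c = PX (GT r c)"

lemma svar_neq [simp]: "svar W c \<noteq> GL i e" "svar W c \<noteq> GT i e"
  by (cases W; simp)+

lemma svar_eq [simp]: "svar W c = GA i e \<longleftrightarrow> W = SA i \<and> c = e" "svar W c = GV i e \<longleftrightarrow> W = SV i \<and> c = e"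
  by (cases W; auto)+

lemma pd_vecs [simp]:
  "pd (GT r e) (sv W c) = 0" "pd (GL i e) (sv W c) = 0"
  "pd (GA i e) (sv W c) = (if W = SA i \<and> c = e then 1 else 0)"
  "pd (GV i e) (sv W c) = (if W = SV i \<and> c = e then 1 else 0)"
  "pd (GT r e) (tv q c) = (if q = r \<and> c = e then 1 else 0)"
  "pd (GA i e) (lv j c) = 0" "pd (GV i e) (lv j c) = 0"
  by (simp_all add: sv_def lv_def tv_def pd_PX)

text \<open>The generators in the first fundamental theorem for SL(3) with vectors and covectors.
  They are kept as syntax so that the letters of a product can be counted regardless of its
  value.\<close>

datatype gen = Br sym sym sym | Co nat sym | De nat nat nat

fun gval :: "gen \<Rightarrow> gpoly" where
  "gval (Br U V W) = br (sv U) (sv V) (sv W)"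
| "gval (Co i W) = dot3 (lv i) (sv W)"
| "gval (De i j k) = br (lv i) (lv j) (lv k)"

fun gidx :: "gen \<Rightarrow> nat set" where
  "gidx (Br U V W) = {sidx U, sidx V, sidx W}"
| "gidx (Co i W) = {i, sidx W}"
| "gidx (De i j k) = {i, j, k}"

text \<open>One generator is multiplied at a time, so closure under a differential operator reduces
  to the generators and a product rule.\<close>

inductive_set Nalg :: "nat set \<Rightarrow> gpoly set" for J where
  const: "PC c \<in> Nalg J"
| add: "x \<in> Nalg J \<Longrightarrow> y \<in> Nalg J \<Longrightarrow> x + y \<in> Nalg J"
| mult: "gidx g \<subseteq> J \<Longrightarrow> x \<in> Nalg J \<Longrightarrow> gval g * x \<in> Nalg J"

lemma Nalg_mult: "x \<in> Nalg J \<Longrightarrow> y \<in> Nalg J \<Longrightarrow> x * y \<in> Nalg J"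
proof (induction x rule: Nalg.induct)
  case (const c)
  from const show ?case
  proof (induction y rule: Nalg.induct)
    case (mult g x)
    then show ?case using Nalg.mult[of g J "PC c * x"] by (simp add: mult.left_commute)
  qed (auto simp: distrib_left simp flip: PC_mult intro: Nalg.intros)
qed (auto simp: distrib_right mult.assoc intro: Nalg.intros)

lemma Nalg_1: "1 \<in> Nalg J" and Nalg_0: "0 \<in> Nalg J"
  using Nalg.const[of 1 J] Nalg.const[of 0 J] by (simp_all add: PC_0 PC_1)

lemma Nalg_gval: "gidx g \<subseteq> J \<Longrightarrow> gval g \<in> Nalg J"
  using Nalg.mult[OF _ Nalg_1] by simp

lemma Nalg_uminus: "x \<in> Nalg J \<Longrightarrow> - x \<in> Nalg J"
  using Nalg_mult[OF Nalg.const[of "-1" J]] by (simp add: PC_uminus PC_1)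

lemma Nalg_diff: "x \<in> Nalg J \<Longrightarrow> y \<in> Nalg J \<Longrightarrow> x - y \<in> Nalg J"
  using Nalg.add[of x J "- y"] Nalg_uminus by simp

section \<open>The first fundamental theorem for vectors, by Cayley's Omega process\<close>

abbreviation td :: "nat \<Rightarrow> nat \<Rightarrow> gpoly \<Rightarrow> gpoly" where "td r c \<equiv> pd (GT r c)"

definition tform :: "sym \<Rightarrow> nat \<Rightarrow> gpoly" where "tform W r = dot3 (tv r) (sv W)"

text \<open>The polynomials in the coordinates \<open>tform W r\<close> of TW contain every f(TA,
  Tv). The brackets are adjoined because differentiation in T brings them out of these
  coordinates.\<close>

inductive_set Malg :: "nat set \<Rightarrow> gpoly set" for J where
  const: "PC c \<in> Malg J"
| add: "x \<in> Malg J \<Longrightarrow> y \<in> Malg J \<Longrightarrow> x + y \<in> Malg J"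
| mult_br: "sidx U \<in> J \<Longrightarrow> sidx V \<in> J \<Longrightarrow> sidx W \<in> J \<Longrightarrow> x \<in> Malg J \<Longrightarrow>
    br (sv U) (sv V) (sv W) * x \<in> Malg J"
| mult_form: "sidx W \<in> J \<Longrightarrow> r < 3 \<Longrightarrow> x \<in> Malg J \<Longrightarrow> tform W r * x \<in> Malg J"

lemma Malg_mult: "x \<in> Malg J \<Longrightarrow> y \<in> Malg J \<Longrightarrow> x * y \<in> Malg J"
proof (induction x rule: Malg.induct)
  case (const c)
  from const show ?case
  proof (induction y rule: Malg.induct)
    case (mult_br U V W x)
    then show ?case using Malg.mult_br[of U J V W "PC c * x"] by (simp add: mult.left_commute)
  next
    case (mult_form W r x)
    then show ?case using Malg.mult_form[of W J r "PC c * x"] by (simp add: mult.left_commute)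
  qed (auto simp: distrib_left simp flip: PC_mult intro: Malg.intros)
qed (auto simp: distrib_right mult.assoc intro: Malg.intros)

lemma Malg_1: "1 \<in> Malg J" and Malg_0: "0 \<in> Malg J"
  using Malg.const[of 1 J] Malg.const[of 0 J] by (simp_all add: PC_0 PC_1)

lemma Malg_uminus: "x \<in> Malg J \<Longrightarrow> - x \<in> Malg J"
  using Malg_mult[OF Malg.const[of "-1" J]] by (simp add: PC_uminus PC_1)

lemma Malg_diff: "x \<in> Malg J \<Longrightarrow> y \<in> Malg J \<Longrightarrow> x - y \<in> Malg J"
  using Malg.add[of x J "- y"] Malg_uminus by simp

text \<open>The operators \<open>(u \<times> w) \<cdot> \<partial>\<^sub>r\<close>, \<open>u \<cdot> (\<partial>\<^sub>r \<times> \<partial>\<^sub>s)\<close> and \<open>\<partial>\<^sub>0 \<cdot> (\<partial>\<^sub>1 \<times> \<partial>\<^sub>2)\<close>, where \<open>\<partial>\<^sub>r\<close> is the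
  gradient in row \<open>r\<close> of the matrix of variables \<open>GT\<close>; the last one is Cayley's Omega.\<close>

definition KO :: "nat \<Rightarrow> (nat \<Rightarrow> gpoly) \<Rightarrow> gpoly \<Rightarrow> gpoly" where
  "KO r u x = dot3 u (\<lambda>c. td r c x)"

definition TT :: "nat \<Rightarrow> nat \<Rightarrow> nat \<Rightarrow> gpoly \<Rightarrow> gpoly" where
  "TT r s c x = (if c = 0 then td r 1 (td s 2 x) - td r 2 (td s 1 x)
     else if c = 1 then td r 2 (td s 0 x) - td r 0 (td s 2 x)
     else td r 0 (td s 1 x) - td r 1 (td s 0 x))"

definition EO :: "nat \<Rightarrow> nat \<Rightarrow> (nat \<Rightarrow> gpoly) \<Rightarrow> gpoly \<Rightarrow> gpoly" where
  "EO r s u x = dot3 u (\<lambda>c. TT r s c x)"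

definition Om :: "gpoly \<Rightarrow> gpoly" where
  "Om x = td 0 0 (TT 1 2 0 x) + td 0 1 (TT 1 2 1 x) + td 0 2 (TT 1 2 2 x)"

lemma pd_br_sv [simp]: "pd (GT r c) (br (sv U) (sv V) (sv W)) = 0"
  by (simp add: vec_defs)

lemma pd_tform: "c < 3 \<Longrightarrow> td r c (tform W q) = (if q = r then sv W c else 0)"
  by (cases "c = 0"; cases "c = 1"; cases "c = 2") (auto simp: tform_def dot3_def)

text \<open>Moving \<open>KO\<close>, \<open>EO\<close> or \<open>Om\<close>, of order 1, 2 and 3,
  past a coordinate of TW leaves terms of one order less. The lowest such term is a bracket, so
  closure passes from brackets to \<open>KO\<close>, then to \<open>EO\<close> and to
  \<open>Om\<close>.\<close>

lemma KO_closed: "x \<in> Malg J \<Longrightarrow> sidx U \<in> J \<Longrightarrow> sidx V \<in> J \<Longrightarrow> KO r (crs (sv U) (sv V)) x \<in> Malg J"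
proof (induction x rule: Malg.induct)
  case (const c)
  then show ?case using Malg_0 by (simp add: KO_def dot3_def)
next
  case (add x y)
  have "KO r u (x + y) = KO r u x + KO r u y" for u
    by (simp add: KO_def dot3_def algebra_simps)
  with add show ?case by (auto intro: Malg.intros)
next
  case (mult_br U' V' W x)
  have "KO r u (br (sv U') (sv V') (sv W) * x) = br (sv U') (sv V') (sv W) * KO r u x" for u
    by (simp add: KO_def dot3_def algebra_simps)
  with mult_br show ?case by (auto intro: Malg.intros)
next
  case (mult_form W q x)
  have "KO r (crs (sv U) (sv V)) (tform W q * x) =
    tform W q * KO r (crs (sv U) (sv V)) x + (if q = r then br (sv W) (sv U) (sv V) * x else 0)"
    by (simp add: KO_def pd_tform br_def dot3_def algebra_simps)
  with mult_form show ?case using Malg_0 by (auto intro!: Malg.intros)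
qed

lemma EO_closed: "x \<in> Malg J \<Longrightarrow> sidx U \<in> J \<Longrightarrow> r \<noteq> s \<Longrightarrow> EO r s (sv U) x \<in> Malg J"
proof (induction x rule: Malg.induct)
  case (const c)
  then show ?case using Malg_0 by (simp add: EO_def TT_def dot3_def)
next
  case (add x y)
  have "EO r s u (x + y) = EO r s u x + EO r s u y" for u
    by (simp add: EO_def TT_def dot3_def algebra_simps)
  with add show ?case by (auto intro: Malg.intros)
next
  case (mult_br U' V' W x)
  have "EO r s u (br (sv U') (sv V') (sv W) * x) = br (sv U') (sv V') (sv W) * EO r s u x" for u
    by (simp add: EO_def TT_def dot3_def algebra_simps)
  with mult_br show ?case by (auto intro: Malg.intros)
next
  case (mult_form W q x)
  have "EO r s (sv U) (tform W q * x) = tform W q * EO r s (sv U) x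
    + (if q = r then KO s (crs (sv U) (sv W)) x else 0)
    + (if q = s then KO r (crs (sv W) (sv U)) x else 0)"
    using \<open>r \<noteq> s\<close> by (simp add: EO_def TT_def KO_def pd_tform dot3_def crs_def algebra_simps)
  with mult_form show ?case
    by (auto intro!: Malg.add Malg.mult_form KO_closed simp: Malg_0)
qed

lemma Om_add: "Om (x + y) = Om x + Om y"
  by (simp add: Om_def TT_def algebra_simps)

lemma Om_mult_const:
  assumes "\<And>r c. td r c f = 0"
  shows "Om (f * x) = f * Om x"
  by (simp add: Om_def TT_def algebra_simps assms)

lemma Om_closed: "x \<in> Malg J \<Longrightarrow> Om x \<in> Malg J"
proof (induction x rule: Malg.induct)
  case (const c)
  then show ?case using Malg_0 by (simp add: Om_def TT_def)
next
  case (add x y)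
  then show ?case by (auto simp: Om_add intro: Malg.intros)
next
  case (mult_br U' V' W x)
  then show ?case by (subst Om_mult_const) (auto intro: Malg.intros)
next
  case (mult_form W q x)
  \<comment> \<open>Differentiating the coordinate in row \<open>q\<close> leaves the other two rows
    in cyclic order; for \<open>q = 1\<close> this is the order 2, 0, whence the sign.\<close>
  have "Om (tform W q * x) = tform W q * Om x
    + (if q = 0 then EO 1 2 (sv W) x else 0)
    + (if q = 1 then - EO 0 2 (sv W) x else 0)
    + (if q = 2 then EO 0 1 (sv W) x else 0)"
    by (simp add: Om_def EO_def TT_def pd_tform dot3_def algebra_simps)
  with mult_form show ?case
    by (auto intro!: Malg.add Malg.mult_form EO_closed Malg_diff Malg_uminus simp: Malg_0)
qed

definition Tdet :: gpoly where "Tdet = br (tv 0) (tv 1) (tv 2)"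

lemma td_Tdet:
  "td 0 c Tdet = (if c < 3 then crs (tv 1) (tv 2) c else 0)"
  "td (Suc 0) c Tdet = (if c < 3 then crs (tv 2) (tv 0) c else 0)"
  "td 2 c Tdet = (if c < 3 then crs (tv 0) (tv 1) c else 0)"
  by (auto simp: Tdet_def vec_defs)

lemma Om_Tdet: "Om Tdet = 6"
  by (simp add: Om_def TT_def td_Tdet crs_def)

lemma Om_Tdet_power2: "Om (Tdet ^ Suc (Suc 0)) = 24 * Tdet"
  by (simp add: Om_def TT_def td_Tdet crs_def)
    (simp add: Tdet_def vec_defs algebra_simps)

text \<open>Cayley's identity: Omega sends det^s to s(s+1)(s+2) det^(s-1), here with s = q + 3.
  Third derivatives involve det^(s-3), so the exponents 1 and 2 are treated apart. With
  \<open>Tdet ^ q\<close> and \<open>q\<close> as indeterminates the claim is a polynomial identity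
  in the nine entries.\<close>

lemma Om_Tdet_power3:
  "Om (Tdet ^ Suc (Suc (Suc q))) = (of_nat q + 3) * (of_nat q + 4) * (of_nat q + 5) * Tdet ^ Suc (Suc q)"
proof -
  define x where "x = Tdet ^ q"
  define k where "k = (of_nat q :: gpoly)"
  have px: "Tdet ^ Suc q = Tdet * x" "Tdet ^ Suc (Suc q) = Tdet * (Tdet * x)"
    by (simp_all add: x_def)
  have pk: "of_nat (Suc q) = k + 1" "of_nat (Suc (Suc q)) = k + 2" "of_nat (Suc (Suc (Suc q))) = k + 3"
    by (simp_all add: k_def)
  show ?thesis
    apply (simp add: Om_def TT_def pd_Suc_power td_Tdet crs_def del: power_Suc of_nat_Suc)
    apply (simp only: px pk x_def[symmetric] k_def[symmetric])
    apply (simp add: Tdet_def vec_defs)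
    apply algebra
    done
qed


lemma Om_funpow:
  assumes f: "\<And>r c. td r c f = 0"
  shows "\<exists>c. c > 0 \<and> (Om ^^ p) (Tdet ^ p * f) = PC c * f"
proof (induction p)
  case 0
  then show ?case by (intro exI[of _ 1]) (simp add: PC_1)
next
  case (Suc p)
  have "\<exists>c>0. Om (Tdet ^ Suc p) = PC c * Tdet ^ p"
  proof -
    consider "p = 0" | "p = 1" | q where "p = Suc (Suc q)" by (metis One_nat_def not0_implies_Suc)
    then show ?thesis
    proof cases
      case 1
      then show ?thesis by (intro exI[of _ 6]) (simp add: Om_Tdet PC_numeral)
    next
      case 2
      then show ?thesis using Om_Tdet_power2 by (intro exI[of _ 24]) (simp add: PC_numeral)
    next
      case 3
      let ?c = "real ((q + 3) * (q + 4) * (q + 5))"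
      have "(of_nat q + 3) * (of_nat q + 4) * (of_nat q + 5) = (PC ?c :: gpoly)"
        unfolding PC_of_nat by simp
      with 3 show ?thesis using Om_Tdet_power3[of q] by (intro exI[of _ ?c]) (simp del: power_Suc)
    qed
  qed
  then obtain c where c: "c > 0" "Om (Tdet ^ Suc p) = PC c * Tdet ^ p" by blast
  from Suc obtain c' where c': "c' > 0" "(Om ^^ p) (Tdet ^ p * f) = PC c' * f" by blast
  have pull: "(Om ^^ j) (PC c * y) = PC c * (Om ^^ j) y" for j y
    by (induction j) (simp_all add: Om_mult_const)
  have "(Om ^^ Suc p) (Tdet ^ Suc p * f) = (Om ^^ p) (Om (f * Tdet ^ Suc p))"
    by (simp add: funpow_Suc_right mult.commute del: funpow.simps power_Suc)
  also have "Om (f * Tdet ^ Suc p) = PC c * (Tdet ^ p * f)"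
    using f by (simp add: Om_mult_const c mult_ac del: power_Suc)
  also have "(Om ^^ p) (PC c * (Tdet ^ p * f)) = PC (c * c') * f"
    by (simp add: pull c' PC_mult mult.assoc)
  finally show ?case using c c' by (intro exI[of _ "c * c'"]) simp
qed

lemma Malg_if_Tdet_power:
  assumes f: "\<And>r c. td r c f = 0" and M: "Tdet ^ p * f \<in> Malg J"
  shows "f \<in> Malg J"
proof -
  obtain c where c: "c > 0" "(Om ^^ p) (Tdet ^ p * f) = PC c * f"
    using Om_funpow[OF f] by blast
  have "(Om ^^ q) (Tdet ^ p * f) \<in> Malg J" for q
    by (induction q) (simp_all add: M Om_closed)
  then have "PC (1 / c) * (PC c * f) \<in> Malg J"
    unfolding c(2)[symmetric] by (intro Malg_mult Malg.const)
  also have "PC (1 / c) * (PC c * f) = PC (1 / c * c) * f"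
    by (simp only: PC_mult mult.assoc)
  finally show ?thesis using c(1) by (simp add: PC_1)
qed

text \<open>At T = 0 every coordinate of TW vanishes, so only words made of brackets alone survive.
  For a polynomial that does not contain T this loses nothing.\<close>

lemma Malg_at_0:
  assumes "x \<in> Malg J"
  shows "\<exists>y\<in>Nalg J. \<forall>\<zeta>. (\<forall>r c. \<zeta> (GT r c) = 0) \<longrightarrow> pev \<zeta> x = pev \<zeta> y"
  using assms
proof (induction x rule: Malg.induct)
  case (const c)
  then show ?case by (intro bexI[of _ "PC c"] Nalg.intros) auto
next
  case (add x y)
  then obtain x' y' where "x' \<in> Nalg J" "\<forall>\<zeta>. (\<forall>r c. \<zeta> (GT r c) = 0) \<longrightarrow> pev \<zeta> x = pev \<zeta> x'"
    "y' \<in> Nalg J" "\<forall>\<zeta>. (\<forall>r c. \<zeta> (GT r c) = 0) \<longrightarrow> pev \<zeta> y = pev \<zeta> y'" by blast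
  then show ?case by (intro bexI[of _ "x' + y'"] Nalg.intros) auto
next
  case (mult_br U V W x)
  then obtain x' where "x' \<in> Nalg J" "\<forall>\<zeta>. (\<forall>r c. \<zeta> (GT r c) = 0) \<longrightarrow> pev \<zeta> x = pev \<zeta> x'" by blast
  with mult_br Nalg.mult[of "Br U V W" J x'] show ?case
    by (intro bexI[of _ "br (sv U) (sv V) (sv W) * x'"]) auto
next
  case (mult_form W r x)
  then show ?case using Nalg_0
    by (intro bexI[of _ 0]) (auto simp: tform_def dot3_def tv_def)
qed

text \<open>Invariance enters through \<open>M\<close>: f(TA, Tv) lies in \<open>Malg\<close> by
  construction, and for an invariant of weight \<open>p\<close> it equals det(T)^p f.\<close>

theorem fft_vectors:
  assumes f: "\<And>r c. homog {GT r c} 0 f" and M: "Tdet ^ p * f \<in> Malg J"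
  shows "f \<in> Nalg J"
proof -
  have "td r c f = 0" for r c
    using f[of r c] by (intro pd_eq_0_if_homog[of "{GT r c}"]) auto
  then have "f \<in> Malg J" using M by (rule Malg_if_Tdet_power)
  then obtain y where y: "y \<in> Nalg J" "\<And>\<zeta>. (\<forall>r c. \<zeta> (GT r c) = 0) \<Longrightarrow> pev \<zeta> f = pev \<zeta> y"
    using Malg_at_0 by meson
  define \<tau> where "\<tau> = (\<lambda>(\<zeta> :: gvar \<Rightarrow> real) v. case v of GT r c \<Rightarrow> 0 | _ \<Rightarrow> \<zeta> v)"
  have yT: "pev (\<tau> \<zeta>) y = pev \<zeta> y" for \<zeta>
    using y(1)
  proof (induction y rule: Nalg.induct)
    case (mult g x)
    have "pev (\<tau> \<zeta>) (gval g) = pev \<zeta> (gval g)"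
    proof -
      have "\<tau> \<zeta> (svar W c) = \<zeta> (svar W c)" "\<tau> \<zeta> (GL i c) = \<zeta> (GL i c)" for W i c
        by (cases W; simp add: \<tau>_def)+
      then show ?thesis by (cases g) (simp_all add: vec_defs sv_def lv_def)
    qed
    with mult show ?case by simp
  qed auto
  have fT: "pev (\<tau> \<zeta>) f = pev \<zeta> f" for \<zeta>
  proof (rule pev_cong)
    fix m v assume "m \<in> Poly_Mapping.keys f" "v \<in> Poly_Mapping.keys m"
    with f have "v \<noteq> GT r c" for r c
      by (auto simp: homog_def hdeg_def in_keys_iff)
    then show "\<tau> \<zeta> v = \<zeta> v" by (auto simp: \<tau>_def split: gvar.split)
  qed
  have "f = y"
  proof (rule pev_positive_eqI)
    fix \<zeta> :: "gvar \<Rightarrow> real"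
    have "pev (\<tau> \<zeta>) f = pev (\<tau> \<zeta>) y" by (rule y) (simp add: \<tau>_def)
    then show "pev \<zeta> f = pev \<zeta> y" by (simp add: fT yT)
  qed
  with y show ?thesis by simp
qed

section \<open>Invariants of a flag, by Capelli's identity\<close>

text \<open>Covariants of covector type: the gradients of invariants with respect to a vector lie in
  this module over \<open>Nalg\<close>. Vectors are functions on \<open>nat\<close> of which only
  the coordinates 0, 1, 2 count, whence the rule \<open>ext\<close>.\<close>

inductive_set Cov :: "nat set \<Rightarrow> (nat \<Rightarrow> gpoly) set" for J where
  crs: "sidx U \<in> J \<Longrightarrow> sidx V \<in> J \<Longrightarrow> crs (sv U) (sv V) \<in> Cov J"
| lv: "j \<in> J \<Longrightarrow> lv j \<in> Cov J"
| add: "\<phi> \<in> Cov J \<Longrightarrow> \<psi> \<in> Cov J \<Longrightarrow> (\<lambda>c. \<phi> c + \<psi> c) \<in> Cov J"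
| scale: "x \<in> Nalg J \<Longrightarrow> \<phi> \<in> Cov J \<Longrightarrow> (\<lambda>c. x * \<phi> c) \<in> Cov J"
| ext: "\<phi> \<in> Cov J \<Longrightarrow> (\<And>c. c < 3 \<Longrightarrow> \<psi> c = \<phi> c) \<Longrightarrow> \<psi> \<in> Cov J"
| zero: "(\<lambda>c. 0) \<in> Cov J"

lemma Nalg_gens:
  "sidx U \<in> J \<Longrightarrow> sidx V \<in> J \<Longrightarrow> sidx W \<in> J \<Longrightarrow> br (sv U) (sv V) (sv W) \<in> Nalg J"
  "j \<in> J \<Longrightarrow> sidx U \<in> J \<Longrightarrow> dot3 (lv j) (sv U) \<in> Nalg J"
  "i \<in> J \<Longrightarrow> j \<in> J \<Longrightarrow> k \<in> J \<Longrightarrow> br (lv i) (lv j) (lv k) \<in> Nalg J"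
  using Nalg_gval[of "Br U V W" J] Nalg_gval[of "Co j U" J] Nalg_gval[of "De i j k" J] by auto

lemma br_crs_crs: "br l (crs u v) (crs u' v') = dot3 l u' * br v' u v - dot3 l v' * br u' u v"
  by (simp add: vec_defs algebra_simps)

lemma br_crs: "br l (crs u v) m = dot3 l v * dot3 m u - dot3 l u * dot3 m v"
  by (simp add: vec_defs algebra_simps)

lemma br_swap: "br l m w = - br l w m"
  by (simp add: vec_defs algebra_simps)

lemma br_lincomb:
  "br l (\<lambda>c. \<phi> c + \<phi>' c) \<psi> = br l \<phi> \<psi> + br l \<phi>' \<psi>" "br l (\<lambda>c. x * \<phi> c) \<psi> = x * br l \<phi> \<psi>"
  "br l \<psi> (\<lambda>c. \<phi> c + \<phi>' c) = br l \<psi> \<phi> + br l \<psi> \<phi>'" "br l \<psi> (\<lambda>c. x * \<phi> c) = x * br l \<psi> \<phi>"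
  "br l (\<lambda>c. 0) \<psi> = 0" "br l \<psi> (\<lambda>c. 0) = 0"
  by (simp_all add: vec_defs algebra_simps)

lemma br_ext: "(\<And>c. c < 3 \<Longrightarrow> \<psi> c = \<phi> c) \<Longrightarrow> br l \<psi> w = br l \<phi> w"
  "(\<And>c. c < 3 \<Longrightarrow> \<psi> c = \<phi> c) \<Longrightarrow> br l w \<psi> = br l w \<phi>"
  by (simp_all add: vec_defs)

text \<open>A bracket of covectors in which a cross product occurs expands into contractions and
  brackets of vectors, and three rows \<open>lv\<close> form a generator. Thus the mixed terms in
  the product rule of \<open>DO\<close> create no new kind of invariant.\<close>

lemma br_Cov:
  assumes i: "i \<in> J" and "\<phi> \<in> Cov J" "\<psi> \<in> Cov J"
  shows "br (lv i) \<phi> \<psi> \<in> Nalg J"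
  using assms(2)
proof (induction \<phi> rule: Cov.induct)
  case (crs U V)
  from assms(3) show ?case
  proof (induction \<psi> rule: Cov.induct)
    case (crs U' V')
    show ?case unfolding br_crs_crs
      using crs \<open>sidx U \<in> J\<close> \<open>sidx V \<in> J\<close> i by (intro Nalg_diff Nalg_mult Nalg_gens)
  next
    case (lv j)
    show ?case unfolding br_crs
      using lv \<open>sidx U \<in> J\<close> \<open>sidx V \<in> J\<close> i by (intro Nalg_diff Nalg_mult Nalg_gens)
  next
    case (ext \<phi> \<psi>)
    then show ?case using br_ext(2)[of \<psi> \<phi>] by simp
  qed (auto simp: br_lincomb Nalg_0 intro: Nalg.add Nalg_mult)
next
  case (lv j)
  from assms(3) show ?case
  proof (induction \<psi> rule: Cov.induct)
    case (crs U' V')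
    show ?case unfolding br_swap[of _ "lv j"] br_crs
      using crs \<open>j \<in> J\<close> i by (intro Nalg_uminus Nalg_diff Nalg_mult Nalg_gens)
  next
    case (lv k)
    then show ?case using \<open>j \<in> J\<close> i by (intro Nalg_gens)
  next
    case (ext \<phi> \<psi>)
    then show ?case using br_ext(2)[of \<psi> \<phi>] by simp
  qed (auto simp: br_lincomb Nalg_0 intro: Nalg.add Nalg_mult)
next
  case (ext \<phi> \<psi>)
  then show ?case using br_ext(1)[of \<psi> \<phi>] by simp
qed (auto simp: br_lincomb Nalg_0 intro: Nalg.add Nalg_mult)

lemma less_3_cases: "(c::nat) < 3 \<Longrightarrow> (c = 0 \<Longrightarrow> P) \<Longrightarrow> (c = 1 \<Longrightarrow> P) \<Longrightarrow> (c = 2 \<Longrightarrow> P) \<Longrightarrow> P"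
  by linarith

lemma gradient_gval:
  assumes g: "gidx g \<subseteq> J" and X: "X = GA i \<and> S = SA i \<or> X = GV i \<and> S = SV i"
  shows "(\<lambda>c. pd (X c) (gval g)) \<in> Cov J"
proof -
  have Xs: "pd (X e) (sv W c) = (if W = S \<and> c = e then 1 else 0)" "pd (X e) (lv j c) = 0" for e W c j
    using X by auto
  have ind: "(if b then 1 else 0) \<in> Nalg J" for b :: bool
    using Nalg_0 Nalg_1 by auto
  show ?thesis
  proof (cases g)
    case (Br U V W)
    show ?thesis
    proof (rule Cov.ext)
      show "(\<lambda>c. (if U = S then 1 else 0) * crs (sv V) (sv W) c +
          ((if V = S then 1 else 0) * crs (sv W) (sv U) c +
           (if W = S then 1 else 0) * crs (sv U) (sv V) c)) \<in> Cov J"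
        using g by (intro Cov.add Cov.scale ind Cov.crs) (auto simp: Br)
    qed (erule less_3_cases; simp add: Br vec_defs Xs)
  next
    case (Co j W)
    show ?thesis
    proof (rule Cov.ext)
      show "(\<lambda>c. (if W = S then 1 else 0) * lv j c) \<in> Cov J"
        using g by (intro Cov.scale ind Cov.lv) (auto simp: Co)
    qed (erule less_3_cases; simp add: Co vec_defs Xs)
  next
    case (De j k l)
    show ?thesis by (rule Cov.ext[OF Cov.zero]) (simp add: De vec_defs Xs)
  qed
qed

lemma gradient_Nalg:
  assumes "x \<in> Nalg J" and X: "X = GA i \<and> S = SA i \<or> X = GV i \<and> S = SV i"
  shows "(\<lambda>c. pd (X c) x) \<in> Cov J"
  using assms(1)
proof (induction x rule: Nalg.induct)
  case (const c)
  show ?case by (simp add: Cov.zero)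
next
  case (add x y)
  then show ?case by (simp add: Cov.add)
next
  case (mult g x)
  have "(\<lambda>c. x * pd (X c) (gval g) + gval g * pd (X c) x) \<in> Cov J"
    using mult X by (intro Cov.add Cov.scale gradient_gval Nalg_gval)
  then show ?case by (simp add: ac_simps)
qed

text \<open>The components of d/dA_i x d/dv_i, in the pattern of \<open>crs\<close>.\<close>

definition AV :: "nat \<Rightarrow> nat \<Rightarrow> gpoly \<Rightarrow> gpoly" where
  "AV i c x = (if c = 0 then pd (GA i 1) (pd (GV i 2) x) - pd (GA i 2) (pd (GV i 1) x)
     else if c = 1 then pd (GA i 2) (pd (GV i 0) x) - pd (GA i 0) (pd (GV i 2) x)
     else pd (GA i 0) (pd (GV i 1) x) - pd (GA i 1) (pd (GV i 0) x))"

definition DO :: "nat \<Rightarrow> gpoly \<Rightarrow> gpoly" where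
  "DO i x = dot3 (lv i) (\<lambda>c. AV i c x)"

text \<open>The infinitesimal generator of v_i -> v_i + t A_i.\<close>

definition UO :: "nat \<Rightarrow> gpoly \<Rightarrow> gpoly" where
  "UO i x = dot3 (sv (SA i)) (\<lambda>c. pd (GV i c) x)"

lemma DO_add: "DO i (x + y) = DO i x + DO i y"
  by (simp add: DO_def AV_def dot3_def algebra_simps)

text \<open>For an operator of second order the product rule has two mixed terms; here they are
  brackets of l_i with one gradient of each factor, the case handled by
  \<open>br_Cov\<close>.\<close>

lemma DO_mult: "DO i (x * y) = DO i x * y + x * DO i y
    + br (lv i) (\<lambda>c. pd (GA i c) x) (\<lambda>c. pd (GV i c) y) + br (lv i) (\<lambda>c. pd (GA i c) y) (\<lambda>c. pd (GV i c) x)"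
  by (simp add: DO_def AV_def vec_defs algebra_simps)

lemma DO_0 [simp]: "DO i 0 = 0"
  by (simp add: DO_def AV_def dot3_def)

text \<open>The factor 2 is the contraction of two alternating symbols: [A_i, v_i, W] goes to twice
  l_i W, up to the sign of the arrangement. The indicators also cover repeated symbols, where the
  terms cancel or vanish.\<close>

lemma DO_br:
  fixes i defines "a \<equiv> \<lambda>W. if W = SA i then 1 else 0" and "b \<equiv> \<lambda>W. if W = SV i then 1 else 0"
  shows "DO i (br (sv U) (sv V) (sv W)) =
    2 * (a U * b V - b U * a V) * dot3 (lv i) (sv W)
    + 2 * (a V * b W - b V * a W) * dot3 (lv i) (sv U)
    + 2 * (a W * b U - b W * a U) * dot3 (lv i) (sv V)"
  unfolding a_def b_def
  by (cases "U = SA i"; cases "U = SV i"; cases "V = SA i"; cases "V = SV i"; cases "W = SA i"; cases "W = SV i")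
    (simp_all add: DO_def AV_def vec_defs algebra_simps)

lemma DO_gval: "gidx g \<subseteq> J \<Longrightarrow> i \<in> J \<Longrightarrow> DO i (gval g) \<in> Nalg J"
proof (cases g)
  case (Br U V W)
  assume "gidx g \<subseteq> J" "i \<in> J"
  moreover have "2 \<in> Nalg J" using Nalg.const[of 2 J] by (simp add: PC_numeral)
  ultimately show ?thesis unfolding Br gval.simps DO_br
    by (intro Nalg.add Nalg_mult Nalg_diff Nalg_gens) (auto simp: Br Nalg_0 Nalg_1)
qed (auto simp: DO_def AV_def vec_defs Nalg_0)

lemma DO_closed:
  assumes i: "i \<in> J" and x: "x \<in> Nalg J"
  shows "DO i x \<in> Nalg J"
  using x
proof (induction x rule: Nalg.induct)
  case (const c)
  then show ?case by (simp add: DO_def AV_def dot3_def Nalg_0)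
next
  case (add x y)
  then show ?case by (simp add: DO_add Nalg.add)
next
  case (mult g x)
  then show ?case unfolding DO_mult using i
    by (intro Nalg.add Nalg_mult DO_gval Nalg_gval br_Cov gradient_Nalg[of _ _ _ _ "SA i"]
        gradient_Nalg[of _ _ _ _ "SV i"]) auto
qed

text \<open>The commutator of d/dA_i with A_i . d/dv_i is d/dv_i, so the commutator of the two
  operators contains d/dv_i x d/dv_i, which is 0.\<close>

lemma UO_DO: "UO j (DO i x) = DO i (UO j x)"
  by (cases "i = j") (simp_all add: UO_def DO_def AV_def dot3_def algebra_simps pd_commute)

text \<open>Lagrange's identity for (A x v) . (d/dA x d/dv). The 1 in \<open>m + 1\<close> comes
  from the ordering: moving d/dA past the A inside \<open>UO\<close> yields an additional term v .
  d/dv.\<close>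

lemma Capelli:
  fixes x :: gpoly
  assumes U: "UO i x = 0"
    and A: "dot3 (sv (SA i)) (\<lambda>c. pd (GA i c) x) = m * x"
    and V: "dot3 (sv (SV i)) (\<lambda>c. pd (GV i c) x) = k * x" and k: "\<And>c. pd (GA i c) k = 0"
  shows "dot3 (crs (sv (SA i)) (sv (SV i))) (\<lambda>c. AV i c x) = (m + 1) * k * x"
proof -
  let ?A = "sv (SA i)" and ?V = "sv (SV i)"
  have V': "pd (GA i c) (dot3 ?V (\<lambda>c. pd (GV i c) x)) = k * pd (GA i c) x" for c
    unfolding V by (simp add: k)
  have "dot3 (crs ?A ?V) (\<lambda>c. AV i c x) = dot3 ?A (\<lambda>c. pd (GA i c) (dot3 ?V (\<lambda>c. pd (GV i c) x)))
    - dot3 ?V (\<lambda>c. pd (GA i c) (UO i x)) + dot3 ?V (\<lambda>c. pd (GV i c) x)"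
    by (simp add: dot3_def crs_def AV_def UO_def algebra_simps)
  also have "dot3 ?A (\<lambda>c. pd (GA i c) (dot3 ?V (\<lambda>c. pd (GV i c) x))) = k * (m * x)"
    unfolding V' A[symmetric] by (simp add: dot3_def algebra_simps)
  also have "dot3 ?V (\<lambda>c. pd (GA i c) (UO i x)) = 0"
    unfolding U by (simp add: dot3_def)
  finally show ?thesis unfolding V by (simp add: algebra_simps)
qed

section \<open>Degrees and highest weights under the operator \<open>DO\<close>\<close>

definition Aset where "Aset i = GA i ` {..<3}"
definition Vset where "Vset i = GV i ` {..<3}"
definition Lset where "Lset i = GL i ` {..<3}"

lemma finite_sets [simp]: "finite (Aset i)" "finite (Vset i)" "finite (Lset i)"
  by (simp_all add: Aset_def Vset_def Lset_def)

lemma euler_dot3: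
  "homog (Aset i) m x \<Longrightarrow> dot3 (sv (SA i)) (\<lambda>c. pd (GA i c) x) = of_int m * x"
  "homog (Vset i) m x \<Longrightarrow> dot3 (sv (SV i)) (\<lambda>c. pd (GV i c) x) = of_int m * x"
  using euler[of "Aset i" m x] euler[of "Vset i" m x]
  by (simp_all add: Aset_def Vset_def sum.reindex inj_on_def dot3_def sv_def numeral_3_eq_3
      numeral_2_eq_2 lessThan_Suc algebra_simps)

lemma homog_DO:
  assumes S: "finite S" "homog S d x"
    and "\<And>c. c < 3 \<Longrightarrow> (if GA i c \<in> S then 1 else 0) = a" "\<And>c. c < 3 \<Longrightarrow> (if GV i c \<in> S then 1 else 0) = b"
      "\<And>c. c < 3 \<Longrightarrow> (if GL i c \<in> S then 1 else 0) = l"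
  shows "homog S (d - a - b + l) (DO i x)"
proof -
  have pdV: "homog S (d - b) (pd (GV i c) x)" if "c < 3" for c
    using homog_pd[OF S, of "GV i c"] assms(4)[OF that] by (auto split: if_splits)
  have pdA: "homog S (d - a - b) (pd (GA i e) (pd (GV i c) x))" if "c < 3" "e < 3" for c e
    using homog_pd[OF S(1) pdV[OF that(1)], of "GA i e"] assms(3)[OF that(2)]
    by (auto split: if_splits simp: algebra_simps)
  have AV: "homog S (d - a - b) (AV i c x)" for c
    unfolding AV_def by (auto intro!: homog_diff pdA)
  have lv: "homog S l (lv i c)" if "c < 3" for c
    using homog_PX[OF S(1), of "GL i c"] assms(5)[OF that] by (simp add: lv_def)
  show ?thesis
    unfolding DO_def dot3_def add.commute[of _ l]
    by (intro homog_add homog_mult lv AV) auto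
qed

lemma homog_DO_same:
  "homog (Aset i) d x \<Longrightarrow> homog (Aset i) (d - 1) (DO i x)"
  "homog (Vset i) d x \<Longrightarrow> homog (Vset i) (d - 1) (DO i x)"
  "homog (Lset i) d x \<Longrightarrow> homog (Lset i) (d + 1) (DO i x)"
proof -
  show "homog (Aset i) (d - 1) (DO i x)" if "homog (Aset i) d x"
    using homog_DO[OF _ that, of i 1 0 0] by (simp add: Aset_def image_iff)
  show "homog (Vset i) (d - 1) (DO i x)" if "homog (Vset i) d x"
    using homog_DO[OF _ that, of i 0 1 0] by (simp add: Vset_def image_iff)
  show "homog (Lset i) (d + 1) (DO i x)" if "homog (Lset i) d x"
    using homog_DO[OF _ that, of i 0 0 1] by (simp add: Lset_def image_iff)
qed

lemma homog_DO_other: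
  assumes "j \<noteq> i"
  shows "homog (Aset j) d x \<Longrightarrow> homog (Aset j) d (DO i x)"
    "homog (Vset j) d x \<Longrightarrow> homog (Vset j) d (DO i x)"
    "homog (Lset j) d x \<Longrightarrow> homog (Lset j) d (DO i x)"
proof -
  show "homog (Aset j) d (DO i x)" if "homog (Aset j) d x"
    using homog_DO[OF _ that, of i 0 0 0] assms by (simp add: Aset_def image_iff)
  show "homog (Vset j) d (DO i x)" if "homog (Vset j) d x"
    using homog_DO[OF _ that, of i 0 0 0] assms by (simp add: Vset_def image_iff)
  show "homog (Lset j) d (DO i x)" if "homog (Lset j) d x"
    using homog_DO[OF _ that, of i 0 0 0] assms by (simp add: Lset_def image_iff)
qed

text \<open>For \<open>l = 0\<close>: a highest weight vector of weight \<open>(a, v)\<close> for \<open>GL(2)\<close> acting on the pair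
  \<open>(A\<^sub>i, v\<^sub>i)\<close>.\<close>

definition flag_hw :: "nat \<Rightarrow> int \<Rightarrow> int \<Rightarrow> int \<Rightarrow> gpoly \<Rightarrow> bool" where
  "flag_hw i a v l x \<longleftrightarrow> homog (Aset i) a x \<and> homog (Vset i) v x \<and> homog (Lset i) l x \<and> UO i x = 0"

lemma flag_hw_DO_same: "flag_hw i a v l x \<Longrightarrow> flag_hw i (a - 1) (v - 1) (l + 1) (DO i x)"
  by (simp add: flag_hw_def homog_DO_same UO_DO)

lemma flag_hw_DO_other: "j \<noteq> i \<Longrightarrow> flag_hw j a v l x \<Longrightarrow> flag_hw j a v l (DO i x)"
  by (simp add: flag_hw_def homog_DO_other UO_DO)

text \<open>Where l_i = A_i x v_i, the operator \<open>DO i\<close> has the values of the operator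
  in \<open>Capelli\<close>, and Euler's relation supplies the scalars. As \<open>DO i x\<close>
  contains the l_i as independent variables, this is an identity of values, not of
  polynomials.\<close>

lemma pev_DO:
  assumes \<zeta>: "\<And>c. c < 3 \<Longrightarrow> \<zeta> (GL i c) = crs (\<lambda>c. \<zeta> (GA i c)) (\<lambda>c. \<zeta> (GV i c)) c"
    and x: "flag_hw i a v l x"
  shows "pev \<zeta> (DO i x) = of_int ((a + 1) * v) * pev \<zeta> x"
proof -
  have "dot3 (crs (sv (SA i)) (sv (SV i))) (\<lambda>c. AV i c x) = (of_int a + 1) * of_int v * x"
    using x by (intro Capelli euler_dot3) (auto simp: flag_hw_def simp flip: PC_of_int)
  moreover have "pev \<zeta> (DO i x) = pev \<zeta> (dot3 (crs (sv (SA i)) (sv (SV i))) (\<lambda>c. AV i c x))"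
    using \<zeta>[of 0] \<zeta>[of 1] \<zeta>[of 2] by (simp add: DO_def dot3_def crs_def lv_def sv_def)
  moreover have "pev \<zeta> (of_int b) = of_int b" for b
    using pev_PC[of \<zeta> "of_int b"] by (simp add: PC_of_int)
  ultimately show ?thesis by simp
qed

text \<open>The steps multiply the values by (a + 1) k, then a (k - 1), and finally a - k + 2; the
  lower bound on \<open>a\<close> keeps the last factor, hence all of them, positive.\<close>

lemma DO_funpow:
  assumes x: "flag_hw i a (int k) l x" and a: "a + 1 \<ge> int k"
    and N: "i \<in> J" "x \<in> Nalg J"
  shows "(DO i ^^ k) x \<in> Nalg J \<and> flag_hw i (a - int k) 0 (l + int k) ((DO i ^^ k) x) \<and>
    (\<forall>j a' v' l'. j \<noteq> i \<longrightarrow> flag_hw j a' v' l' x \<longrightarrow> flag_hw j a' v' l' ((DO i ^^ k) x)) \<and>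
    (\<exists>c. c \<noteq> 0 \<and> (\<forall>\<zeta>. (\<forall>e<3. \<zeta> (GL i e) = crs (\<lambda>c. \<zeta> (GA i c)) (\<lambda>c. \<zeta> (GV i c)) e) \<longrightarrow>
       pev \<zeta> ((DO i ^^ k) x) = c * pev \<zeta> x))"
  using x a N(2)
proof (induction k arbitrary: a l x)
  case 0
  then show ?case by (auto intro: exI[of _ 1])
next
  case (Suc k)
  have 1: "flag_hw i (a - 1) (int k) (l + 1) (DO i x)"
    using flag_hw_DO_same[OF Suc.prems(1)] by simp
  have 2: "DO i x \<in> Nalg J" using Suc.prems(3) N by (intro DO_closed)
  have IH: "(DO i ^^ k) (DO i x) \<in> Nalg J" "flag_hw i (a - int (Suc k)) 0 (l + int (Suc k)) ((DO i ^^ k) (DO i x))"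
    "\<And>j a' v' l'. j \<noteq> i \<Longrightarrow> flag_hw j a' v' l' (DO i x) \<Longrightarrow> flag_hw j a' v' l' ((DO i ^^ k) (DO i x))"
    using Suc.IH[OF 1 _ 2] Suc.prems(2) by (auto simp: algebra_simps)
  obtain c where c: "c \<noteq> 0" "\<And>\<zeta>. (\<forall>e<3. \<zeta> (GL i e) = crs (\<lambda>c. \<zeta> (GA i c)) (\<lambda>c. \<zeta> (GV i c)) e) \<Longrightarrow>
       pev \<zeta> ((DO i ^^ k) (DO i x)) = c * pev \<zeta> (DO i x)"
    using Suc.IH[OF 1 _ 2] Suc.prems(2) by auto
  have "\<exists>c. c \<noteq> 0 \<and> (\<forall>\<zeta>. (\<forall>e<3. \<zeta> (GL i e) = crs (\<lambda>c. \<zeta> (GA i c)) (\<lambda>c. \<zeta> (GV i c)) e) \<longrightarrow>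
       pev \<zeta> ((DO i ^^ k) (DO i x)) = c * pev \<zeta> x)"
    using c pev_DO[OF _ Suc.prems(1)] Suc.prems(2)
    by (intro exI[of _ "c * of_int ((a + 1) * int (Suc k))"]) (auto simp del: of_nat_Suc of_int_mult)
  with IH flag_hw_DO_other show ?case
    by (auto simp: funpow_swap1)
qed

text \<open>Each step trades one A_i and one v_i for one l_i, so \<open>k i\<close> steps lead from
  degrees (2k - 3, k, 0) to (k - 3, 0, k), and operators of different indices do not disturb each
  other. For k >= 2 one has 2k - 2 >= k, the bound in \<open>DO_funpow\<close>. For k = 2 the degree
  -1 says that \<open>h\<close> is 0.\<close>

lemma eliminate_vectors:
  assumes J: "finite J" and f: "f \<in> Nalg J"
    and hw: "\<And>i. i \<in> J \<Longrightarrow> k i \<ge> 2" "\<And>i. i \<in> J \<Longrightarrow> flag_hw i (2 * int (k i) - 3) (int (k i)) 0 f"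
  obtains h c where "h \<in> Nalg J" "c \<noteq> 0" "\<And>i. i \<in> J \<Longrightarrow> flag_hw i (int (k i) - 3) 0 (int (k i)) h"
    "\<And>\<zeta>. (\<And>i e. i \<in> J \<Longrightarrow> e < 3 \<Longrightarrow> \<zeta> (GL i e) = crs (\<lambda>c. \<zeta> (GA i c)) (\<lambda>c. \<zeta> (GV i c)) e) \<Longrightarrow>
      pev \<zeta> h = c * pev \<zeta> f"
proof -
  have "\<exists>h c. h \<in> Nalg J \<and> c \<noteq> 0 \<and> (\<forall>i\<in>I. flag_hw i (int (k i) - 3) 0 (int (k i)) h) \<and>
    (\<forall>i\<in>J-I. flag_hw i (2 * int (k i) - 3) (int (k i)) 0 h) \<and>
    (\<forall>\<zeta>. (\<forall>i\<in>J. \<forall>e<3. \<zeta> (GL i e) = crs (\<lambda>c. \<zeta> (GA i c)) (\<lambda>c. \<zeta> (GV i c)) e) \<longrightarrow>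
      pev \<zeta> h = c * pev \<zeta> f)" if "I \<subseteq> J" for I
    using finite_subset[OF that J] that
  proof (induction I rule: finite_induct)
    case empty
    show ?case using f hw by (intro exI[of _ f] exI[of _ 1]) auto
  next
    case (insert i I)
    then obtain h c where h: "h \<in> Nalg J" "c \<noteq> 0" "\<And>i. i \<in> I \<Longrightarrow> flag_hw i (int (k i) - 3) 0 (int (k i)) h"
      "\<And>i. i \<in> J - I \<Longrightarrow> flag_hw i (2 * int (k i) - 3) (int (k i)) 0 h"
      "\<And>\<zeta>. (\<forall>i\<in>J. \<forall>e<3. \<zeta> (GL i e) = crs (\<lambda>c. \<zeta> (GA i c)) (\<lambda>c. \<zeta> (GV i c)) e) \<Longrightarrow>
      pev \<zeta> h = c * pev \<zeta> f" by auto
    have i: "i \<in> J" "i \<notin> I" using insert by auto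
    let ?h = "(DO i ^^ k i) h"
    have *: "?h \<in> Nalg J" "flag_hw i (int (k i) - 3) 0 (int (k i)) ?h"
      "\<And>j a' v' l'. j \<noteq> i \<Longrightarrow> flag_hw j a' v' l' h \<Longrightarrow> flag_hw j a' v' l' ?h"
      using DO_funpow[OF h(4)[of i] _ i(1) h(1)] i hw(1)[OF i(1)] by auto
    obtain d where d: "d \<noteq> 0" "\<And>\<zeta>. (\<forall>e<3. \<zeta> (GL i e) = crs (\<lambda>c. \<zeta> (GA i c)) (\<lambda>c. \<zeta> (GV i c)) e) \<Longrightarrow>
       pev \<zeta> ?h = d * pev \<zeta> h"
      using DO_funpow[OF h(4)[of i] _ i(1) h(1)] i hw(1)[OF i(1)] by auto
    show ?case
      using * h d i by (intro exI[of _ ?h] exI[of _ "d * c"]) (auto intro!: *(3) h)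
  qed
  from this[OF subset_refl] obtain h c where "h \<in> Nalg J" "c \<noteq> 0"
      "\<forall>i\<in>J. flag_hw i (int (k i) - 3) 0 (int (k i)) h"
      "\<forall>\<zeta>. (\<forall>i\<in>J. \<forall>e<3. \<zeta> (GL i e) = crs (\<lambda>c. \<zeta> (GA i c)) (\<lambda>c. \<zeta> (GV i c)) e) \<longrightarrow>
        pev \<zeta> h = c * pev \<zeta> f" by blast
  then show ?thesis by (intro that[of h c]) auto
qed

section \<open>Words in brackets and contractions\<close>

definition wval :: "gen multiset \<Rightarrow> gpoly" where
  "wval w = prod_mset (image_mset gval w)"

fun symcount :: "sym \<Rightarrow> sym \<Rightarrow> nat" where
  "symcount S W = (if W = S then 1 else 0)"

fun symdeg :: "sym \<Rightarrow> gen \<Rightarrow> nat" where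
  "symdeg S (Br U V W) = symcount S U + symcount S V + symcount S W"
| "symdeg S (Co i W) = symcount S W"
| "symdeg S (De i j k) = 0"

fun ldeg :: "nat \<Rightarrow> gen \<Rightarrow> nat" where
  "ldeg l (Br U V W) = 0"
| "ldeg l (Co i W) = of_bool (i = l)"
| "ldeg l (De i j k) = of_bool (i = l) + of_bool (j = l) + of_bool (k = l)"

definition wdeg :: "(gen \<Rightarrow> nat) \<Rightarrow> gen multiset \<Rightarrow> nat" where
  "wdeg d w = (\<Sum>g\<in>#w. d g)"

lemma wdeg_simps [simp]: "wdeg d {#} = 0" "wdeg d (add_mset g w) = d g + wdeg d w"
  "wdeg d (v + w) = wdeg d v + wdeg d w"
  by (simp_all add: wdeg_def)

lemma Nalg_words:
  assumes "h \<in> Nalg J"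
  shows "\<exists>K c. finite K \<and> (\<forall>w\<in>K. \<forall>g\<in>#w. gidx g \<subseteq> J) \<and> h = (\<Sum>w\<in>K. PC (c w) * wval w)"
  using assms
proof (induction h rule: Nalg.induct)
  case (const a)
  show ?case by (intro exI[of _ "{{#}}"] exI[of _ "\<lambda>_. a"]) (simp add: wval_def)
next
  case (add x y)
  then obtain K c K' c' where K: "finite K" "\<forall>w\<in>K. \<forall>g\<in>#w. gidx g \<subseteq> J" "x = (\<Sum>w\<in>K. PC (c w) * wval w)"
    and K': "finite K'" "\<forall>w\<in>K'. \<forall>g\<in>#w. gidx g \<subseteq> J" "y = (\<Sum>w\<in>K'. PC (c' w) * wval w)" by blast
  define d where "d = (\<lambda>w. (if w \<in> K then c w else 0) + (if w \<in> K' then c' w else 0))"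
  have "x = (\<Sum>w\<in>K \<union> K'. PC (if w \<in> K then c w else 0) * wval w)"
    unfolding K(3) using K(1) K'(1) by (intro sum.mono_neutral_cong_left) (auto simp: PC_0)
  moreover have "y = (\<Sum>w\<in>K \<union> K'. PC (if w \<in> K' then c' w else 0) * wval w)"
    unfolding K'(3) using K(1) K'(1) by (intro sum.mono_neutral_cong_left) (auto simp: PC_0)
  ultimately have "x + y = (\<Sum>w\<in>K \<union> K'. PC (d w) * wval w)"
    by (simp add: d_def PC_add distrib_right sum.distrib)
  with K K' show ?case by (intro exI[of _ "K \<union> K'"] exI[of _ d]) auto
next
  case (mult g x)
  then obtain K c where K: "finite K" "\<forall>w\<in>K. \<forall>g\<in>#w. gidx g \<subseteq> J" "x = (\<Sum>w\<in>K. PC (c w) * wval w)"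
    by blast
  have "gval g * x = (\<Sum>w\<in>add_mset g ` K. PC (c (w - {#g#})) * wval w)"
    by (subst sum.reindex) (auto simp: inj_on_def K(3) sum_distrib_left wval_def mult_ac)
  with K mult.hyps show ?case
    by (intro exI[of _ "add_mset g ` K"] exI[of _ "\<lambda>w. c (w - {#g#})"]) auto
qed

lemma homog_select_family:
  assumes "finite C" "finite K" and F: "F = (\<Sum>x\<in>K. G x)" "\<And>y. y \<in> C \<Longrightarrow> homog (S y) (k y) F"
    and G: "\<And>x y. x \<in> K \<Longrightarrow> y \<in> C \<Longrightarrow> homog (S y) (d y x) (G x)"
  shows "F = (\<Sum>x\<in>{x\<in>K. \<forall>y\<in>C. d y x = k y}. G x)"
  using assms(1) F(2) G
proof (induction C rule: finite_induct)
  case empty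
  then show ?case by (simp add: F(1))
next
  case (insert y C)
  have "F = (\<Sum>x\<in>{x\<in>{x\<in>K. \<forall>y\<in>C. d y x = k y}. d y x = k y}. G x)"
    using insert \<open>finite K\<close> by (intro homog_select[of _ "S y"]) auto
  then show ?case by (simp add: conj_ac Collect_conj_eq Int_ac)
qed

lemma homog_sv:
  assumes "finite S" "\<And>c. c < 3 \<Longrightarrow> svar W c \<in> S \<longleftrightarrow> b" "c < 3"
  shows "homog S (of_bool b) (sv W c)"
  using homog_PX[OF assms(1), of "svar W c"] assms(2)[OF assms(3)] by (auto simp: sv_def split: if_splits)

lemma homog_lv:
  assumes "finite S" "\<And>c. c < 3 \<Longrightarrow> GL i c \<in> S \<longleftrightarrow> b" "c < 3"
  shows "homog S (of_bool b) (lv i c)"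
  using homog_PX[OF assms(1), of "GL i c"] assms(2)[OF assms(3)] by (auto simp: lv_def split: if_splits)

lemma homog_dot3:
  assumes "\<And>c. c < 3 \<Longrightarrow> homog S a (u c)" "\<And>c. c < 3 \<Longrightarrow> homog S b (w c)"
  shows "homog S (a + b) (dot3 u w)"
  unfolding dot3_def using assms by (intro homog_add homog_mult) auto

lemma homog_crs:
  assumes "\<And>c. c < 3 \<Longrightarrow> homog S a (u c)" "\<And>c. c < 3 \<Longrightarrow> homog S b (w c)"
  shows "homog S (a + b) (crs u w c)"
  unfolding crs_def using assms by (auto intro!: homog_diff homog_mult)

lemma homog_br:
  assumes "\<And>c. c < 3 \<Longrightarrow> homog S a (u c)" "\<And>c. c < 3 \<Longrightarrow> homog S b (v c)" "\<And>c. c < 3 \<Longrightarrow> homog S d (w c)"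
  shows "homog S (a + (b + d)) (br u v w)"
  unfolding br_def using assms by (intro homog_dot3 homog_crs) auto

lemma homog_gval:
  "homog (Aset i) (int (symdeg (SA i) g)) (gval g)"
  "homog (Vset i) (int (symdeg (SV i) g)) (gval g)"
  "homog (Lset i) (int (ldeg i g)) (gval g)"
proof -
  \<comment> \<open>The degrees are summed in the nesting of \<open>homog_br\<close> and
    \<open>homog_dot3\<close>, so that these rules apply without rearrangement.\<close>
  have *: "homog S (int (case g of Br U V W \<Rightarrow> s U + (s V + s W) | Co j W \<Rightarrow> t j + s W | De i j k \<Rightarrow> t i + (t j + t k))) (gval g)"
    if "\<And>W c. c < 3 \<Longrightarrow> homog S (int (s W)) (sv W c)" "\<And>j c. c < 3 \<Longrightarrow> homog S (int (t j)) (lv j c)" for S s t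
    using that by (cases g) (simp_all only: gen.case gval.simps of_nat_add homog_br homog_dot3)
  have A: "homog (Aset i) (int (of_bool (W = SA i))) (sv W c)" "homog (Aset i) (int 0) (lv j c)" if "c < 3" for W j c
    using homog_sv[of "Aset i" W "W = SA i" c] homog_lv[of "Aset i" j False c] that
    by (auto simp: Aset_def image_iff)
  have V: "homog (Vset i) (int (of_bool (W = SV i))) (sv W c)" "homog (Vset i) (int 0) (lv j c)" if "c < 3" for W j c
    using homog_sv[of "Vset i" W "W = SV i" c] homog_lv[of "Vset i" j False c] that
    by (auto simp: Vset_def image_iff)
  have L: "homog (Lset i) (int 0) (sv W c)" "homog (Lset i) (int (of_bool (j = i))) (lv j c)" if "c < 3" for W j c
    using homog_sv[of "Lset i" W False c] homog_lv[of "Lset i" j "j = i" c] that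
    by (auto simp: Lset_def image_iff)
  have "symdeg (SA i) g = (case g of Br U V W \<Rightarrow> of_bool (U = SA i) + (of_bool (V = SA i) + of_bool (W = SA i))
      | Co j W \<Rightarrow> 0 + of_bool (W = SA i) | De i j k \<Rightarrow> 0 + (0 + 0))"
    by (cases g) auto
  with *[OF A] show "homog (Aset i) (int (symdeg (SA i) g)) (gval g)" by metis
  have "symdeg (SV i) g = (case g of Br U V W \<Rightarrow> of_bool (U = SV i) + (of_bool (V = SV i) + of_bool (W = SV i))
      | Co j W \<Rightarrow> 0 + of_bool (W = SV i) | De i j k \<Rightarrow> 0 + (0 + 0))"
    by (cases g) auto
  with *[OF V] show "homog (Vset i) (int (symdeg (SV i) g)) (gval g)" by metis
  have "ldeg i g = (case g of Br U V W \<Rightarrow> 0 + (0 + 0)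
      | Co j W \<Rightarrow> of_bool (j = i) + 0 | De k j l \<Rightarrow> of_bool (k = i) + (of_bool (j = i) + of_bool (l = i)))"
    by (cases g) auto
  with *[OF L] show "homog (Lset i) (int (ldeg i g)) (gval g)" by metis
qed

lemma homog_wval:
  assumes "\<And>g. homog S (int (d g)) (gval g)"
  shows "homog S (int (wdeg d w)) (PC c * wval w)"
proof -
  have "homog S (int (wdeg d w)) (wval w)"
    by (induction w) (auto simp: wval_def homog_1 intro!: homog_mult assms)
  then show ?thesis using homog_mult[OF homog_PC] by fastforce
qed

text \<open>Words are selected by their degrees in the A_i, then in the v_i, then in the l_i. Each
  remaining word has the right letter counts as syntax, even if its value is 0.\<close>

lemma Nalg_words_of_degree:
  assumes "finite J" "h \<in> Nalg J" and h: "\<And>i. i \<in> J \<Longrightarrow> flag_hw i (a i) (v i) (l i) h"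
  obtains K c where "finite K" "h = (\<Sum>w\<in>K. PC (c w) * wval w)"
    "\<And>w g. w \<in> K \<Longrightarrow> g \<in># w \<Longrightarrow> gidx g \<subseteq> J"
    "\<And>w i. w \<in> K \<Longrightarrow> i \<in> J \<Longrightarrow> int (wdeg (symdeg (SA i)) w) = a i \<and>
      int (wdeg (symdeg (SV i)) w) = v i \<and> int (wdeg (ldeg i) w) = l i"
proof -
  obtain K c where K: "finite K" "\<And>w g. w \<in> K \<Longrightarrow> g \<in># w \<Longrightarrow> gidx g \<subseteq> J" "h = (\<Sum>w\<in>K. PC (c w) * wval w)"
    using Nalg_words[OF assms(2)] by blast
  let ?KA = "{w\<in>K. \<forall>i\<in>J. int (wdeg (symdeg (SA i)) w) = a i}"
  let ?KV = "{w\<in>?KA. \<forall>i\<in>J. int (wdeg (symdeg (SV i)) w) = v i}"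
  let ?KL = "{w\<in>?KV. \<forall>i\<in>J. int (wdeg (ldeg i) w) = l i}"
  have "h = (\<Sum>w\<in>?KA. PC (c w) * wval w)"
    by (rule homog_select_family[where S = Aset, OF assms(1) K(1) K(3)])
      (use h in \<open>auto simp: flag_hw_def intro!: homog_wval homog_gval\<close>)
  from homog_select_family[where S = Vset, OF assms(1) _ this, where k = v and d = "\<lambda>i w. int (wdeg (symdeg (SV i)) w)"]
  have "h = (\<Sum>w\<in>?KV. PC (c w) * wval w)"
    using h K(1) by (auto simp: flag_hw_def intro!: homog_wval homog_gval)
  from homog_select_family[where S = Lset, OF assms(1) _ this, where k = l and d = "\<lambda>i w. int (wdeg (ldeg i) w)"]
  have "h = (\<Sum>w\<in>?KL. PC (c w) * wval w)"
    using h K(1) by (auto simp: flag_hw_def intro!: homog_wval homog_gval)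
  then show thesis using K by (intro that[of ?KL c]) auto
qed

section \<open>Dehomogenized words\<close>

definition jA :: "nat \<Rightarrow> nat \<Rightarrow> jpoly" where
  "jA i c = (if c = 0 then pvar (JX i) else if c = 1 then pvar (JY i) else 1)"

text \<open>A solution \<open>v\<^sub>i\<close> of \<open>(x\<^sub>i, y\<^sub>i, 1) \<times> v\<^sub>i = \<ell>\<^sub>i\<close>.\<close>

definition jV :: "nat \<Rightarrow> nat \<Rightarrow> jpoly" where
  "jV i c = (if c = 0 then pvar (JQ i) else if c = 1 then - pvar (JP i) else 0)"

definition jL :: "nat \<Rightarrow> nat \<Rightarrow> jpoly" where
  "jL i c = (if c = 0 then pvar (JP i) else if c = 1 then pvar (JQ i)
     else - pvar (JP i) * pvar (JX i) - pvar (JQ i) * pvar (JY i))"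

fun jsv :: "sym \<Rightarrow> nat \<Rightarrow> jpoly" where
  "jsv (SA i) = jA i"
| "jsv (SV i) = jV i"

fun jgen :: "gen \<Rightarrow> jpoly" where
  "jgen (Br U V W) = br (jsv U) (jsv V) (jsv W)"
| "jgen (Co i W) = dot3 (jL i) (jsv W)"
| "jgen (De i j k) = br (jL i) (jL j) (jL k)"

definition jw :: "gen multiset \<Rightarrow> jpoly" where
  "jw w = prod_mset (image_mset jgen w)"

text \<open>The lift of \<open>z\<close> whose columns A_i have last coordinate 1; it lies on the
  locus l_i = A_i x v_i and is a right inverse of \<open>dehom\<close>.\<close>

definition pt :: "(jvar \<Rightarrow> real) \<Rightarrow> gvar \<Rightarrow> real" where
  "pt z v = (case v of GA i c \<Rightarrow> pev z (jA i c) | GV i c \<Rightarrow> pev z (jV i c) | GL i c \<Rightarrow> pev z (jL i c) | GT r c \<Rightarrow> 1)"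

lemma pt_crs: "e < 3 \<Longrightarrow> pt z (GL i e) = crs (\<lambda>c. pt z (GA i c)) (\<lambda>c. pt z (GV i c)) e"
  by (erule less_3_cases) (auto simp: pt_def jA_def jV_def jL_def crs_def)

lemma pev_jgen: "pev z (jgen g) = pev (pt z) (gval g)"
proof -
  have 1: "pev (pt z) (sv W c) = pev z (jsv W c)" "pev (pt z) (lv i c) = pev z (jL i c)" for W i c
    by (cases W; simp add: sv_def lv_def pt_def)+
  show ?thesis by (cases g) (simp_all add: vec_defs 1)
qed

lemma pev_jw: "pev z (jw w) = pev (pt z) (wval w)"
  by (induction w) (simp_all add: jw_def wval_def pev_jgen)

lemma jL_jA: "dot3 (jL i) (jA i) = 0"
  by (simp add: dot3_def jL_def jA_def)

lemma Cpol_dot3: "Cpol i j = dot3 (jL i) (jA j)"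
  by (simp add: Cpol_eq dot3_def jL_def jA_def algebra_simps)

lemma br_alternating: "br u u w = 0" "br u w u = 0" "br w u u = 0"
  by (simp_all add: vec_defs algebra_simps)

lemma br_perm: "br v u w = - br u v w" "br w v u = - br u v w" "br u w v = - br u v w"
  "br v w u = br u v w" "br w u v = br u v w"
  by (simp_all add: vec_defs algebra_simps)

lemma Dpol_sorted: "i < j \<Longrightarrow> j < k \<Longrightarrow> Dpol {i, j, k} = br (jL i) (jL j) (jL k)"
  by (simp add: Dpol_def det_3 vec_defs jL_def lrow_def algebra_simps)

lemma Dpol_br:
  assumes "i \<noteq> j" "i \<noteq> k" "j \<noteq> k"
  shows "br (jL i) (jL j) (jL k) = Dpol {i, j, k} \<or> br (jL i) (jL j) (jL k) = - Dpol {i, j, k}"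
proof -
  consider "i < j \<and> j < k" | "i < k \<and> k < j" | "j < i \<and> i < k" | "j < k \<and> k < i" | "k < i \<and> i < j" | "k < j \<and> j < i"
    using assms by linarith
  then show ?thesis
  proof cases
    case 1 then show ?thesis by (simp add: Dpol_sorted)
  next
    case 2
    then show ?thesis using Dpol_sorted[of i k j] br_perm(3)[of "jL i" "jL k" "jL j"]
      by (simp add: insert_commute)
  next
    case 3
    then show ?thesis using Dpol_sorted[of j i k] br_perm(1)[of "jL i" "jL j" "jL k"]
      by (simp add: insert_commute)
  next
    case 4
    then show ?thesis using Dpol_sorted[of j k i] br_perm(5)[of "jL i" "jL j" "jL k"] br_perm(4)[of "jL i" "jL j" "jL k"]
      by (simp add: insert_commute)
  next
    case 5
    then show ?thesis using Dpol_sorted[of k i j] br_perm(5)[of "jL k" "jL i" "jL j"] br_perm(4)[of "jL k" "jL i" "jL j"]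
      by (simp add: insert_commute)
  next
    case 6
    then show ?thesis using Dpol_sorted[of k j i] br_perm(2)[of "jL i" "jL j" "jL k"]
      by (simp add: insert_commute)
  qed
qed

lemma finite_triples [simp]: "finite (triples n)"
  by (rule finite_subset[of _ "Pow {1..n}"]) (auto simp: triples_def)

text \<open>The support conditions of admissibility without its degree conditions, which hold only
  for the complete word and not during an induction over its letters.\<close>

definition ba_ok :: "nat \<Rightarrow> (nat set \<Rightarrow> nat) \<Rightarrow> (nat \<Rightarrow> nat \<Rightarrow> nat) \<Rightarrow> bool" where
  "ba_ok n b a \<longleftrightarrow> (\<forall>I. I \<notin> triples n \<longrightarrow> b I = 0) \<and>
     (\<forall>i j. i \<notin> {1..n} \<or> j \<notin> {1..n} \<longrightarrow> a i j = 0) \<and> (\<forall>i. a i i = 0)"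

lemma finite_offdiag [simp]: "finite {(i, j). i \<in> {1..n::nat} \<and> j \<in> {1..n} \<and> i \<noteq> j}"
  by (rule finite_subset[of _ "{1..n} \<times> {1..n}"]) auto

lemma Ppol_add:
  "Ppol n (\<lambda>I. b I + b' I, \<lambda>i j. a i j + a' i j) = Ppol n (b, a) * Ppol n (b', a')"
  by (simp add: Ppol_def power_add prod.distrib case_prod_beta mult_ac)

lemma Ppol_0: "Ppol n (\<lambda>_. 0, \<lambda>_ _. 0) = 1"
  by (simp add: Ppol_def)

lemma Ppol_single_b: "I \<in> triples n \<Longrightarrow> Ppol n (\<lambda>I'. of_bool (I' = I), \<lambda>_ _. 0) = Dpol I"
  by (simp add: Ppol_def of_bool_def if_distrib[of "power _"] prod.delta cong: if_cong)

lemma Ppol_single_a: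
  assumes "i \<in> {1..n}" "j \<in> {1..n}" "i \<noteq> j"
  shows "Ppol n (\<lambda>_. 0, \<lambda>i' j'. of_bool (i' = i \<and> j' = j)) = Cpol i j"
proof -
  let ?S = "{(i, j). i \<in> {1..n} \<and> j \<in> {1..n} \<and> i \<noteq> j}"
  have "Ppol n (\<lambda>_. 0, \<lambda>i' j'. of_bool (i' = i \<and> j' = j)) = (\<Prod>p\<in>?S. if p = (i, j) then Cpol i j else 1)"
    by (auto simp: Ppol_def intro!: prod.cong)
  also have "\<dots> = Cpol i j" by (subst prod.delta[OF finite_offdiag]) (use assms in auto)
  finally show ?thesis .
qed

lemma bdeg_add: "bdeg n (\<lambda>I. b I + b' I) i = bdeg n b i + bdeg n b' i"
  by (simp add: bdeg_def sum.distrib)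

lemma bdeg_single: "I \<in> triples n \<Longrightarrow> bdeg n (\<lambda>I'. of_bool (I' = I)) i = of_bool (i \<in> I)"
  by (auto simp: bdeg_def of_bool_def intro!: sum.neutral)

fun isBr :: "gen \<Rightarrow> nat" where "isBr (Br U V W) = 1" | "isBr _ = 0"
fun isDe :: "gen \<Rightarrow> nat" where "isDe (De i j k) = 1" | "isDe _ = 0"
fun isCo :: "gen \<Rightarrow> nat" where "isCo (Co i W) = 1" | "isCo _ = 0"

text \<open>A contraction l_i A_j is an edge from i to j counted by \<open>a\<close>, a bracket of
  rows is a triple counted by \<open>b\<close>. The degree in A_i becomes a column sum, the degree
  in l_i a row sum plus a triple degree. The value 0 is due to a factor l_i A_i or a repeated row in
  a bracket.\<close>

lemma word_without_Br:
  assumes "\<And>g. g \<in># w \<Longrightarrow> gidx g \<subseteq> {1..n}" "wdeg isBr w = 0"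
    "\<And>i. i \<in> {1..n} \<Longrightarrow> wdeg (symdeg (SV i)) w = 0"
  shows "jw w = 0 \<or> (\<exists>b a. (jw w = Ppol n (b, a) \<or> jw w = - Ppol n (b, a)) \<and> ba_ok n b a \<and>
    (\<Sum>I\<in>triples n. b I) = wdeg isDe w \<and>
    (\<forall>i\<in>{1..n}. bdeg n b i + (\<Sum>j\<in>{1..n}. a i j) = wdeg (ldeg i) w \<and>
      (\<Sum>j\<in>{1..n}. a j i) = wdeg (symdeg (SA i)) w))"
  using assms
proof (induction w)
  case empty
  show ?case
    by (rule disjI2, rule exI[of _ "\<lambda>_. 0"], rule exI[of _ "\<lambda>_ _. 0"])
      (simp add: jw_def Ppol_0 ba_ok_def bdeg_def)
next
  case (add g w)
  have jw: "jw (add_mset g w) = jgen g * jw w" by (simp add: jw_def)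
  have "jw w = 0 \<or> (\<exists>b a. (jw w = Ppol n (b, a) \<or> jw w = - Ppol n (b, a)) \<and> ba_ok n b a \<and>
    (\<Sum>I\<in>triples n. b I) = wdeg isDe w \<and>
    (\<forall>i\<in>{1..n}. bdeg n b i + (\<Sum>j\<in>{1..n}. a i j) = wdeg (ldeg i) w \<and>
      (\<Sum>j\<in>{1..n}. a j i) = wdeg (symdeg (SA i)) w))"
    using add.prems by (intro add.IH) auto
  then consider "jw w = 0" | b a where "jw w = Ppol n (b, a) \<or> jw w = - Ppol n (b, a)" "ba_ok n b a"
      "(\<Sum>I\<in>triples n. b I) = wdeg isDe w"
      "\<forall>i\<in>{1..n}. bdeg n b i + (\<Sum>j\<in>{1..n}. a i j) = wdeg (ldeg i) w \<and>
      (\<Sum>j\<in>{1..n}. a j i) = wdeg (symdeg (SA i)) w" by blast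
  then show ?case
  proof cases
    case 1
    then show ?thesis by (simp add: jw)
  next
    case prems: (2 b a)
    note w = prems(1) and ok = prems(2) and bs = prems(3) and deg = prems(4)
    show ?thesis
    proof (cases g)
      case (Br U V W)
      with add.prems show ?thesis by simp
    next
      case (Co i W)
      have idx: "i \<in> {1..n}" "sidx W \<in> {1..n}" using add.prems(1)[of g] by (auto simp: Co)
      obtain j where W: "W = SA j"
        using idx(2) add.prems(3)[of "sidx W"] by (cases W) (auto simp: Co)
      show ?thesis
      proof (cases "i = j")
        case True
        then have "jw (add_mset g w) = 0" by (simp only: jw) (simp add: Co W jL_jA)
        then show ?thesis ..
      next
        case False
        let ?a = "\<lambda>i' j'. of_bool (i' = i \<and> j' = j) + a i' j'"
        have "Ppol n (b, ?a) = Cpol i j * Ppol n (b, a)"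
          using Ppol_add[of n "\<lambda>_. 0" b "\<lambda>i' j'. of_bool (i' = i \<and> j' = j)" a] idx W False
          by (simp add: Ppol_single_a)
        then have "jw (add_mset g w) = Ppol n (b, ?a) \<or> jw (add_mset g w) = - Ppol n (b, ?a)"
          unfolding jw using w by (auto simp: Co W Cpol_dot3)
        moreover have "ba_ok n b ?a" using ok idx W False by (auto simp: ba_ok_def)
        moreover have "bdeg n b i' + (\<Sum>j'\<in>{1..n}. ?a i' j') = wdeg (ldeg i') (add_mset g w) \<and>
          (\<Sum>j'\<in>{1..n}. ?a j' i') = wdeg (symdeg (SA i')) (add_mset g w)" if "i' \<in> {1..n}" for i'
        proof -
          have "(\<Sum>j'\<in>{1..n}. of_bool (i' = i \<and> j' = j)) = (of_bool (i' = i) :: nat)"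
            using idx W by (cases "i' = i") (auto simp: of_bool_def)
          moreover have "(\<Sum>j'\<in>{1..n}. of_bool (j' = i \<and> i' = j)) = (of_bool (i' = j) :: nat)"
            using idx W by (cases "i' = j") (auto simp: of_bool_def)
          ultimately show ?thesis using deg that
            by (auto simp: Co W sum.distrib)
        qed
        moreover have "(\<Sum>I\<in>triples n. b I) = wdeg isDe (add_mset g w)" using bs by (simp add: Co)
        ultimately show ?thesis by blast
      qed
    next
      case (De i j k)
      have idx: "i \<in> {1..n}" "j \<in> {1..n}" "k \<in> {1..n}" using add.prems(1)[of g] by (auto simp: De)
      show ?thesis
      proof (cases "i \<noteq> j \<and> i \<noteq> k \<and> j \<noteq> k")
        case False
        then have "jw (add_mset g w) = 0" unfolding jw by (auto simp: De br_alternating)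
        then show ?thesis ..
      next
        case True
        let ?I = "{i, j, k}"
        have I: "?I \<in> triples n" using True idx by (auto simp: triples_def)
        let ?b = "\<lambda>I'. of_bool (I' = ?I) + b I'"
        have "Ppol n (?b, a) = Dpol ?I * Ppol n (b, a)"
          using Ppol_add[of n "\<lambda>I'. of_bool (I' = ?I)" b "\<lambda>_ _. 0" a] Ppol_single_b[OF I] by simp
        then have "jw (add_mset g w) = Ppol n (?b, a) \<or> jw (add_mset g w) = - Ppol n (?b, a)"
          unfolding jw using w Dpol_br[of i j k] True by (auto simp: De)
        moreover have "ba_ok n ?b a" using ok I by (auto simp: ba_ok_def)
        moreover have "bdeg n ?b i' + (\<Sum>j'\<in>{1..n}. a i' j') = wdeg (ldeg i') (add_mset g w) \<and>
          (\<Sum>j'\<in>{1..n}. a j' i') = wdeg (symdeg (SA i')) (add_mset g w)" if "i' \<in> {1..n}" for i'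
          using deg that True by (auto simp: De bdeg_add bdeg_single[OF I])
        moreover have "(\<Sum>I\<in>triples n. ?b I) = wdeg isDe (add_mset g w)"
          using bs I by (simp add: De sum.distrib of_bool_def)
        ultimately show ?thesis by blast
      qed
    qed
  qed
qed

section \<open>Elimination of the brackets of points\<close>

lemma br_mult_br: "br u v w * br l m p =
    dot3 l u * (dot3 m v * dot3 p w) - dot3 l u * (dot3 m w * dot3 p v)
  - dot3 l v * (dot3 m u * dot3 p w) + dot3 l v * (dot3 m w * dot3 p u)
  + dot3 l w * (dot3 m u * dot3 p v) - dot3 l w * (dot3 m v * dot3 p u)"
  by (simp add: vec_defs algebra_simps)

lemma word_in_span:
  assumes S: "0 \<in> S" "\<And>x y. x \<in> S \<Longrightarrow> y \<in> S \<Longrightarrow> x + y \<in> S" "\<And>x. x \<in> S \<Longrightarrow> - x \<in> S"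
      "\<And>b a. admissible n (b, a) \<Longrightarrow> Ppol n (b, a) \<in> S"
    and w: "\<And>g. g \<in># w \<Longrightarrow> gidx g \<subseteq> {1..n}"
      "\<And>i. i \<in> {1..n} \<Longrightarrow> wdeg (symdeg (SV i)) w = 0"
      "\<And>i. i \<in> {1..n} \<Longrightarrow> wdeg (ldeg i) w = wdeg (symdeg (SA i)) w + 3"
  shows "jw w \<in> S"
  using w
proof (induction "wdeg isBr w" arbitrary: w)
  \<comment> \<open>Counting letters: with multiplicity there are 3 De + Co rows and 3 Br + Co
    vectors, and by the degree condition the difference is 3n. So a word with a bracket of vectors
    also has a bracket of rows to pair it with.\<close>
  have De_Br: "wdeg isDe w = wdeg isBr w + n"
    if w: "\<And>g. g \<in># w \<Longrightarrow> gidx g \<subseteq> {1..n}"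
      "\<And>i. i \<in> {1..n} \<Longrightarrow> wdeg (symdeg (SV i)) w = 0"
      "\<And>i. i \<in> {1..n} \<Longrightarrow> wdeg (ldeg i) w = wdeg (symdeg (SA i)) w + 3" for w
  proof -
    have sw: "(\<Sum>i\<in>{1..n}. symcount (SA i) W) + (\<Sum>i\<in>{1..n}. symcount (SV i) W) = 1" if "sidx W \<in> {1..n}" for W
      using that by (cases W) auto
    have "(\<Sum>i\<in>{1..n}. wdeg (ldeg i) w) = 3 * wdeg isDe w + wdeg isCo w \<and>
      (\<Sum>i\<in>{1..n}. wdeg (symdeg (SA i)) w) + (\<Sum>i\<in>{1..n}. wdeg (symdeg (SV i)) w) = 3 * wdeg isBr w + wdeg isCo w"
      using w(1)
    proof (induction w)
      case (add g w)
      then have IH: "(\<Sum>i\<in>{1..n}. wdeg (ldeg i) w) = 3 * wdeg isDe w + wdeg isCo w \<and>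
        (\<Sum>i\<in>{1..n}. wdeg (symdeg (SA i)) w) + (\<Sum>i\<in>{1..n}. wdeg (symdeg (SV i)) w) = 3 * wdeg isBr w + wdeg isCo w"
        by auto
      have g: "gidx g \<subseteq> {1..n}" using add.prems by auto
      have "(\<Sum>i\<in>{1..n}. ldeg i g) = 3 * isDe g + isCo g"
        using g by (cases g) (auto simp: sum.distrib of_bool_def)
      moreover have "(\<Sum>i\<in>{1..n}. symdeg (SA i) g) + (\<Sum>i\<in>{1..n}. symdeg (SV i) g) = 3 * isBr g + isCo g"
      proof (cases g)
        case (Br U V W)
        with g sw[of U] sw[of V] sw[of W] show ?thesis by (simp add: sum.distrib del: symcount.simps)
      next
        case (Co i W)
        with g sw[of W] show ?thesis by (simp add: sum.distrib del: symcount.simps)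
      qed simp
      ultimately show ?case using IH by (simp add: sum.distrib)
    qed simp
    then show ?thesis using w(2,3) by (simp add: sum.distrib)
  qed
  {
    case 0
    from De_Br[OF 0(2,3,4)] 0(1) have De: "wdeg isDe w = n" by simp
    from 0 have "jw w = 0 \<or> (\<exists>b a. (jw w = Ppol n (b, a) \<or> jw w = - Ppol n (b, a)) \<and> ba_ok n b a \<and>
      (\<Sum>I\<in>triples n. b I) = wdeg isDe w \<and>
      (\<forall>i\<in>{1..n}. bdeg n b i + (\<Sum>j\<in>{1..n}. a i j) = wdeg (ldeg i) w \<and>
        (\<Sum>j\<in>{1..n}. a j i) = wdeg (symdeg (SA i)) w))"
      by (intro word_without_Br) auto
    then consider "jw w = 0" | b a where "jw w = Ppol n (b, a) \<or> jw w = - Ppol n (b, a)" "ba_ok n b a"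
      "(\<Sum>I\<in>triples n. b I) = wdeg isDe w"
      "\<forall>i\<in>{1..n}. bdeg n b i + (\<Sum>j\<in>{1..n}. a i j) = wdeg (ldeg i) w \<and>
      (\<Sum>j\<in>{1..n}. a j i) = wdeg (symdeg (SA i)) w" by blast
    then show ?case
    proof cases
      case 1
      then show ?thesis using S by simp
    next
      case prems: (2 b a)
      note w = prems(1) and ok = prems(2) and bs = prems(3) and deg = prems(4)
      have "int (bdeg n b i) + adiff n a i = 3" if "i \<in> {1..n}" for i
      proof -
        have "bdeg n b i + (\<Sum>j\<in>{1..n}. a i j) = (\<Sum>j\<in>{1..n}. a j i) + 3"
          using deg that 0(4)[OF that] by auto
        then show ?thesis unfolding adiff_def by linarith
      qed
      then have "admissible n (b, a)" using ok bs De by (auto simp: admissible_def ba_ok_def)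
      with S w show ?thesis by auto
    qed
  next
    case (Suc m)
    have "wdeg isBr w \<noteq> 0" "wdeg isDe w \<noteq> 0" using De_Br[OF Suc(3,4,5)] Suc(2) by auto
    then obtain g g' where g: "g \<in># w" "isBr g \<noteq> 0" "g' \<in># w" "isDe g' \<noteq> 0"
      unfolding wdeg_def by (metis (no_types, lifting) sum_mset_0_iff imageE set_image_mset)
    from g(2,4) obtain U V W i j k where gg: "g = Br U V W" "g' = De i j k"
      by (cases g; cases g') auto
    obtain w' where w': "w = add_mset g (add_mset g' w')"
      using g gg by (metis gen.distinct(3) insert_DiffM insert_noteq_member)
    let ?W = "\<lambda>X Y Z. add_mset (Co i X) (add_mset (Co j Y) (add_mset (Co k Z) w'))"
    \<comment> \<open>Expanding the determinant of contractions only permutes U, V, W among the rows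
      i, j, k, so all degree counts stay the same while one bracket of vectors disappears.\<close>
    have ok: "jw (?W X Y Z) \<in> S" if "mset [X, Y, Z] = mset [U, V, W]" for X Y Z
    proof (rule Suc(1))
      show "m = wdeg isBr (?W X Y Z)" using Suc(2) by (simp add: w' gg)
      have "{X, Y, Z} = {U, V, W}" using arg_cong[OF that, of set_mset] by simp
      then have XYZ: "sidx X \<in> {1..n}" "sidx Y \<in> {1..n}" "sidx Z \<in> {1..n}"
        using Suc(3)[of g] by (auto simp: w' gg)
      show "gidx h \<subseteq> {1..n}" if "h \<in># ?W X Y Z" for h
        using Suc(3)[of g'] Suc(3)[of h] XYZ that by (auto simp: w' gg)
      have sm: "symcount T X + symcount T Y + symcount T Z = symcount T U + symcount T V + symcount T W" for T
        using arg_cong[OF that, of "\<lambda>M. \<Sum>Q\<in>#M. symcount T Q"] by (simp del: symcount.simps)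
      show "wdeg (symdeg (SV i)) (?W X Y Z) = 0" if "i \<in> {1..n}" for i
        using Suc(4)[OF that] sm[of "SV i"] by (simp add: w' gg del: symcount.simps)
      show "wdeg (ldeg i) (?W X Y Z) = wdeg (symdeg (SA i)) (?W X Y Z) + 3" if "i \<in> {1..n}" for i
        using Suc(5)[OF that] sm[of "SA i"] by (simp add: w' gg del: symcount.simps)
    qed
    have diff: "x - y \<in> S" if "x \<in> S" "y \<in> S" for x y
      using S(2)[OF that(1) S(3)[OF that(2)]] by simp
    have "jw w = jw (?W U V W) - jw (?W U W V) - jw (?W V U W) + jw (?W V W U) + jw (?W W U V) - jw (?W W V U)"
      by (simp add: w' gg jw_def br_mult_br flip: mult.assoc) (simp add: algebra_simps)
    also have "\<dots> \<in> S" by (intro S(2) diff ok) simp_all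
    finally show ?case .
  }
qed

section \<open>The algebra of absolute invariants\<close>

lemma Rpoly_PC: "PC c \<in> Rpoly n"
  by (simp add: Rpoly_def PC_def)

lemma Rpoly_pvar: "v \<in> jvars n \<Longrightarrow> pvar v \<in> Rpoly n"
  by (simp add: Rpoly_def pvar_def)

lemma Rpoly_add: "F \<in> Rpoly n \<Longrightarrow> G \<in> Rpoly n \<Longrightarrow> F + G \<in> Rpoly n"
  using Poly_Mapping.keys_add[of F G] by (auto simp: Rpoly_def)

lemma Rpoly_mult: "F \<in> Rpoly n \<Longrightarrow> G \<in> Rpoly n \<Longrightarrow> F * G \<in> Rpoly n"
proof -
  assume F: "F \<in> Rpoly n" and G: "G \<in> Rpoly n"
  show ?thesis unfolding Rpoly_def
  proof (intro CollectI ballI)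
    fix m assume "m \<in> Poly_Mapping.keys (F * G)"
    then obtain k l where "m = k + l" "k \<in> Poly_Mapping.keys F" "l \<in> Poly_Mapping.keys G"
      using keys_mult[of F G] by blast
    then show "Poly_Mapping.keys m \<subseteq> jvars n"
      using F G Poly_Mapping.keys_add[of k l] unfolding Rpoly_def by blast
  qed
qed

lemma Rpoly_uminus: "F \<in> Rpoly n \<Longrightarrow> - F \<in> Rpoly n"
  using Rpoly_mult[OF Rpoly_PC[of "-1" n]] by (simp add: PC_uminus PC_1)

lemma Rpoly_diff: "F \<in> Rpoly n \<Longrightarrow> G \<in> Rpoly n \<Longrightarrow> F - G \<in> Rpoly n"
  using Rpoly_add[of F n "- G"] Rpoly_uminus by simp

lemma Rpoly_1: "1 \<in> Rpoly n"
  using Rpoly_PC[of 1 n] by (simp add: PC_1)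

lemma Rpoly_power: "F \<in> Rpoly n \<Longrightarrow> F ^ k \<in> Rpoly n"
  by (induction k) (auto intro: Rpoly_1 Rpoly_mult)

lemma Rpoly_prod: "(\<And>x. x \<in> S \<Longrightarrow> F x \<in> Rpoly n) \<Longrightarrow> prod F S \<in> Rpoly n"
  by (induction S rule: infinite_finite_induct) (auto intro: Rpoly_1 Rpoly_mult)

lemma absolute_invariants_PC: "PC c \<in> absolute_invariants n"
  by (simp add: absolute_invariants_def Rpoly_PC peval_eq_pev)

lemma absolute_invariants_add:
  "F \<in> absolute_invariants n \<Longrightarrow> G \<in> absolute_invariants n \<Longrightarrow> F + G \<in> absolute_invariants n"
  by (simp add: absolute_invariants_def Rpoly_add peval_eq_pev)

lemma absolute_invariants_mult:
  "F \<in> absolute_invariants n \<Longrightarrow> G \<in> absolute_invariants n \<Longrightarrow> F * G \<in> absolute_invariants n"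
  by (simp add: absolute_invariants_def Rpoly_mult peval_eq_pev)

lemma relative_invariants_0: "0 \<in> relative_invariants n w"
  using Rpoly_PC[of 0 n] by (simp add: relative_invariants_def peval_eq_pev PC_0)

lemma relative_invariants_add:
  "F \<in> relative_invariants n w \<Longrightarrow> G \<in> relative_invariants n w \<Longrightarrow> F + G \<in> relative_invariants n w"
  by (simp add: relative_invariants_def Rpoly_add peval_eq_pev distrib_left)

lemma relative_invariants_mult:
  "F \<in> absolute_invariants n \<Longrightarrow> G \<in> relative_invariants n w \<Longrightarrow> F * G \<in> relative_invariants n w"
  by (simp add: absolute_invariants_def relative_invariants_def Rpoly_mult peval_eq_pev)

lemma sum_module_add:
  assumes A: "\<And>x y. x \<in> A \<Longrightarrow> y \<in> A \<Longrightarrow> x + y \<in> A" and "x \<in> sum_module A K g" "y \<in> sum_module A K g"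
  shows "x + y \<in> sum_module A K g"
proof -
  obtain h h' where "x = (\<Sum>k\<in>K. h k * g k)" "\<forall>k\<in>K. h k \<in> A" "y = (\<Sum>k\<in>K. h' k * g k)" "\<forall>k\<in>K. h' k \<in> A"
    using assms(2,3) by (auto simp: sum_module_def)
  then show ?thesis using A
    unfolding sum_module_def by (intro CollectI exI[of _ "\<lambda>k. h k + h' k"]) (simp add: distrib_right sum.distrib)
qed

lemma sum_module_gen:
  assumes "0 \<in> A" "finite K" "k \<in> K" "x \<in> A"
  shows "x * g k \<in> sum_module A K g"
  unfolding sum_module_def
proof (intro CollectI exI[of _ "\<lambda>k'. if k' = k then x else 0"] conjI)
  show "x * g k = (\<Sum>k'\<in>K. (if k' = k then x else 0) * g k')"
    using assms by (simp add: if_distrib[of "\<lambda>a. a * _"] sum.delta cong: if_cong)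
qed (use assms in auto)

lemma sum_closed:
  assumes "0 \<in> S" "\<And>x y. x \<in> S \<Longrightarrow> y \<in> S \<Longrightarrow> x + y \<in> S" "\<And>k. k \<in> K \<Longrightarrow> f k \<in> S"
  shows "sum f K \<in> S"
  using assms(3) by (induction K rule: infinite_finite_induct) (auto intro: assms(1,2))

lemma sum_module_subset:
  assumes "0 \<in> S" "\<And>x y. x \<in> S \<Longrightarrow> y \<in> S \<Longrightarrow> x + y \<in> S" "\<And>x k. x \<in> A \<Longrightarrow> k \<in> K \<Longrightarrow> x * g k \<in> S"
  shows "sum_module A K g \<subseteq> S"
proof
  fix y assume "y \<in> sum_module A K g"
  then obtain h where y: "y = (\<Sum>k\<in>K. h k * g k)" "\<forall>k\<in>K. h k \<in> A" by (auto simp: sum_module_def)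
  show "y \<in> S" unfolding y(1) using y(2) by (intro sum_closed assms) auto
qed

section \<open>Transformation of the generators\<close>

lemma peval_Cpol: "peval z (Cpol i j) = lrow z i \<bullet> Acol z j"
  by (simp add: peval_eq_pev pvar_eq_PX Cpol_eq inner_vec_def sum_3 lrow_def Acol_def algebra_simps)

lemma peval_Dpol:
  "peval z (Dpol I) = det (vector [lrow z (sorted_list_of_set I ! 0), lrow z (sorted_list_of_set I ! 1),
    lrow z (sorted_list_of_set I ! 2)] :: real^3^3)"
  by (simp add: peval_eq_pev pvar_eq_PX Dpol_def Let_def det_3 lrow_def)

lemma peval_act_Cpol:
  assumes T: "invertible T" and s: "sden T z i \<noteq> 0" "sden T z j \<noteq> 0"
  shows "peval (act T z) (Cpol i j) = sden T z i / sden T z j * peval z (Cpol i j)"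
proof -
  have "peval (act T z) (Cpol i j) = sden T z i / sden T z j * ((lrow z i v* matrix_inv T) \<bullet> (T *v Acol z j))"
    using s T by (simp add: peval_Cpol lrow_act Acol_act)
  also have "(lrow z i v* matrix_inv T) \<bullet> (T *v Acol z j) = lrow z i \<bullet> (matrix_inv T *v (T *v Acol z j))"
    by (simp add: dot_lmul_matrix)
  also have "\<dots> = peval z (Cpol i j)"
    using matrix_inv_inverse[OF T] by (simp add: matrix_vector_mul_assoc peval_Cpol)
  finally show ?thesis .
qed

lemma det_rows_mult:
  fixes u v w :: "real^3" and N :: "real^3^3"
  shows "det (vector [a *\<^sub>R (u v* N), b *\<^sub>R (v v* N), c *\<^sub>R (w v* N)] :: real^3^3) =
    a * b * c * (det (vector [u, v, w] :: real^3^3) * det N)"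
proof -
  have "(vector [u, v, w] :: real^3^3) ** N = vector [u v* N, v v* N, w v* N]"
    by (simp add: vec_eq_iff forall_3 matrix_matrix_mult_def vector_matrix_mult_def sum_3 mult.commute)
  then have "det (vector [u, v, w] :: real^3^3) * det N = det (vector [u v* N, v v* N, w v* N] :: real^3^3)"
    by (metis det_mul)
  moreover have "det (vector [a *\<^sub>R x, b *\<^sub>R y, c *\<^sub>R t] :: real^3^3) = a * b * c * det (vector [x, y, t] :: real^3^3)"
    for x y t :: "real^3"
    by (simp add: det_3 algebra_simps)
  ultimately show ?thesis by simp
qed

lemma det_matrix_inv: "invertible (T :: real^3^3) \<Longrightarrow> det (matrix_inv T) = 1 / det T"
  using matrix_inv_inverse(1)[of T] det_mul[of "matrix_inv T" T]
  by (simp add: invertible_det_nz field_simps)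

lemma peval_act_Dpol:
  assumes T: "invertible T" and s: "\<And>i. i \<in> {1..n} \<Longrightarrow> sden T z i \<noteq> 0" and I: "I \<in> triples n"
  shows "peval (act T z) (Dpol I) = (\<Prod>i\<in>I. sden T z i) / det T * peval z (Dpol I)"
proof -
  have fin: "finite I" using I by (auto simp: triples_def intro: finite_subset)
  obtain i j k where l: "sorted_list_of_set I = [i, j, k]"
  proof -
    have "length (sorted_list_of_set I) = 3" using I fin by (simp add: triples_def)
    then obtain i j k where "sorted_list_of_set I = [i, j, k]"
      by (auto simp only: numeral_3_eq_3 length_Suc_conv length_0_conv)
    then show ?thesis by (rule that)
  qed
  have "set [i, j, k] = I" "distinct [i, j, k]"
    unfolding l[symmetric] using fin by auto
  then have I': "I = {i, j, k}" "i \<noteq> j" "i \<noteq> k" "j \<noteq> k" by auto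
  have "i \<in> {1..n}" "j \<in> {1..n}" "k \<in> {1..n}" using I I' by (auto simp: triples_def)
  then show ?thesis using T s I'
    by (simp add: peval_Dpol l lrow_act det_rows_mult det_matrix_inv)
qed

lemma prod_triples_power:
  "(\<Prod>I\<in>triples n. (\<Prod>i\<in>I. s i) ^ b I) = (\<Prod>i\<in>{1..n}. (s i :: real) ^ bdeg n b i)"
proof -
  have "(\<Prod>I\<in>triples n. (\<Prod>i\<in>I. s i) ^ b I) = (\<Prod>I\<in>triples n. \<Prod>i\<in>{1..n}. if i \<in> I then s i ^ b I else 1)"
  proof (rule prod.cong[OF refl])
    fix I assume "I \<in> triples n"
    then have "{i \<in> {1..n}. i \<in> I} = I" by (auto simp: triples_def)
    then show "(\<Prod>i\<in>I. s i) ^ b I = (\<Prod>i\<in>{1..n}. if i \<in> I then s i ^ b I else 1)"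
      by (simp add: prod_power_distrib flip: prod.inter_filter)
  qed
  also have "\<dots> = (\<Prod>i\<in>{1..n}. \<Prod>I\<in>triples n. if i \<in> I then s i ^ b I else 1)"
    by (rule prod.swap)
  also have "\<dots> = (\<Prod>i\<in>{1..n}. s i ^ bdeg n b i)"
    by (simp add: bdeg_def power_sum flip: prod.inter_filter)
  finally show ?thesis .
qed

lemma prod_offdiag_power:
  fixes s :: "nat \<Rightarrow> real"
  assumes s: "\<And>i. i \<in> {1..n} \<Longrightarrow> s i \<noteq> 0"
  shows "(\<Prod>i\<in>{1..n}. s i ^ (\<Sum>j\<in>{1..n}. a j i)) * (\<Prod>(i, j)\<in>{(i, j). i \<in> {1..n} \<and> j \<in> {1..n} \<and> i \<noteq> j}. (s i / s j) ^ a i j) =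
    (\<Prod>i\<in>{1..n}. s i ^ (\<Sum>j\<in>{1..n}. a i j))"
proof -
  have "(\<Prod>(i, j)\<in>{(i, j). i \<in> {1..n} \<and> j \<in> {1..n} \<and> i \<noteq> j}. (s i / s j) ^ a i j) =
    (\<Prod>(i, j)\<in>{1..n} \<times> {1..n}. (s i / s j) ^ a i j)"
    using s by (intro prod.mono_neutral_left) auto
  also have "\<dots> = (\<Prod>i\<in>{1..n}. \<Prod>j\<in>{1..n}. s i ^ a i j) / (\<Prod>i\<in>{1..n}. \<Prod>j\<in>{1..n}. s j ^ a i j)"
    by (simp add: power_divide prod_dividef flip: prod.cartesian_product)
  also have "(\<Prod>i\<in>{1..n}. \<Prod>j\<in>{1..n}. s j ^ a i j) = (\<Prod>j\<in>{1..n}. \<Prod>i\<in>{1..n}. s j ^ a i j)"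
    by (rule prod.swap)
  finally show ?thesis using s by (simp add: power_sum)
qed

text \<open>Each D_I contributes the product of its s_i divided by det T, each C_ij contributes s_i
  / s_j. Arbitrary exponents are allowed and denominators cleared, so that admissible pairs and
  balanced matrices are both instances.\<close>

lemma peval_act_Ppol:
  assumes T: "invertible T" and s: "\<And>i. i \<in> {1..n} \<Longrightarrow> sden T z i \<noteq> 0"
  shows "(\<Prod>i\<in>{1..n}. sden T z i ^ (\<Sum>j\<in>{1..n}. a j i)) * det T ^ (\<Sum>I\<in>triples n. b I) * peval (act T z) (Ppol n (b, a)) =
    (\<Prod>i\<in>{1..n}. sden T z i ^ (bdeg n b i + (\<Sum>j\<in>{1..n}. a i j))) * peval z (Ppol n (b, a))"
proof -
  let ?s = "sden T z" and ?O = "{(i, j). i \<in> {1..n} \<and> j \<in> {1..n} \<and> i \<noteq> j}"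
  have d: "det T \<noteq> 0" using T by (simp add: invertible_det_nz)
  have P: "peval y (Ppol n (b, a)) = (\<Prod>I\<in>triples n. peval y (Dpol I) ^ b I) * (\<Prod>(i, j)\<in>?O. peval y (Cpol i j) ^ a i j)" for y
    by (simp add: Ppol_def peval_eq_pev case_prod_beta)
  have Dt: "peval (act T z) (Dpol I) = (\<Prod>i\<in>I. ?s i) / det T * peval z (Dpol I)" if "I \<in> triples n" for I
    using peval_act_Dpol[OF T _ that] s by blast
  have "(\<Prod>I\<in>triples n. peval (act T z) (Dpol I) ^ b I) =
    (\<Prod>I\<in>triples n. (\<Prod>i\<in>I. ?s i) ^ b I * (1 / det T) ^ b I * peval z (Dpol I) ^ b I)"
    by (rule prod.cong) (simp_all add: Dt power_mult_distrib power_divide)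
  also have "\<dots> = (\<Prod>i\<in>{1..n}. ?s i ^ bdeg n b i) / det T ^ (\<Sum>I\<in>triples n. b I) * (\<Prod>I\<in>triples n. peval z (Dpol I) ^ b I)"
    by (simp add: prod.distrib prod_triples_power power_sum power_divide prod_dividef)
  finally have D: "det T ^ (\<Sum>I\<in>triples n. b I) * (\<Prod>I\<in>triples n. peval (act T z) (Dpol I) ^ b I) =
    (\<Prod>i\<in>{1..n}. ?s i ^ bdeg n b i) * (\<Prod>I\<in>triples n. peval z (Dpol I) ^ b I)"
    using d by simp
  have "(\<Prod>(i, j)\<in>?O. peval (act T z) (Cpol i j) ^ a i j) =
    (\<Prod>(i, j)\<in>?O. (?s i / ?s j) ^ a i j * peval z (Cpol i j) ^ a i j)"
    by (rule prod.cong) (auto simp: peval_act_Cpol[OF T s s] simp flip: power_mult_distrib)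
  also have "\<dots> = (\<Prod>(i, j)\<in>?O. (?s i / ?s j) ^ a i j) * (\<Prod>(i, j)\<in>?O. peval z (Cpol i j) ^ a i j)"
    by (simp add: case_prod_beta prod.distrib)
  finally have C: "(\<Prod>i\<in>{1..n}. ?s i ^ (\<Sum>j\<in>{1..n}. a j i)) * (\<Prod>(i, j)\<in>?O. peval (act T z) (Cpol i j) ^ a i j) =
    (\<Prod>i\<in>{1..n}. ?s i ^ (\<Sum>j\<in>{1..n}. a i j)) * (\<Prod>(i, j)\<in>?O. peval z (Cpol i j) ^ a i j)"
    using prod_offdiag_power[OF s, where a = a] by (simp only: mult.assoc[symmetric])
  have "(\<Prod>i\<in>{1..n}. ?s i ^ (\<Sum>j\<in>{1..n}. a j i)) * det T ^ (\<Sum>I\<in>triples n. b I) * peval (act T z) (Ppol n (b, a)) =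
    (det T ^ (\<Sum>I\<in>triples n. b I) * (\<Prod>I\<in>triples n. peval (act T z) (Dpol I) ^ b I)) *
    ((\<Prod>i\<in>{1..n}. ?s i ^ (\<Sum>j\<in>{1..n}. a j i)) * (\<Prod>(i, j)\<in>?O. peval (act T z) (Cpol i j) ^ a i j))"
    by (simp only: P mult_ac)
  also have "\<dots> = (\<Prod>i\<in>{1..n}. ?s i ^ (bdeg n b i + (\<Sum>j\<in>{1..n}. a i j))) * peval z (Ppol n (b, a))"
    by (simp only: C D P power_add prod.distrib mult_ac)
  finally show ?thesis .
qed

lemma pvar_Rpoly_index: "i \<in> {1..n} \<Longrightarrow> pvar (JX i) \<in> Rpoly n \<and> pvar (JY i) \<in> Rpoly n \<and>
    pvar (JP i) \<in> Rpoly n \<and> pvar (JQ i) \<in> Rpoly n"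
  by (auto intro!: Rpoly_pvar simp: jvars_def)

lemma Rpoly_Cpol: "i \<in> {1..n} \<Longrightarrow> j \<in> {1..n} \<Longrightarrow> Cpol i j \<in> Rpoly n"
  unfolding Cpol_eq using pvar_Rpoly_index[of i n] pvar_Rpoly_index[of j n]
  by (intro Rpoly_add Rpoly_mult Rpoly_diff) auto

lemma Rpoly_Dpol: assumes I: "I \<in> triples n" shows "Dpol I \<in> Rpoly n"
proof -
  have fin: "finite I" using I by (auto simp: triples_def intro: finite_subset)
  have "set (sorted_list_of_set I) \<subseteq> {1..n}" "length (sorted_list_of_set I) = 3"
    using I fin by (auto simp: triples_def)
  then have *: "sorted_list_of_set I ! k \<in> {1..n}" if "k < 3" for k
    using that nth_mem[of k "sorted_list_of_set I"] by (metis subsetD)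
  note idx = pvar_Rpoly_index[OF *[of 0]] pvar_Rpoly_index[OF *[of 1]] pvar_Rpoly_index[OF *[of 2]]
  show ?thesis
    unfolding Dpol_def Let_def det_3 lrow_def vector_3 using idx
    by (intro Rpoly_add Rpoly_mult Rpoly_diff Rpoly_uminus) auto
qed

lemma Rpoly_Ppol: "Ppol n (b, a) \<in> Rpoly n"
  unfolding Ppol_def by (auto intro!: Rpoly_mult Rpoly_prod Rpoly_power Rpoly_Cpol Rpoly_Dpol)

lemma Ppol_relative_invariant:
  assumes "admissible n (b, a)"
  shows "Ppol n (b, a) \<in> relative_invariants n (-1)"
  unfolding relative_invariants_def
proof (intro CollectI conjI allI impI Rpoly_Ppol)
  fix T :: "real^3^3" and z
  assume T: "invertible T" and s: "\<forall>i\<in>{1..n}. sden T z i \<noteq> 0"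
  let ?c = "\<lambda>i. \<Sum>j\<in>{1..n}. a j i"
  have d: "det T \<noteq> 0" using T by (simp add: invertible_det_nz)
  have adm: "bdeg n b i + (\<Sum>j\<in>{1..n}. a i j) = ?c i + 3" if "i \<in> {1..n}" for i
  proof -
    have "int (bdeg n b i) + adiff n a i = 3" using assms that by (simp add: admissible_def)
    then show ?thesis unfolding adiff_def by linarith
  qed
  have "(\<Prod>i\<in>{1..n}. sden T z i ^ ?c i) * det T ^ n * peval (act T z) (Ppol n (b, a)) =
    (\<Prod>i\<in>{1..n}. sden T z i ^ (?c i + 3)) * peval z (Ppol n (b, a))"
    using peval_act_Ppol[OF T, of n z a b] s assms adm by (simp add: admissible_def)
  also have "\<dots> = (\<Prod>i\<in>{1..n}. sden T z i ^ ?c i) * ((\<Prod>i\<in>{1..n}. sden T z i ^ 3) * peval z (Ppol n (b, a)))"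
    by (simp add: power_add prod.distrib)
  finally have "det T ^ n * peval (act T z) (Ppol n (b, a)) = (\<Prod>i\<in>{1..n}. sden T z i ^ 3) * peval z (Ppol n (b, a))"
    using s by (simp add: mult.assoc)
  then show "peval (act T z) (Ppol n (b, a)) = Jfac n T z powi (-1) * peval z (Ppol n (b, a))"
    using d by (simp add: Jfac_def power_int_minus field_simps)
qed

lemma Ppol_absolute_invariant:
  assumes "\<And>i. i \<in> {1..n} \<Longrightarrow> (\<Sum>j\<in>{1..n}. e i j) = (\<Sum>j\<in>{1..n}. e j i)"
  shows "Ppol n (\<lambda>_. 0, e) \<in> absolute_invariants n"
  unfolding absolute_invariants_def
proof (intro CollectI conjI allI impI Rpoly_Ppol)
  fix T :: "real^3^3" and z
  assume T: "invertible T" and s: "\<forall>i\<in>{1..n}. sden T z i \<noteq> 0"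
  have "(\<Prod>i\<in>{1..n}. sden T z i ^ (\<Sum>j\<in>{1..n}. e i j)) = (\<Prod>i\<in>{1..n}. sden T z i ^ (\<Sum>j\<in>{1..n}. e j i))"
    by (rule prod.cong) (simp_all only: assms)
  then show "peval (act T z) (Ppol n (\<lambda>_. 0, e)) = peval z (Ppol n (\<lambda>_. 0, e))"
    using peval_act_Ppol[OF T, of n z e "\<lambda>_. 0"] s by (simp add: bdeg_def)
qed

section \<open>Removing cycles\<close>

text \<open>A vertex of a cycle has one edge out and one edge in, every other vertex has none. This
  balance makes Z_gamma an absolute invariant.\<close>

lemma cycle_indicator:
  fixes n :: nat
  assumes c: "distinct c" "set c \<subseteq> {1..n}"
  defines "e \<equiv> \<lambda>i j. of_bool (\<exists>k<length c. i = c ! k \<and> j = c ! (Suc k mod length c)) :: nat"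
  shows "(\<Sum>j\<in>{1..n}. e i j) = (\<Sum>j\<in>{1..n}. e j i)"
proof -
  let ?L = "length c"
  have suc: "Suc k mod ?L < ?L" if "k < ?L" for k using that by (intro mod_less_divisor) linarith
  have inj: "k = k'" if "Suc k mod ?L = Suc k' mod ?L" "k < ?L" "k' < ?L" for k k'
    using that by (auto simp: mod_Suc split: if_splits)
  have mem: "c ! k \<in> {1..n}" if "k < ?L" for k using c(2) that nth_mem by blast
  have row: "(\<Sum>j\<in>{1..n}. e i j) = of_bool (i \<in> set c)"
  proof (cases "i \<in> set c")
    case True
    then obtain k where k: "k < ?L" "i = c ! k" by (metis in_set_conv_nth)
    have "e i j = (if j = c ! (Suc k mod ?L) then 1 else 0)" for j
      using k c(1) by (auto simp: e_def nth_eq_iff_index_eq)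
    then show ?thesis using True mem[OF suc[OF k(1)]] by simp
  next
    case False
    then show ?thesis by (auto simp: e_def intro!: sum.neutral)
  qed
  have col: "(\<Sum>j\<in>{1..n}. e j i) = of_bool (i \<in> set c)"
  proof (cases "i \<in> set c")
    case True
    then obtain k where k: "k < ?L" "i = c ! k" by (metis in_set_conv_nth)
    obtain k' where k': "k' < ?L" "Suc k' mod ?L = k"
    proof (cases k)
      case 0
      with k show ?thesis by (intro that[of "?L - 1"]) auto
    next
      case (Suc k')
      with k show ?thesis by (intro that[of k']) auto
    qed
    have "e j i = (if j = c ! k' then 1 else 0)" for j
    proof -
      have *: "j = c ! k'" if "l < ?L" "j = c ! l" "i = c ! (Suc l mod ?L)" for l
      proof -
        have "Suc l mod ?L = k" using that(3) k c(1) suc[OF that(1)] nth_eq_iff_index_eq by metis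
        with k'(2) have "l = k'" using inj[of l k'] that(1) k'(1) by metis
        with that(2) show ?thesis by simp
      qed
      have "(\<exists>l<?L. j = c ! l \<and> i = c ! (Suc l mod ?L)) \<longleftrightarrow> j = c ! k'"
        using * k(2) k' by blast
      then show ?thesis by (simp add: e_def)
    qed
    then show ?thesis using True mem[OF k'(1)] by simp
  next
    case False
    then show ?thesis using suc by (auto simp: e_def intro!: sum.neutral)
  qed
  show ?thesis by (simp only: row col)
qed

text \<open>Induction on the sum of the entries of \<open>a\<close>. The coefficient
  \<open>x\<close> is arbitrary because the cycle split off in a step is absorbed into it.\<close>

lemma admissible_in_module:
  assumes "finite (reduced_pairs n)" "admissible n (b, a)" "x \<in> absolute_invariants n"
  shows "x * Ppol n (b, a) \<in> sum_module (absolute_invariants n) (reduced_pairs n) (Ppol n)"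
  using assms(2,3)
proof (induction "\<Sum>i\<in>{1..n}. \<Sum>j\<in>{1..n}. a i j" arbitrary: a x rule: less_induct)
  case less
  show ?case
  proof (cases "has_cycle n a")
    case False
    then have "(b, a) \<in> reduced_pairs n" using less.prems by (simp add: reduced_pairs_def)
    then show ?thesis using assms(1) less.prems(2) absolute_invariants_PC[of 0 n]
      by (intro sum_module_gen) (auto simp: PC_0)
  next
    case True
    then obtain c where c: "distinct c" "2 \<le> length c" "set c \<subseteq> {1..n}"
      "\<And>k. k < length c \<Longrightarrow> 0 < a (c ! k) (c ! (Suc k mod length c))" by (auto simp: has_cycle_def)
    define e where "e = (\<lambda>i j. of_bool (\<exists>k<length c. i = c ! k \<and> j = c ! (Suc k mod length c)) :: nat)"
    define a' where "a' = (\<lambda>i j. a i j - e i j)"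
    have ea: "e i j \<le> a i j" for i j using c(4) by (auto simp: e_def Suc_le_eq)
    then have a: "a = (\<lambda>i j. e i j + a' i j)" by (auto simp: a'_def fun_eq_iff)
    have bal: "(\<Sum>j\<in>{1..n}. e i j) = (\<Sum>j\<in>{1..n}. e j i)" for i
      unfolding e_def by (rule cycle_indicator[OF c(1,3)])
    have adm: "admissible n (b, a')"
    proof -
      have "adiff n a i = adiff n a' i" for i
        unfolding adiff_def a sum.distrib using bal[of i] by simp
      moreover have "a' i j = 0" if "a i j = 0" for i j using that by (simp add: a'_def)
      ultimately show ?thesis using less.prems(1) by (auto simp: admissible_def)
    qed
    have "0 < (\<Sum>i\<in>{1..n}. \<Sum>j\<in>{1..n}. e i j)"
    proof -
      let ?i = "c ! 0" and ?j = "c ! (Suc 0 mod length c)"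
      have len: "0 < length c" using c(2) by linarith
      have ij: "?i \<in> {1..n}" "?j \<in> {1..n}"
        using c(3) nth_mem[OF len] nth_mem[OF mod_less_divisor[OF len, of "Suc 0"]] by auto
      have "1 = e ?i ?j" using len by (auto simp: e_def)
      also have "\<dots> \<le> (\<Sum>j\<in>{1..n}. e ?i j)" using ij by (intro member_le_sum) auto
      also have "\<dots> \<le> (\<Sum>i\<in>{1..n}. \<Sum>j\<in>{1..n}. e i j)"
        using ij by (intro member_le_sum[of _ _ "\<lambda>i. \<Sum>j\<in>{1..n}. e i j"]) auto
      finally show ?thesis by simp
    qed
    then have "(\<Sum>i\<in>{1..n}. \<Sum>j\<in>{1..n}. a' i j) < (\<Sum>i\<in>{1..n}. \<Sum>j\<in>{1..n}. a i j)"
      unfolding a by (simp add: sum.distrib)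
    from less.hyps[OF this adm absolute_invariants_mult[OF less.prems(2) Ppol_absolute_invariant[of n e]]]
    have "x * Ppol n (\<lambda>_. 0, e) * Ppol n (b, a') \<in> sum_module (absolute_invariants n) (reduced_pairs n) (Ppol n)"
      using bal by simp
    moreover have "Ppol n (b, a) = Ppol n (\<lambda>_. 0, e) * Ppol n (b, a')"
      using Ppol_add[of n "\<lambda>_. 0" b e a'] by (simp flip: a)
    ultimately show ?thesis by (simp add: mult.assoc)
  qed
qed

section \<open>Finiteness of the set of reduced pairs\<close>

text \<open>In a shortest closed walk no vertex repeats, since the part between two visits would be
  a shorter closed walk; a walk of length 1 would be a loop.\<close>

lemma closed_walk_has_cycle:
  fixes n :: nat and a :: "nat \<Rightarrow> nat \<Rightarrow> nat"
  assumes a: "\<And>i j. i \<notin> {1..n} \<or> j \<notin> {1..n} \<Longrightarrow> a i j = 0" "\<And>i. a i i = 0"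
    and c: "c \<noteq> []" "\<And>k. k < length c \<Longrightarrow> 0 < a (c ! k) (c ! (Suc k mod length c))"
  shows "has_cycle n a"
proof -
  define W where "W = (\<lambda>c. c \<noteq> [] \<and> (\<forall>k<length c. 0 < a (c ! k) (c ! (Suc k mod length c))))"
  obtain d where d: "W d" "\<And>c. W c \<Longrightarrow> length d \<le> length c"
    using ex_has_least_nat[of W c length] c by (auto simp: W_def)
  let ?L = "length d"
  have edge: "0 < a (d ! k) (d ! (Suc k mod ?L))" if "k < ?L" for k
    using d(1) that by (simp add: W_def)
  have "distinct d"
  proof (rule ccontr)
    assume "\<not> distinct d"
    then obtain p q where pq: "p < q" "q < ?L" "d ! p = d ! q"
      unfolding distinct_conv_nth by (metis linorder_neqE_nat)
    let ?c = "take (q - p) (drop p d)"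
    have len: "length ?c = q - p" using pq by simp
    have nth: "?c ! k = d ! (p + k)" if "k < q - p" for k using that pq by simp
    have "W ?c"
      unfolding W_def len
    proof (intro conjI allI impI)
      show "?c \<noteq> []" using pq by auto
      fix k assume k: "k < q - p"
      have e: "0 < a (d ! (p + k)) (d ! Suc (p + k))" using edge[of "p + k"] k pq by simp
      show "0 < a (?c ! k) (?c ! (Suc k mod (q - p)))"
      proof (cases "Suc k = q - p")
        case True
        then have "Suc (p + k) = q" by simp
        then show ?thesis using e True k pq nth[of k] nth[of 0] by simp
      next
        case False
        then show ?thesis using e k nth[of k] nth[of "Suc k"] by simp
      qed
    qed
    from d(2)[OF this] len pq show False by simp
  qed
  moreover have "2 \<le> ?L"
  proof (rule ccontr)
    assume "\<not> 2 \<le> ?L"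
    moreover have "?L > 0" using d(1) by (simp add: W_def)
    ultimately have "?L = 1" by linarith
    with edge[of 0] a(2) show False by simp
  qed
  moreover have "set d \<subseteq> {1..n}"
  proof
    fix x assume "x \<in> set d"
    then obtain k where "k < ?L" "x = d ! k" by (metis in_set_conv_nth)
    then show "x \<in> {1..n}" using edge[of k] a(1)[of x] by (metis less_irrefl)
  qed
  ultimately show ?thesis using edge by (auto simp: has_cycle_def)
qed

text \<open>No edge leaves the set \<open>R\<close> of vertices reachable from \<open>j\<close>, while the edges from \<open>i\<close> to \<open>j\<close>
  enter it, so the total divergence of \<open>R\<close>, which is bounded below, is at most \<open>- a i j\<close>.\<close>

lemma reduced_pair_bound:
  assumes "(b, a) \<in> reduced_pairs n"
  shows "a i j \<le> n * n"
proof (cases "a i j = 0")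
  case False
  have adm: "admissible n (b, a)" and nc: "\<not> has_cycle n a" using assms by (auto simp: reduced_pairs_def)
  have a0: "a i j = 0" if "i \<notin> {1..n} \<or> j \<notin> {1..n}" for i j using adm that by (simp add: admissible_def)
  have aii: "a i i = 0" for i using adm by (simp add: admissible_def)
  have ij: "i \<in> {1..n}" "j \<in> {1..n}" using a0[of i j] False by auto
  define E where "E = {(i, j). a i j > 0}"
  define R where "R = {v. (j, v) \<in> E\<^sup>*}"
  have RJ: "R \<subseteq> {1..n}"
  proof
    fix v assume "v \<in> R"
    then have "(j, v) \<in> E\<^sup>*" by (simp add: R_def)
    then show "v \<in> {1..n}"
      by (cases rule: rtranclE) (use ij a0 in \<open>auto simp: E_def intro: ccontr\<close>)
  qed
  have iR: "i \<notin> R"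
  proof
    assume "i \<in> R"
    then obtain m where "(j, i) \<in> E ^^ m" by (auto simp: R_def rtrancl_power)
    then obtain f where f: "f 0 = j" "f m = i" "\<And>k. k < m \<Longrightarrow> (f k, f (Suc k)) \<in> E"
      by (auto simp: relpow_fun_conv)
    \<comment> \<open>The walk from \<open>j\<close> to \<open>i\<close> is closed by the edge from
      \<open>i\<close> to \<open>j\<close>.\<close>
    have "has_cycle n a"
    proof (rule closed_walk_has_cycle[where c = "map f [0..<Suc m]"])
      fix k assume k: "k < length (map f [0..<Suc m])"
      show "0 < a (map f [0..<Suc m] ! k) (map f [0..<Suc m] ! (Suc k mod length (map f [0..<Suc m])))"
      proof (cases "k = m")
        case True
        then show ?thesis using f False by (simp del: upt_Suc)
      next
        case False
        then show ?thesis using f(3)[of k] k by (simp add: E_def del: upt_Suc)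
      qed
    qed (use a0 aii in auto)
    with nc show False ..
  qed
  have jR: "j \<in> R" by (simp add: R_def)
  have fin: "finite R" using RJ finite_subset by blast
  have out: "(\<Sum>w\<in>{1..n}. a v w) = (\<Sum>w\<in>R. a v w)" if "v \<in> R" for v
  proof -
    have "w \<in> R" if "a v w \<noteq> 0" for w
      using \<open>v \<in> R\<close> that by (auto simp: R_def E_def intro: rtrancl_into_rtrancl)
    then show ?thesis using RJ by (intro sum.mono_neutral_right) auto
  qed
  have into: "(\<Sum>w\<in>R. a w v) + (if v = j then a i j else 0) \<le> (\<Sum>w\<in>{1..n}. a w v)" if "v \<in> R" for v
  proof -
    have "(\<Sum>w\<in>R. a w v) + (if v = j then a i j else 0) \<le> (\<Sum>w\<in>insert i R. a w v)"
      using iR fin by simp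
    also have "\<dots> \<le> (\<Sum>w\<in>{1..n}. a w v)"
      using RJ ij by (intro sum_mono2) auto
    finally show ?thesis .
  qed
  have "(\<Sum>v\<in>R. \<Sum>w\<in>R. a w v) + a i j = (\<Sum>v\<in>R. (\<Sum>w\<in>R. a w v) + (if v = j then a i j else 0))"
    using jR fin by (simp add: sum.distrib)
  also have "\<dots> \<le> (\<Sum>v\<in>R. \<Sum>w\<in>{1..n}. a w v)" by (rule sum_mono[OF into])
  \<comment> \<open>The divergence at \<open>v\<close> is 3 minus \<open>bdeg n b v\<close>, and the
    latter is at most \<open>n\<close>; so the inflow exceeds the outflow by at most
    \<open>n\<close>.\<close>
  also have "\<dots> \<le> (\<Sum>v\<in>R. n + (\<Sum>w\<in>{1..n}. a v w))"
  proof (rule sum_mono)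
    fix v assume "v \<in> R"
    then have v: "v \<in> {1..n}" using RJ by blast
    have "int (bdeg n b v) + adiff n a v = 3" using adm v by (simp add: admissible_def)
    moreover have "bdeg n b v \<le> n"
    proof -
      have "bdeg n b v \<le> (\<Sum>I\<in>triples n. b I)" unfolding bdeg_def by (intro sum_mono2) auto
      then show ?thesis using adm by (simp add: admissible_def)
    qed
    ultimately show "(\<Sum>w\<in>{1..n}. a w v) \<le> n + (\<Sum>w\<in>{1..n}. a v w)"
      unfolding adiff_def by linarith
  qed
  also have "\<dots> = card R * n + (\<Sum>v\<in>R. \<Sum>w\<in>R. a v w)" using out by (simp add: sum.distrib)
  also have "(\<Sum>v\<in>R. \<Sum>w\<in>R. a v w) = (\<Sum>v\<in>R. \<Sum>w\<in>R. a w v)" by (rule sum.swap)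
  finally have "a i j \<le> card R * n" by simp
  also have "card R \<le> n" using card_mono[OF _ RJ] by simp
  finally show ?thesis by simp
qed simp

lemma finite_reduced_pairs: "finite (reduced_pairs n)"
proof -
  let ?B = "{b. \<forall>I. (I \<in> triples n \<longrightarrow> b I \<in> {..n}) \<and> (I \<notin> triples n \<longrightarrow> b I = 0)}"
  let ?A = "{f. \<forall>p. (p \<in> {1..n} \<times> {1..n} \<longrightarrow> f p \<in> {..n * n}) \<and> (p \<notin> {1..n} \<times> {1..n} \<longrightarrow> f p = 0)}"
  have "finite ?B" "finite ?A"
    by (rule finite_set_of_finite_funs; simp)+
  then have "finite ((\<lambda>(b, f). (b, curry f)) ` (?B \<times> ?A))" by blast
  moreover have "reduced_pairs n \<subseteq> (\<lambda>(b, f). (b, curry f)) ` (?B \<times> ?A)"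
  proof
    fix p assume p: "p \<in> reduced_pairs n"
    obtain b a where ba: "p = (b, a)" by force
    have adm: "admissible n (b, a)" using p by (auto simp: ba reduced_pairs_def)
    have "b I \<le> n" for I
    proof (cases "I \<in> triples n")
      case True
      then have "b I \<le> (\<Sum>I\<in>triples n. b I)" by (intro member_le_sum) auto
      then show ?thesis using adm by (simp add: admissible_def)
    next
      case False
      then show ?thesis using adm by (simp add: admissible_def)
    qed
    then have "b \<in> ?B" using adm by (auto simp: admissible_def)
    moreover have "case_prod a \<in> ?A"
      using adm reduced_pair_bound[of b a n] p by (auto simp: admissible_def ba)
    ultimately show "p \<in> (\<lambda>(b, f). (b, curry f)) ` (?B \<times> ?A)"
      unfolding ba by (intro image_eqI[of _ _ "(b, case_prod a)"]) auto
  qed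
  ultimately show ?thesis by (rule finite_subset[rotated])
qed

section \<open>Decomposition by the degrees in the derivatives\<close>

definition scalepq :: "(nat \<Rightarrow> real) \<Rightarrow> (jvar \<Rightarrow> real) \<Rightarrow> jvar \<Rightarrow> real" where
  "scalepq u z v = (case v of JP i \<Rightarrow> u i * z v | JQ i \<Rightarrow> u i * z v | _ \<Rightarrow> z v)"

lemma finite_jvars [simp]: "finite (jvars n)"
  by (simp add: jvars_def)

lemma prod_jvars: "(\<Prod>v\<in>jvars n. h v) = (\<Prod>i\<in>{1..n}. h (JX i) * (h (JY i) * (h (JP i) * (h (JQ i) :: real))))"
  unfolding jvars_def by (subst prod.UNION_disjoint) auto

lemma mev_scalepq:
  assumes "Poly_Mapping.keys m \<subseteq> jvars n"
  shows "mev (scalepq u z) m = (\<Prod>i\<in>{1..n}. u i ^ hdeg {JP i, JQ i} m) * mev z m"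
  unfolding mev_superset[OF finite_jvars assms] prod_jvars prod.distrib[symmetric]
  by (rule prod.cong) (simp_all add: scalepq_def hdeg_def power_add power_mult_distrib)

lemma act_scalepq: "act T (scalepq u z) = scalepq u (act T z)"
proof
  fix v
  have s: "sden T (scalepq u z) i = sden T z i" for i by (simp add: sden_def scalepq_def)
  have l: "lrow (scalepq u z) i = u i *\<^sub>R lrow z i" for i
    by (simp add: vec_eq_iff forall_3 lrow_def scalepq_def algebra_simps)
  show "act T (scalepq u z) v = scalepq u (act T z) v"
    by (cases v) (simp_all add: act_def s l scalepq_def vector_matrix_mult_def sum_3 algebra_simps)
qed

lemma pev_scalepq:
  assumes F: "F \<in> Rpoly n" "\<And>i. i \<in> {1..n} \<Longrightarrow> homog {JP i, JQ i} (int (k i)) F"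
  shows "pev (scalepq u z) F = (\<Prod>i\<in>{1..n}. u i ^ k i) * pev z F"
  unfolding pev_def sum_distrib_left
proof (rule sum.cong[OF refl])
  fix m assume m: "m \<in> Poly_Mapping.keys F"
  have "hdeg {JP i, JQ i} m = k i" if "i \<in> {1..n}" for i using F(2)[OF that] m by (auto simp: homog_def)
  then have "(\<Prod>i\<in>{1..n}. u i ^ hdeg {JP i, JQ i} m) = (\<Prod>i\<in>{1..n}. u i ^ k i)"
    by (intro prod.cong) auto
  moreover have "Poly_Mapping.keys m \<subseteq> jvars n" using F(1) m by (auto simp: Rpoly_def)
  ultimately show "Poly_Mapping.lookup F m * mev (scalepq u z) m =
      (\<Prod>i\<in>{1..n}. u i ^ k i) * (Poly_Mapping.lookup F m * mev z m)"
    by (simp add: mev_scalepq)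
qed

text \<open>The action is linear in each \<open>(p\<^sub>i, q\<^sub>i)\<close>, hence commutes with rescaling these variables.\<close>

lemma relative_invariants_homogeneous_parts:
  assumes F: "F \<in> relative_invariants n w"
  obtains K G where "finite K" "F = (\<Sum>\<kappa>\<in>K. G \<kappa>)"
    "\<And>\<kappa>. G \<kappa> \<in> relative_invariants n w"
    "\<And>\<kappa> i. i \<in> {1..n} \<Longrightarrow> homog {JP i, JQ i} (int (Poly_Mapping.lookup \<kappa> i)) (G \<kappa>)"
proof -
  have FR: "F \<in> Rpoly n" using F by (simp add: relative_invariants_def)
  \<comment> \<open>The multidegree is encoded as a monomial in variables indexed by
    \<open>i\<close>, so that the factor by which a part scales is
    \<open>mev u \<kappa>\<close>.\<close>
  define D where "D = (\<lambda>m. \<Sum>i\<in>{1..n}. Poly_Mapping.single i (hdeg {JP i, JQ i} m))"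
  have lD: "Poly_Mapping.lookup (D m) i = (if i \<in> {1..n} then hdeg {JP i, JQ i} m else 0)" for m i
    by (simp add: D_def lookup_sum lookup_single when_def)
  have mevD: "mev u (D m) = (\<Prod>i\<in>{1..n}. u i ^ hdeg {JP i, JQ i} m)" for u m
    by (subst mev_superset[of "{1..n}"]) (auto simp: in_keys_iff lD intro!: prod.cong split: if_splits)
  let ?M = "Poly_Mapping.keys F"
  define G where "G = (\<lambda>\<kappa>. \<Sum>m\<in>{m \<in> ?M. D m = \<kappa>}. Poly_Mapping.single m (Poly_Mapping.lookup F m))"
  define K where "K = D ` ?M"
  have lG: "Poly_Mapping.lookup (G \<kappa>) m = (if D m = \<kappa> then Poly_Mapping.lookup F m else 0)" for \<kappa> m
    by (auto simp: G_def lookup_sum lookup_single when_def in_keys_iff)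
  have keysG: "m \<in> ?M \<and> D m = \<kappa>" if "m \<in> Poly_Mapping.keys (G \<kappa>)" for m \<kappa>
    using that by (auto simp: in_keys_iff lG split: if_splits)
  have GR: "G \<kappa> \<in> Rpoly n" for \<kappa>
    using FR keysG by (auto simp: Rpoly_def)
  have Ghom: "homog {JP i, JQ i} (int (Poly_Mapping.lookup \<kappa> i)) (G \<kappa>)" if "i \<in> {1..n}" for \<kappa> i
    unfolding homog_def
  proof
    fix m assume "m \<in> Poly_Mapping.keys (G \<kappa>)"
    then have "D m = \<kappa>" using keysG by blast
    then show "int (hdeg {JP i, JQ i} m) = int (Poly_Mapping.lookup \<kappa> i)"
      using that lD[of m i] by auto
  qed
  have FG: "F = (\<Sum>\<kappa>\<in>K. G \<kappa>)"
    by (rule poly_mapping_eqI) (auto simp: lookup_sum lG K_def in_keys_iff sum.delta')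
  have scale: "pev (scalepq u z) F = (\<Sum>\<kappa>\<in>K. mev u \<kappa> * pev z (G \<kappa>))" for u z
  proof -
    have "pev (scalepq u z) (G \<kappa>) = mev u \<kappa> * pev z (G \<kappa>)" if \<kappa>: "\<kappa> \<in> K" for \<kappa>
    proof -
      obtain m where "\<kappa> = D m" using \<kappa> by (auto simp: K_def)
      then have "(\<Prod>i\<in>{1..n}. u i ^ Poly_Mapping.lookup \<kappa> i) = mev u \<kappa>"
        by (simp add: mevD lD)
      then show ?thesis using pev_scalepq[OF GR Ghom] by simp
    qed
    then show ?thesis unfolding FG by simp
  qed
  have GI: "G \<kappa> \<in> relative_invariants n w" for \<kappa>
  proof (cases "\<kappa> \<in> K")
    case True
    show ?thesis unfolding relative_invariants_def
    proof (intro CollectI conjI GR allI impI)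
      fix T :: "real^3^3" and z
      assume T: "invertible T" and s: "\<forall>i\<in>{1..n}. sden T z i \<noteq> 0"
      define E where "E = (\<lambda>\<kappa>. pev (act T z) (G \<kappa>) - Jfac n T z powi w * pev z (G \<kappa>))"
      have sd: "sden T (scalepq u z) i = sden T z i" for u i by (simp add: sden_def scalepq_def)
      \<comment> \<open>\<open>H\<close> is a polynomial in the scaling factors \<open>u\<close>
        whose coefficients are the defects of invariance of the parts. Invariance of
        \<open>F\<close> at all rescaled points makes it vanish, hence every defect is 0.\<close>
      define H where "H = (\<Sum>\<kappa>\<in>K. Poly_Mapping.single \<kappa> (E \<kappa>))"
      have "H = 0"
      proof (rule pev_positive_eq_0)
        fix u :: "nat \<Rightarrow> real"
        have "Jfac n T (scalepq u z) = Jfac n T z" by (simp add: Jfac_def sd)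
        then have "pev (scalepq u (act T z)) F = Jfac n T z powi w * pev (scalepq u z) F"
          using F T s by (simp add: relative_invariants_def peval_eq_pev sd flip: act_scalepq)
        then show "pev u H = 0"
          by (simp add: H_def pev_single E_def scale algebra_simps sum_subtractf sum_distrib_left)
      qed
      then have "Poly_Mapping.lookup H \<kappa> = 0" by simp
      then have "E \<kappa> = 0"
        using True by (simp add: H_def lookup_sum lookup_single when_def K_def)
      then show "peval (act T z) (G \<kappa>) = Jfac n T z powi w * peval z (G \<kappa>)"
        by (simp add: E_def peval_eq_pev)
    qed
  next
    case False
    then have "G \<kappa> = 0" by (intro poly_mapping_eqI) (auto simp: lG K_def in_keys_iff)
    then show ?thesis by (simp add: relative_invariants_0)
  qed
  show thesis by (rule that[OF _ FG GI Ghom]) (simp add: K_def)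
qed

section \<open>Homogenization\<close>

abbreviation pA :: "(gvar \<Rightarrow> real) \<Rightarrow> nat \<Rightarrow> nat \<Rightarrow> real" where "pA \<zeta> i c \<equiv> \<zeta> (GA i c)"
abbreviation pV :: "(gvar \<Rightarrow> real) \<Rightarrow> nat \<Rightarrow> nat \<Rightarrow> real" where "pV \<zeta> i c \<equiv> \<zeta> (GV i c)"

text \<open>The point \<open>z\<close> whose column \<open>Acol z i\<close> is proportional to \<open>A\<^sub>i\<close> and whose row \<open>lrow z i\<close> is
  proportional to \<open>A\<^sub>i \<times> v\<^sub>i\<close>, with inverse factors.\<close>

definition dehom :: "(gvar \<Rightarrow> real) \<Rightarrow> jvar \<Rightarrow> real" where
  "dehom \<zeta> v = (case v of JX i \<Rightarrow> pA \<zeta> i 0 / pA \<zeta> i 2 | JY i \<Rightarrow> pA \<zeta> i 1 / pA \<zeta> i 2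
    | JP i \<Rightarrow> pA \<zeta> i 2 * crs (pA \<zeta> i) (pV \<zeta> i) 0 | JQ i \<Rightarrow> pA \<zeta> i 2 * crs (pA \<zeta> i) (pV \<zeta> i) 1)"

definition tmat :: "(nat \<Rightarrow> nat \<Rightarrow> real) \<Rightarrow> real^3^3" where
  "tmat t = vector [vector [t 0 0, t 0 1, t 0 2], vector [t 1 0, t 1 1, t 1 2], vector [t 2 0, t 2 1, t 2 2]]"

definition vec3 :: "(nat \<Rightarrow> real) \<Rightarrow> real^3" where "vec3 a = vector [a 0, a 1, a 2]"

text \<open>Variables that do not matter are sent to \<open>1\<close>, so that substituting keeps polynomials in \<open>Malg\<close>.\<close>

definition tr :: "nat \<Rightarrow> (nat \<Rightarrow> nat \<Rightarrow> real) \<Rightarrow> (gvar \<Rightarrow> real) \<Rightarrow> gvar \<Rightarrow> real" where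
  "tr n t \<zeta> v = (case v of
      GA i c \<Rightarrow> if i \<in> {1..n} \<and> c < 3 then dot3 (t c) (pA \<zeta> i) else 1
    | GV i c \<Rightarrow> if i \<in> {1..n} \<and> c < 3 then dot3 (t c) (pV \<zeta> i) else 1
    | _ \<Rightarrow> 1)"

lemma det_tmat: "det (tmat t) = br (t 0) (t 1) (t 2)"
  by (simp add: tmat_def det_3 vec_defs algebra_simps)

text \<open>TA x Tv is det T times (A x v) T^(-1), which is the action on rows up to the factor det
  T. This factor appears as a scaling of the derivative variables.\<close>

lemma dehom_tr:
  assumes T: "invertible (tmat t)" and i: "i \<in> {1..n}" and W: "pA \<zeta> i 2 \<noteq> 0" "dot3 (t 2) (pA \<zeta> i) \<noteq> 0"
  shows "sden (tmat t) (dehom \<zeta>) i = dot3 (t 2) (pA \<zeta> i) / pA \<zeta> i 2"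
    and "v \<in> {JX i, JY i, JP i, JQ i} \<Longrightarrow>
      dehom (tr n t \<zeta>) v = scalepq (\<lambda>_. det (tmat t)) (act (tmat t) (dehom \<zeta>)) v"
proof -
  let ?T = "tmat t" and ?z = "dehom \<zeta>" and ?A = "pA \<zeta> i" and ?V = "pV \<zeta> i"
  let ?TA = "\<lambda>r. dot3 (t r) ?A" and ?TV = "\<lambda>r. dot3 (t r) ?V"
  show s: "sden ?T ?z i = dot3 (t 2) ?A / ?A 2"
    using W by (simp add: sden_def tmat_def dehom_def dot3_def field_simps)
  have d: "det ?T \<noteq> 0" using T by (simp add: invertible_det_nz)
  have l: "lrow ?z i = ?A 2 *\<^sub>R vec3 (crs ?A ?V)"
    using W by (simp add: vec_eq_iff forall_3 lrow_def vec3_def dehom_def crs_def field_simps)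
  have "vec3 (crs ?TA ?TV) v* ?T = det ?T *\<^sub>R vec3 (crs ?A ?V)"
    by (simp add: vec_eq_iff forall_3 vector_matrix_mult_def sum_3 vec3_def tmat_def det_3 vec_defs algebra_simps)
  then have "(vec3 (crs ?TA ?TV) v* ?T) v* matrix_inv ?T = det ?T *\<^sub>R (vec3 (crs ?A ?V) v* matrix_inv ?T)"
    by (simp add: vector_matrix_mult_def sum_3 vec_eq_iff algebra_simps)
  then have u: "vec3 (crs ?TA ?TV) = det ?T *\<^sub>R (vec3 (crs ?A ?V) v* matrix_inv ?T)"
    using matrix_inv_inverse[OF T] by (simp add: vector_matrix_mul_assoc)
  have u1: "crs ?TA ?TV 0 = det ?T * (vec3 (crs ?A ?V) v* matrix_inv ?T) $ 1"
    "crs ?TA ?TV 1 = det ?T * (vec3 (crs ?A ?V) v* matrix_inv ?T) $ 2"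
    using arg_cong[OF u, of "\<lambda>x. x $ 1"] arg_cong[OF u, of "\<lambda>x. x $ 2"] by (simp_all add: vec3_def)
  have tr: "tr n t \<zeta> (GA i c) = ?TA c" "tr n t \<zeta> (GV i c) = ?TV c" if "c < 3" for c
    using i that by (simp_all add: tr_def)
  have c: "crs (pA (tr n t \<zeta>) i) (pV (tr n t \<zeta>) i) e = crs ?TA ?TV e" for e
    unfolding crs_def by (simp add: tr)
  have lv: "lrow ?z i v* matrix_inv ?T = ?A 2 *\<^sub>R (vec3 (crs ?A ?V) v* matrix_inv ?T)"
    unfolding l by (simp add: vector_matrix_mult_def sum_3 vec_eq_iff algebra_simps)
  have dP: "dehom \<xi> (JP i) = pA \<xi> i 2 * crs (pA \<xi> i) (pV \<xi> i) 0"
    "dehom \<xi> (JQ i) = pA \<xi> i 2 * crs (pA \<xi> i) (pV \<xi> i) (Suc 0)" for \<xi>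
    by (simp_all add: dehom_def)
  have PQ: "dehom (tr n t \<zeta>) (JP i) = scalepq (\<lambda>_. det ?T) (act ?T ?z) (JP i)"
    "dehom (tr n t \<zeta>) (JQ i) = scalepq (\<lambda>_. det ?T) (act ?T ?z) (JQ i)"
    using W by (simp_all add: dP c u1[unfolded One_nat_def] tr scalepq_def act_def s lv)
  have nm: "?T $ 1 $ 1 * ?z (JX i) + ?T $ 1 $ 2 * ?z (JY i) + ?T $ 1 $ 3 = dot3 (t 0) ?A / ?A 2"
    "?T $ 2 $ 1 * ?z (JX i) + ?T $ 2 $ 2 * ?z (JY i) + ?T $ 2 $ 3 = dot3 (t 1) ?A / ?A 2"
    using W by (simp_all add: tmat_def dehom_def dot3_def field_simps)
  have dX: "dehom \<xi> (JX i) = pA \<xi> i 0 / pA \<xi> i 2" "dehom \<xi> (JY i) = pA \<xi> i 1 / pA \<xi> i 2" for \<xi>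
    by (simp_all add: dehom_def)
  have XY: "dehom (tr n t \<zeta>) (JX i) = scalepq (\<lambda>_. det ?T) (act ?T ?z) (JX i)"
    "dehom (tr n t \<zeta>) (JY i) = scalepq (\<lambda>_. det ?T) (act ?T ?z) (JY i)"
    using W unfolding scalepq_def act_def jvar.case s nm dX[of "tr n t \<zeta>"] by (simp_all add: tr)
  show "v \<in> {JX i, JY i, JP i, JQ i} \<Longrightarrow> dehom (tr n t \<zeta>) v = scalepq (\<lambda>_. det ?T) (act ?T ?z) v"
    using XY PQ by blast
qed

lemma Rpoly_cong:
  assumes "F \<in> Rpoly n" "\<And>i v. i \<in> {1..n} \<Longrightarrow> v \<in> {JX i, JY i, JP i, JQ i} \<Longrightarrow> z v = z' v"
  shows "pev z F = pev z' F"
proof (rule pev_cong)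
  fix m v assume "m \<in> Poly_Mapping.keys F" "v \<in> Poly_Mapping.keys m"
  then have "v \<in> jvars n" using assms(1) by (auto simp: Rpoly_def)
  then obtain i where "i \<in> {1..n}" "v \<in> {JX i, JY i, JP i, JQ i}" unfolding jvars_def by blast
  then show "z v = z' v" by (rule assms(2))
qed

text \<open>The factor 1/J supplies det^(-n) and the cubes of s_i, where s_i is the quotient of the
  last coordinates of TA_i and A_i; the scaling by det T supplies det to the power of the total
  degree. Denominators are cleared so that polynomials can be compared.\<close>

lemma pev_dehom_tr:
  assumes F: "F \<in> relative_invariants n (-1)" "\<And>i. i \<in> {1..n} \<Longrightarrow> homog {JP i, JQ i} (int (k i)) F"
    and T: "invertible (tmat t)"
    and W: "\<And>i. i \<in> {1..n} \<Longrightarrow> pA \<zeta> i 2 \<noteq> 0" "\<And>i. i \<in> {1..n} \<Longrightarrow> dot3 (t 2) (pA \<zeta> i) \<noteq> 0"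
  shows "det (tmat t) ^ n * (\<Prod>i\<in>{1..n}. pA \<zeta> i 2 ^ 3) * pev (dehom (tr n t \<zeta>)) F =
    det (tmat t) ^ (\<Sum>i\<in>{1..n}. k i) * (\<Prod>i\<in>{1..n}. dot3 (t 2) (pA \<zeta> i) ^ 3) * pev (dehom \<zeta>) F"
proof -
  let ?T = "tmat t"
  have FR: "F \<in> Rpoly n" using F by (simp add: relative_invariants_def)
  have d: "det ?T \<noteq> 0" using T by (simp add: invertible_det_nz)
  have s: "sden ?T (dehom \<zeta>) i = dot3 (t 2) (pA \<zeta> i) / pA \<zeta> i 2" if "i \<in> {1..n}" for i
    using dehom_tr(1)[OF T that] W that by blast
  have "pev (dehom (tr n t \<zeta>)) F = pev (scalepq (\<lambda>_. det ?T) (act ?T (dehom \<zeta>))) F"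
    using dehom_tr(2)[OF T] W by (intro Rpoly_cong[OF FR]) blast
  also have "\<dots> = det ?T ^ (\<Sum>i\<in>{1..n}. k i) * pev (act ?T (dehom \<zeta>)) F"
    using pev_scalepq[OF FR F(2)] by (simp add: power_sum)
  also have "pev (act ?T (dehom \<zeta>)) F = Jfac n ?T (dehom \<zeta>) powi (-1) * pev (dehom \<zeta>) F"
    using F(1) T W s by (simp add: relative_invariants_def peval_eq_pev)
  also have "Jfac n ?T (dehom \<zeta>) powi (-1) =
      (\<Prod>i\<in>{1..n}. dot3 (t 2) (pA \<zeta> i) ^ 3) / (\<Prod>i\<in>{1..n}. pA \<zeta> i 2 ^ 3) / det ?T ^ n"
    using d by (simp add: Jfac_def power_int_minus s power_divide prod_dividef)
  finally show ?thesis using d W by (simp add: field_simps)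
qed

section \<open>Poles of the homogenized function\<close>

lemma lookup_single_times: "Poly_Mapping.lookup (Poly_Mapping.single b c * g) (b + k) = c * Poly_Mapping.lookup g k"
  for g :: "'v mpoly"
  by (induction g rule: mpoly_single_sum_induct)
    (simp_all add: mult_single lookup_single when_def lookup_add distrib_left)

text \<open>The monomials \<open>a\<close> and \<open>b\<close> share no variable, so in every
  monomial of the right-hand side the exponents of \<open>a\<close> must come from
  \<open>g\<close>.\<close>

lemma monomial_dvd:
  fixes g g' :: "'v mpoly"
  assumes eq: "Poly_Mapping.single a 1 * g' = Poly_Mapping.single b c * g" and c: "c \<noteq> 0"
    and ab: "\<And>v. Poly_Mapping.lookup a v = 0 \<or> Poly_Mapping.lookup b v = 0"
  obtains f where "g = Poly_Mapping.single a 1 * f"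
proof -
  have "k = a + (k - a)" if k: "k \<in> Poly_Mapping.keys g" for k
  proof -
    have "b + k \<in> Poly_Mapping.keys (Poly_Mapping.single a 1 * g')"
      unfolding eq using k c by (simp add: in_keys_iff lookup_single_times)
    then obtain l where l: "b + k = a + l"
      using keys_mult[of "Poly_Mapping.single a (1::real)" g'] by (auto split: if_splits)
    have "Poly_Mapping.lookup a v \<le> Poly_Mapping.lookup k v" for v
      using ab[of v] arg_cong[OF l, of "\<lambda>m. Poly_Mapping.lookup m v"] by (auto simp: lookup_add)
    then show ?thesis by (intro poly_mapping_eqI) (simp add: lookup_add lookup_minus)
  qed
  moreover have "g = (\<Sum>k\<in>Poly_Mapping.keys g. Poly_Mapping.single k (Poly_Mapping.lookup g k))"
    by (rule poly_mapping_eqI) (simp add: lookup_sum lookup_single when_def in_keys_iff)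
  ultimately have "g = (\<Sum>k\<in>Poly_Mapping.keys g. Poly_Mapping.single (a + (k - a)) (Poly_Mapping.lookup g k))"
    by (metis (no_types, lifting) sum.cong)
  also have "\<dots> = Poly_Mapping.single a 1 * (\<Sum>k\<in>Poly_Mapping.keys g. Poly_Mapping.single (k - a) (Poly_Mapping.lookup g k))"
    by (simp add: sum_distrib_left mult_single)
  finally show ?thesis by (rule that)
qed

lemma prod_PX_power:
  "finite S \<Longrightarrow> (\<Prod>i\<in>S. PX (x i)) ^ M = Poly_Mapping.single (\<Sum>i\<in>S. Poly_Mapping.single (x i) M) 1"
proof (induction S rule: finite_induct)
  case (insert i S)
  have "PX v ^ M = Poly_Mapping.single (Poly_Mapping.single v M) 1" for v :: 'b
    by (induction M) (simp_all add: PX_def mult_single flip: single_add)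
  with insert show ?case by (simp add: power_mult_distrib mult_single)
qed simp

text \<open>The functions that become polynomial after multiplication by a power of the product of
  all last coordinates are closed under ring operations and include the coordinates of
  \<open>dehom\<close>.\<close>

lemma homogenize_with_denominator:
  assumes F: "F \<in> Rpoly n"
  obtains g N where "\<And>\<zeta>. (\<And>i. i \<in> {1..n} \<Longrightarrow> pA \<zeta> i 2 \<noteq> 0) \<Longrightarrow>
    pev \<zeta> g = (\<Prod>i\<in>{1..n}. pA \<zeta> i 2) ^ N * pev (dehom \<zeta>) F"
proof -
  define W where "W = (\<Prod>i\<in>{1..n}. PX (GA i 2))"
  have W: "pev \<zeta> W = (\<Prod>i\<in>{1..n}. pA \<zeta> i 2)" for \<zeta> by (simp add: W_def)
  define Q where "Q = (\<lambda>\<phi>. \<exists>g N. \<forall>\<zeta>. (\<forall>i\<in>{1..n}. pA \<zeta> i 2 \<noteq> 0) \<longrightarrow> pev \<zeta> g = pev \<zeta> W ^ N * \<phi> \<zeta>)"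
  have "Q (\<lambda>\<zeta>. pev (dehom \<zeta>) F)"
  proof (rule pev_closed[where Q = Q and \<sigma> = dehom])
    show "Q (\<lambda>_. c)" for c unfolding Q_def by (intro exI[of _ "PC c"] exI[of _ 0]) simp
  next
    fix g h assume "Q g" "Q h"
    then obtain a N b M where a: "\<forall>\<zeta>. (\<forall>i\<in>{1..n}. pA \<zeta> i 2 \<noteq> 0) \<longrightarrow> pev \<zeta> a = pev \<zeta> W ^ N * g \<zeta>"
      and b: "\<forall>\<zeta>. (\<forall>i\<in>{1..n}. pA \<zeta> i 2 \<noteq> 0) \<longrightarrow> pev \<zeta> b = pev \<zeta> W ^ M * h \<zeta>" unfolding Q_def by blast
    show "Q (\<lambda>\<zeta>. g \<zeta> + h \<zeta>)" unfolding Q_def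
      by (intro exI[of _ "W ^ M * a + W ^ N * b"] exI[of _ "N + M"])
        (auto simp: a b power_add algebra_simps)
    show "Q (\<lambda>\<zeta>. g \<zeta> * h \<zeta>)" unfolding Q_def
      by (intro exI[of _ "a * b"] exI[of _ "N + M"]) (auto simp: a b power_add algebra_simps)
  next
    fix m v assume "m \<in> Poly_Mapping.keys F" "v \<in> Poly_Mapping.keys m"
    then have "v \<in> jvars n" using F by (auto simp: Rpoly_def)
    then obtain i where i: "i \<in> {1..n}" "v \<in> {JX i, JY i, JP i, JQ i}" unfolding jvars_def by blast
    define W' where "W' = (\<Prod>j\<in>{1..n} - {i}. PX (GA j 2))"
    have "W = PX (GA i 2) * W'" using i(1) unfolding W_def W'_def by (intro prod.remove) auto
    then have WW: "pev \<zeta> W = pA \<zeta> i 2 * pev \<zeta> W'" for \<zeta> by simp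
    have sv: "pev \<zeta> (crs (sv (SA i)) (sv (SV i)) c) = crs (pA \<zeta> i) (pV \<zeta> i) c" for \<zeta> c
      by (simp add: crs_def sv_def)
    have XY: "\<exists>g N. \<forall>\<zeta>. (\<forall>i\<in>{1..n}. pA \<zeta> i 2 \<noteq> 0) \<longrightarrow> pev \<zeta> g = pev \<zeta> W ^ N * (pA \<zeta> i c / pA \<zeta> i 2)" for c
      using i(1) by (intro exI[of _ "PX (GA i c) * W'"] exI[of _ 1]) (auto simp: WW)
    have PQ: "\<exists>g N. \<forall>\<zeta>. (\<forall>i\<in>{1..n}. pA \<zeta> i 2 \<noteq> 0) \<longrightarrow>
        pev \<zeta> g = pev \<zeta> W ^ N * (pA \<zeta> i 2 * crs (pA \<zeta> i) (pV \<zeta> i) c)" for c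
      by (intro exI[of _ "PX (GA i 2) * crs (sv (SA i)) (sv (SV i)) c"] exI[of _ 0]) (simp add: sv)
    show "Q (\<lambda>\<zeta>. dehom \<zeta> v)"
      unfolding Q_def using i(2) XY[of 0] XY[of 1] PQ[of 0] PQ[of 1]
      by (elim insertE emptyE; simp add: dehom_def)
  qed
  then show thesis unfolding Q_def W using that by blast
qed

text \<open>The rational function obtained by homogenizing a relative invariant has poles only where some
  \<open>A\<^sub>i\<close> has last coordinate \<open>0\<close>. By invariance under exchanging the first and the last coordinate, its
  poles also lie where some \<open>A\<^sub>i\<close> has first coordinate \<open>0\<close>; hence it has none.\<close>

lemma homogenize:
  assumes F: "F \<in> relative_invariants n (-1)" "\<And>i. i \<in> {1..n} \<Longrightarrow> homog {JP i, JQ i} (int (k i)) F"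
  obtains f where "\<And>\<zeta>. (\<And>i. i \<in> {1..n} \<Longrightarrow> pA \<zeta> i 2 \<noteq> 0) \<Longrightarrow>
    pev (dehom \<zeta>) F = (\<Prod>i\<in>{1..n}. pA \<zeta> i 2) ^ 3 * pev \<zeta> f"
proof -
  have FR: "F \<in> Rpoly n" using F by (simp add: relative_invariants_def)
  obtain g N where g: "\<And>\<zeta>. (\<And>i. i \<in> {1..n} \<Longrightarrow> pA \<zeta> i 2 \<noteq> 0) \<Longrightarrow>
      pev \<zeta> g = (\<Prod>i\<in>{1..n}. pA \<zeta> i 2) ^ N * pev (dehom \<zeta>) F"
    using homogenize_with_denominator[OF FR] by metis
  \<comment> \<open>The antidiagonal matrix exchanges the coordinates 0 and 2; its determinant -1
    accounts for the signs below.\<close>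
  define t where "t = (\<lambda>r c :: nat. if r + c = 2 then 1 else (0 :: real))"
  have t: "dot3 (t 0) a = a 2" "dot3 (t 1) a = a 1" "dot3 (t 2) a = a 0" for a
    by (simp_all add: dot3_def t_def)
  have det: "det (tmat t) = -1" by (simp add: det_tmat vec_defs t_def)
  then have T: "invertible (tmat t)" by (simp add: invertible_det_nz)
  define W X where "W = (\<Prod>i\<in>{1..n}. PX (GA i 2))" and "X = (\<Prod>i\<in>{1..n}. PX (GA i 0))"
  have "\<exists>g'. \<forall>\<zeta>. pev \<zeta> g' = pev (tr n t \<zeta>) g"
  proof (rule pev_closed[where Q = "\<lambda>\<phi>. \<exists>g'. \<forall>\<zeta>. pev \<zeta> g' = \<phi> \<zeta>" and \<sigma> = "tr n t"])
    fix \<phi> \<psi> :: "(gvar \<Rightarrow> real) \<Rightarrow> real"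
    assume "\<exists>g'. \<forall>\<zeta>. pev \<zeta> g' = \<phi> \<zeta>" "\<exists>g'. \<forall>\<zeta>. pev \<zeta> g' = \<psi> \<zeta>"
    then obtain a b where ab: "\<forall>\<zeta>. pev \<zeta> a = \<phi> \<zeta>" "\<forall>\<zeta>. pev \<zeta> b = \<psi> \<zeta>" by blast
    show "\<exists>g'. \<forall>\<zeta>. pev \<zeta> g' = \<phi> \<zeta> + \<psi> \<zeta>"
      using ab by (intro exI[of _ "a + b"]) simp
    show "\<exists>g'. \<forall>\<zeta>. pev \<zeta> g' = \<phi> \<zeta> * \<psi> \<zeta>"
      using ab by (intro exI[of _ "a * b"]) simp
  next
    fix c :: real show "\<exists>g'. \<forall>\<zeta>. pev \<zeta> g' = c" by (intro exI[of _ "PC c"]) simp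
  next
    fix v
    have "\<exists>g'. \<forall>\<zeta> :: gvar \<Rightarrow> real. pev \<zeta> g' = dot3 (t c) (\<lambda>e. \<zeta> (x e))" for c and x :: "nat \<Rightarrow> gvar"
      by (intro exI[of _ "dot3 (\<lambda>e. PC (t c e)) (\<lambda>e. PX (x e))"]) (simp add: dot3_def)
    note form = this
    have one: "\<exists>g'. \<forall>\<zeta> :: gvar \<Rightarrow> real. pev \<zeta> g' = 1" by (intro exI[of _ 1]) simp
    show "\<exists>g'. \<forall>\<zeta>. pev \<zeta> g' = tr n t \<zeta> v"
    proof (cases v)
      case (GA i c)
      then show ?thesis using form[of c "GA i"] one
        by (cases "i \<in> {1..n} \<and> c < 3") (simp_all only: tr_def gvar.case if_True if_False simp_thms)
    next
      case (GV i c)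
      then show ?thesis using form[of c "GV i"] one
        by (cases "i \<in> {1..n} \<and> c < 3") (simp_all only: tr_def gvar.case if_True if_False simp_thms)
    qed (use one in \<open>simp_all add: tr_def\<close>)
  qed
  then obtain g' where g': "\<And>\<zeta>. pev \<zeta> g' = pev (tr n t \<zeta>) g" by blast
  \<comment> \<open>\<open>g\<close> is W^N times the dehomogenized \<open>F\<close>, and
    \<open>g'\<close> is X^N times its transform; invariance contributes the further cubes. As W and
    X are coprime, W^(N + 3) divides \<open>g\<close>, and removing W^N leaves the factor W^3 of the
    claim.\<close>
  have "W ^ (N + 3) * g' = PC ((-1) ^ (n + (\<Sum>i\<in>{1..n}. k i))) * (X ^ (N + 3) * g)"
  proof (rule pev_positive_eqI)
    fix \<zeta> :: "gvar \<Rightarrow> real" assume pos: "\<And>v. \<zeta> v > 0"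
    then have nz: "\<zeta> v \<noteq> 0" for v by (metis less_irrefl)
    have tr2: "tr n t \<zeta> (GA i 2) = pA \<zeta> i 0" if "i \<in> {1..n}" for i
      using that by (simp add: tr_def t)
    have "(-1) ^ n * pev \<zeta> W ^ 3 * pev (dehom (tr n t \<zeta>)) F = (-1) ^ (\<Sum>i\<in>{1..n}. k i) * pev \<zeta> X ^ 3 * pev (dehom \<zeta>) F"
      using pev_dehom_tr[OF F T, of \<zeta>] nz by (simp add: det t W_def X_def prod_power_distrib)
    then have "(-1) ^ n * ((-1) ^ n * pev \<zeta> W ^ 3 * pev (dehom (tr n t \<zeta>)) F) = (-1) ^ n * ((-1) ^ (\<Sum>i\<in>{1..n}. k i) * pev \<zeta> X ^ 3 * pev (dehom \<zeta>) F)"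
      by simp
    then have 1: "pev \<zeta> W ^ 3 * pev (dehom (tr n t \<zeta>)) F = (-1) ^ (n + (\<Sum>i\<in>{1..n}. k i)) * pev \<zeta> X ^ 3 * pev (dehom \<zeta>) F"
      by (simp add: power_add mult.assoc flip: power_mult_distrib mult.assoc[of "(-1) ^ n" "(-1) ^ n"])
    have 2: "pev \<zeta> g = pev \<zeta> W ^ N * pev (dehom \<zeta>) F"
      using g[of \<zeta>] nz by (simp add: W_def)
    have "pev \<zeta> g' = (\<Prod>i\<in>{1..n}. tr n t \<zeta> (GA i 2)) ^ N * pev (dehom (tr n t \<zeta>)) F"
      unfolding g' using tr2 nz by (intro g) metis
    also have "(\<Prod>i\<in>{1..n}. tr n t \<zeta> (GA i 2)) = pev \<zeta> X" by (simp add: X_def tr2)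
    finally have 3: "pev \<zeta> g' = pev \<zeta> X ^ N * pev (dehom (tr n t \<zeta>)) F" .
    have "pev \<zeta> (W ^ (N + 3) * g') = pev \<zeta> W ^ N * pev \<zeta> X ^ N * (pev \<zeta> W ^ 3 * pev (dehom (tr n t \<zeta>)) F)"
      by (simp add: 3 power_add mult_ac)
    also have "\<dots> = pev \<zeta> (PC ((-1) ^ (n + (\<Sum>i\<in>{1..n}. k i))) * (X ^ (N + 3) * g))"
      unfolding 1 by (simp add: 2 power_add mult_ac)
    finally show "pev \<zeta> (W ^ (N + 3) * g') = pev \<zeta> (PC ((-1) ^ (n + (\<Sum>i\<in>{1..n}. k i))) * (X ^ (N + 3) * g))" .
  qed
  then have eq: "Poly_Mapping.single (\<Sum>i\<in>{1..n}. Poly_Mapping.single (GA i 2) (N + 3)) 1 * g' =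
    Poly_Mapping.single (\<Sum>i\<in>{1..n}. Poly_Mapping.single (GA i 0) (N + 3)) ((-1) ^ (n + (\<Sum>i\<in>{1..n}. k i))) * g"
    unfolding W_def X_def prod_PX_power[OF finite_atLeastAtMost] PC_def mult.assoc[symmetric] mult_single by simp
  have disj: "Poly_Mapping.lookup (\<Sum>i\<in>{1..n}. Poly_Mapping.single (GA i 2) (N + 3)) v = 0 \<or>
      Poly_Mapping.lookup (\<Sum>i\<in>{1..n}. Poly_Mapping.single (GA i 0) (N + 3)) v = 0" for v
    by (cases v) (auto simp: lookup_sum lookup_single when_def)
  obtain f where "g = Poly_Mapping.single (\<Sum>i\<in>{1..n}. Poly_Mapping.single (GA i 2) (N + 3)) 1 * f"
    by (rule monomial_dvd[OF eq _ disj]) simp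
  then have f: "g = W ^ (N + 3) * f"
    by (simp add: W_def prod_PX_power)
  show thesis
  proof (rule that)
    fix \<zeta> :: "gvar \<Rightarrow> real" assume nz: "\<And>i. i \<in> {1..n} \<Longrightarrow> pA \<zeta> i 2 \<noteq> 0"
    have "pev \<zeta> W \<noteq> 0" using nz by (simp add: W_def)
    moreover have "pev \<zeta> W ^ N * pev (dehom \<zeta>) F = pev \<zeta> W ^ N * (pev \<zeta> W ^ 3 * pev \<zeta> f)"
      using g[of \<zeta>, OF nz] unfolding f by (auto simp add: W_def power_add)
    ultimately show "pev (dehom \<zeta>) F = (\<Prod>i\<in>{1..n}. pA \<zeta> i 2) ^ 3 * pev \<zeta> f"
      by (simp add: W_def)
  qed
qed

text \<open>The substituted variables are 1 or linear forms \<open>tform\<close>, and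
  \<open>Malg\<close> is closed under ring operations.\<close>

lemma Malg_tr:
  "\<exists>x\<in>Malg {1..n}. \<forall>\<zeta>. pev \<zeta> x = pev (tr n (\<lambda>r c. \<zeta> (GT r c)) \<zeta>) f"
proof (rule pev_closed[where Q = "\<lambda>\<phi>. \<exists>x\<in>Malg {1..n}. \<forall>\<zeta>. pev \<zeta> x = \<phi> \<zeta>"
      and \<sigma> = "\<lambda>\<zeta>. tr n (\<lambda>r c. \<zeta> (GT r c)) \<zeta>"])
  fix \<phi> \<psi> :: "(gvar \<Rightarrow> real) \<Rightarrow> real"
  assume "\<exists>x\<in>Malg {1..n}. \<forall>\<zeta>. pev \<zeta> x = \<phi> \<zeta>" "\<exists>x\<in>Malg {1..n}. \<forall>\<zeta>. pev \<zeta> x = \<psi> \<zeta>"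
  then obtain a b where ab: "a \<in> Malg {1..n}" "\<forall>\<zeta>. pev \<zeta> a = \<phi> \<zeta>" "b \<in> Malg {1..n}" "\<forall>\<zeta>. pev \<zeta> b = \<psi> \<zeta>"
    by blast
  show "\<exists>x\<in>Malg {1..n}. \<forall>\<zeta>. pev \<zeta> x = \<phi> \<zeta> + \<psi> \<zeta>"
    using ab by (intro bexI[of _ "a + b"] Malg.add) auto
  show "\<exists>x\<in>Malg {1..n}. \<forall>\<zeta>. pev \<zeta> x = \<phi> \<zeta> * \<psi> \<zeta>"
    using ab by (intro bexI[of _ "a * b"] Malg_mult) auto
next
  fix c :: real show "\<exists>x\<in>Malg {1..n}. \<forall>\<zeta>. pev \<zeta> x = c" by (intro bexI[of _ "PC c"] Malg.const) simp
next
  fix v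
  have form: "\<exists>x\<in>Malg {1..n}. \<forall>\<zeta>. pev \<zeta> x = dot3 (\<lambda>e. \<zeta> (GT c e)) (\<lambda>e. \<zeta> (svar W e))"
    if "sidx W \<in> {1..n} \<and> c < 3" for c W
    using that Malg.mult_form[OF _ _ Malg_1, of W "{1..n}" c]
    by (intro bexI[of _ "tform W c"]) (auto simp: tform_def dot3_def tv_def sv_def)
  have one: "\<exists>x\<in>Malg {1..n}. \<forall>\<zeta>. pev \<zeta> x = 1" by (intro bexI[of _ 1] Malg_1) simp
  show "\<exists>x\<in>Malg {1..n}. \<forall>\<zeta>. pev \<zeta> x = tr n (\<lambda>r c. \<zeta> (GT r c)) \<zeta> v"
  proof (cases v)
    case (GA i c)
    then show ?thesis using form[of "SA i" c] one
      by (cases "i \<in> {1..n} \<and> c < 3") (simp_all only: tr_def gvar.case if_True if_False simp_thms svar.simps sidx.simps)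
  next
    case (GV i c)
    then show ?thesis using form[of "SV i" c] one
      by (cases "i \<in> {1..n} \<and> c < 3") (simp_all only: tr_def gvar.case if_True if_False simp_thms svar.simps sidx.simps)
  qed (use one in \<open>simp_all add: tr_def\<close>)
qed

lemma scalepq_single:
  assumes F: "F \<in> Rpoly n" "\<And>i. i \<in> {1..n} \<Longrightarrow> homog {JP i, JQ i} (int (k i)) F" and i: "i \<in> {1..n}"
  shows "pev (scalepq (\<lambda>j. if j = i then c else 1) z) F = c ^ k i * pev z F"
proof -
  have "(\<Prod>j\<in>{1..n}. (if j = i then c else 1) ^ k j) = (\<Prod>j\<in>{1..n}. if j = i then c ^ k i else 1)"
    by (rule prod.cong) auto
  then show ?thesis using i pev_scalepq[OF F] by simp
qed

lemma homogenize_flag_hw: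
  assumes F: "F \<in> Rpoly n" "\<And>i. i \<in> {1..n} \<Longrightarrow> homog {JP i, JQ i} (int (k i)) F"
    and f: "\<And>\<zeta>. (\<And>i. i \<in> {1..n} \<Longrightarrow> pA \<zeta> i 2 \<noteq> 0) \<Longrightarrow>
      pev (dehom \<zeta>) F = (\<Prod>i\<in>{1..n}. pA \<zeta> i 2) ^ 3 * pev \<zeta> f"
  shows "homog {GT r c} 0 f" and "i \<in> {1..n} \<Longrightarrow> flag_hw i (2 * int (k i) - 3) (int (k i)) 0 f"
proof -
  let ?W = "\<lambda>\<zeta>. \<Prod>i\<in>{1..n}. pA \<zeta> i 2"
  let ?sc = "\<lambda>S (\<zeta> :: gvar \<Rightarrow> real) v. (if v \<in> S then 2 else 1) * \<zeta> v"
  have scale: "homog S (int b - int a) f"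
    if S: "finite S" and D: "\<And>\<zeta>. (\<And>v. \<zeta> v > 0) \<Longrightarrow> pev (dehom (?sc S \<zeta>)) F = 2 ^ b * pev (dehom \<zeta>) F"
      and W: "\<And>\<zeta>. ?W (?sc S \<zeta>) ^ 3 = 2 ^ a * ?W \<zeta> ^ 3" for S a b
  proof (rule homog_scaling[OF S])
    fix \<zeta> :: "gvar \<Rightarrow> real" assume pos: "\<And>v. \<zeta> v > 0"
    then have nz: "\<zeta> v \<noteq> 0" for v by (metis less_irrefl)
    have W0: "?W \<zeta> \<noteq> 0" using nz by simp
    have "?W (?sc S \<zeta>) ^ 3 * pev (?sc S \<zeta>) f = 2 ^ b * (?W \<zeta> ^ 3 * pev \<zeta> f)"
      using D[OF pos] f[of "?sc S \<zeta>"] f[of \<zeta>] nz by simp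
    then have "?W \<zeta> ^ 3 * (2 ^ a * pev (?sc S \<zeta>) f) = ?W \<zeta> ^ 3 * (2 ^ b * pev \<zeta> f)"
      unfolding W by (simp add: mult_ac)
    then show "2 ^ a * pev (?sc S \<zeta>) f = 2 ^ b * pev \<zeta> f"
      using W0 by simp
  qed
  show "homog {GT r c} 0 f"
  proof -
    have "dehom (?sc {GT r c} \<zeta>) = dehom \<zeta>" for \<zeta>
      by (auto simp: fun_eq_iff dehom_def crs_def split: jvar.split)
    then show ?thesis using scale[of "{GT r c}" 0 0] by simp
  qed
  assume i: "i \<in> {1..n}"
  have L: "homog (Lset i) 0 f"
  proof -
    have "dehom (?sc (Lset i) \<zeta>) = dehom \<zeta>" for \<zeta>
      by (auto simp: fun_eq_iff dehom_def crs_def Lset_def image_iff split: jvar.split)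
    then show ?thesis using scale[of "Lset i" 0 0] by (simp add: Lset_def image_iff)
  qed
  have V: "homog (Vset i) (int (k i)) f"
  proof -
    have "dehom (?sc (Vset i) \<zeta>) = scalepq (\<lambda>j. if j = i then 2 else 1) (dehom \<zeta>)" for \<zeta>
      by (auto simp: fun_eq_iff dehom_def scalepq_def crs_def Vset_def image_iff algebra_simps split: jvar.split)
    then show ?thesis using scale[of "Vset i" "k i" 0] scalepq_single[OF F i, of 2] by (simp add: Vset_def image_iff)
  qed
  \<comment> \<open>Doubling A_i multiplies p_i and q_i by 4, one factor 2 from the last coordinate
    and one from the cross product, and it multiplies the cube of the product of last coordinates by
    8. Hence the degree 2k - 3.\<close>
  have A: "homog (Aset i) (2 * int (k i) - 3) f"
  proof -
    have "dehom (?sc (Aset i) \<zeta>) = scalepq (\<lambda>j. if j = i then 4 else 1) (dehom \<zeta>)" for \<zeta>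
      by (auto simp: fun_eq_iff dehom_def scalepq_def crs_def Aset_def image_iff algebra_simps split: jvar.split)
    then have D: "pev (dehom (?sc (Aset i) \<zeta>)) F = 2 ^ (2 * k i) * pev (dehom \<zeta>) F" for \<zeta>
      using scalepq_single[OF F i, of 4] by (simp add: power_mult)
    have W: "?W (?sc (Aset i) \<zeta>) ^ 3 = 2 ^ 3 * ?W \<zeta> ^ 3" for \<zeta>
    proof -
      have "?W (?sc (Aset i) \<zeta>) = (\<Prod>j\<in>{1..n}. if j = i then 2 else 1) * ?W \<zeta>"
        unfolding prod.distrib[symmetric] by (rule prod.cong) (auto simp: Aset_def)
      then show ?thesis using i by simp
    qed
    have "homog (Aset i) (int (2 * k i) - int 3) f"
      by (rule scale) (simp_all only: D W finite_sets)
    then show ?thesis by simp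
  qed
  have "UO i f = 0"
  proof (rule pev_positive_eq_0)
    fix \<zeta> :: "gvar \<Rightarrow> real" assume pos: "\<And>v. \<zeta> v > 0"
    then have nz: "\<zeta> v \<noteq> 0" for v by (metis less_irrefl)
    \<comment> \<open>The direction A_i in the block of v_i: A_i x (v_i + t A_i) does not depend on
      t, hence neither does the dehomogenized point.\<close>
    define \<eta> where "\<eta> = (\<lambda>v. case v of GV j c \<Rightarrow> if j = i \<and> c < 3 then pA \<zeta> i c else 0 | _ \<Rightarrow> 0)"
    have \<eta>0: "\<eta> v = 0" if "v \<notin> Vset i" for v
      using that by (cases v) (auto simp: \<eta>_def Vset_def)
    have "pev (\<lambda>v. \<zeta> v + t * \<eta> v) f = pev \<zeta> f" for t
    proof -
      have "dehom (\<lambda>v. \<zeta> v + t * \<eta> v) = dehom \<zeta>"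
        by (auto simp: fun_eq_iff dehom_def crs_def \<eta>_def algebra_simps split: jvar.split)
      moreover have "?W (\<lambda>v. \<zeta> v + t * \<eta> v) = ?W \<zeta>" by (simp add: \<eta>_def)
      ultimately show ?thesis
        using f[of "\<lambda>v. \<zeta> v + t * \<eta> v"] f[of \<zeta>] nz by (simp add: \<eta>_def)
    qed
    then have "((\<lambda>t. pev \<zeta> f) has_real_derivative (\<Sum>v\<in>Vset i. \<eta> v * pev \<zeta> (pd v f))) (at 0)"
      using pev_has_derivative[of "Vset i" \<eta> \<zeta> f] \<eta>0 by simp
    then have "(\<Sum>v\<in>Vset i. \<eta> v * pev \<zeta> (pd v f)) = 0"
      by (rule DERIV_unique) (rule DERIV_const)
    then show "pev \<zeta> (UO i f) = 0"
      by (simp add: UO_def dot3_def sv_def Vset_def sum.reindex inj_on_def \<eta>_def numeral_3_eq_3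
          numeral_2_eq_2 lessThan_Suc algebra_simps)
  qed
  with L V A show "flag_hw i (2 * int (k i) - 3) (int (k i)) 0 f" by (simp add: flag_hw_def)
qed

lemma homogenize_in_Nalg:
  assumes F: "F \<in> relative_invariants n (-1)" "\<And>i. i \<in> {1..n} \<Longrightarrow> homog {JP i, JQ i} (int (k i)) F"
    and f: "\<And>\<zeta>. (\<And>i. i \<in> {1..n} \<Longrightarrow> pA \<zeta> i 2 \<noteq> 0) \<Longrightarrow>
      pev (dehom \<zeta>) F = (\<Prod>i\<in>{1..n}. pA \<zeta> i 2) ^ 3 * pev \<zeta> f"
    and k: "n \<le> (\<Sum>i\<in>{1..n}. k i)"
  shows "f \<in> Nalg {1..n}"
proof -
  have FR: "F \<in> Rpoly n" using F by (simp add: relative_invariants_def)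
  let ?k = "\<Sum>i\<in>{1..n}. k i"
  obtain x where x: "x \<in> Malg {1..n}" "\<And>\<zeta>. pev \<zeta> x = pev (tr n (\<lambda>r c. \<zeta> (GT r c)) \<zeta>) f"
    using Malg_tr by metis
  \<comment> \<open>Of these factors \<open>n\<close> come from the weight, and one more guarantees,
    also for n = 0, that both sides vanish where the matrix is singular. They cancel because
    polynomials form a domain.\<close>
  have "Tdet ^ Suc n * x = Tdet ^ Suc n * (Tdet ^ (?k - n) * f)"
  proof (rule pev_positive_eqI)
    fix \<zeta> :: "gvar \<Rightarrow> real" assume pos: "\<And>v. \<zeta> v > 0"
    then have nz: "\<zeta> v \<noteq> 0" for v by (metis less_irrefl)
    let ?t = "\<lambda>r c. \<zeta> (GT r c)"
    have det: "pev \<zeta> Tdet = det (tmat ?t)" by (simp add: det_tmat Tdet_def vec_defs tv_def)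
    show "pev \<zeta> (Tdet ^ Suc n * x) = pev \<zeta> (Tdet ^ Suc n * (Tdet ^ (?k - n) * f))"
    proof (cases "det (tmat ?t) = 0")
      case True
      then show ?thesis by (simp add: det)
    next
      case False
      then have T: "invertible (tmat ?t)" by (simp add: invertible_det_nz)
      let ?W = "\<Prod>i\<in>{1..n}. pA \<zeta> i 2" and ?S = "\<Prod>i\<in>{1..n}. dot3 (?t 2) (pA \<zeta> i)"
      have S: "dot3 (?t 2) (pA \<zeta> i) \<noteq> 0" for i
        using pos by (intro less_imp_neq[symmetric]) (simp add: dot3_def add_pos_pos)
      have tr2: "tr n ?t \<zeta> (GA i 2) = dot3 (?t 2) (pA \<zeta> i)" if "i \<in> {1..n}" for i
        using that by (simp add: tr_def)
      have 1: "pev (dehom (tr n ?t \<zeta>)) F = ?S ^ 3 * pev \<zeta> x"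
        using f[of "tr n ?t \<zeta>"] S tr2 by (simp add: x)
      have 2: "pev (dehom \<zeta>) F = ?W ^ 3 * pev \<zeta> f" using f[of \<zeta>] nz by simp
      have "det (tmat ?t) ^ n * ?W ^ 3 * (?S ^ 3 * pev \<zeta> x) = det (tmat ?t) ^ ?k * ?S ^ 3 * (?W ^ 3 * pev \<zeta> f)"
        using pev_dehom_tr[OF F T nz S] by (simp add: 1 2 prod_power_distrib)
      then have "?W ^ 3 * ?S ^ 3 * (det (tmat ?t) ^ n * pev \<zeta> x) = ?W ^ 3 * ?S ^ 3 * (det (tmat ?t) ^ ?k * pev \<zeta> f)"
        by (simp only: mult_ac)
      then have "det (tmat ?t) ^ n * pev \<zeta> x = det (tmat ?t) ^ ?k * pev \<zeta> f"
        using nz S by simp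
      also have "det (tmat ?t) ^ ?k = det (tmat ?t) ^ n * det (tmat ?t) ^ (?k - n)"
        using k by (simp flip: power_add)
      finally show ?thesis by (simp add: det)
    qed
  qed
  moreover have "Tdet \<noteq> 0"
  proof
    assume "Tdet = 0"
    then have "pev (\<lambda>v. case v of GT r c \<Rightarrow> of_bool (r = c) | _ \<Rightarrow> 0) Tdet = 0" by simp
    then show False by (simp add: Tdet_def vec_defs tv_def)
  qed
  ultimately have "x = Tdet ^ (?k - n) * f" by simp
  with x show ?thesis
    using homogenize_flag_hw(1)[OF FR F(2) f] by (intro fft_vectors) auto
qed

section \<open>Homogeneous invariants in the span of the admissible products\<close>

lemma dehom_pt: "pev (dehom (pt z)) F = pev z F"
proof -
  have "dehom (pt z) = z"
    by (auto simp: fun_eq_iff dehom_def pt_def crs_def jA_def jV_def pvar_eq_PX split: jvar.split)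
  then show ?thesis by simp
qed

lemma homogeneous_in_span:
  assumes F: "F \<in> relative_invariants n (-1)" "\<And>i. i \<in> {1..n} \<Longrightarrow> homog {JP i, JQ i} (int (k i)) F"
    and S: "0 \<in> S" "\<And>x y. x \<in> S \<Longrightarrow> y \<in> S \<Longrightarrow> x + y \<in> S" "\<And>c x. x \<in> S \<Longrightarrow> PC c * x \<in> S"
      "\<And>b a. admissible n (b, a) \<Longrightarrow> Ppol n (b, a) \<in> S"
  shows "F \<in> S"
proof -
  have FR: "F \<in> Rpoly n" using F by (simp add: relative_invariants_def)
  obtain f where f: "\<And>\<zeta>. (\<And>i. i \<in> {1..n} \<Longrightarrow> pA \<zeta> i 2 \<noteq> 0) \<Longrightarrow>
      pev (dehom \<zeta>) F = (\<Prod>i\<in>{1..n}. pA \<zeta> i 2) ^ 3 * pev \<zeta> f"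
    using homogenize[OF F] by metis
  have hw: "flag_hw i (2 * int (k i) - 3) (int (k i)) 0 f" if "i \<in> {1..n}" for i
    by (rule homogenize_flag_hw(2)[OF FR]) (simp_all only: F(2) that, rule f, blast)
  have Ff: "pev z F = pev (pt z) f" for z
  proof -
    have "pA (pt z) i 2 = 1" for i by (simp add: pt_def jA_def)
    then show ?thesis using f[of "pt z"] by (simp add: dehom_pt)
  qed
  show ?thesis
  proof (cases "f = 0")
    case True
    then have "F = 0" using Ff by (intro pev_positive_eq_0) simp
    with S show ?thesis by simp
  next
    case False
    then obtain m where m: "m \<in> Poly_Mapping.keys f" by fastforce
    \<comment> \<open>The degree 2k - 3 of an actual monomial in A_i cannot be negative. Summing
      over i then makes the exponent of the determinant, the total degree minus \<open>n\<close>,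
      nonnegative.\<close>
    have k2: "k i \<ge> 2" if "i \<in> {1..n}" for i
      using hw[OF that] m unfolding flag_hw_def homog_def by force
    have "n \<le> (\<Sum>i\<in>{1..n}. k i)"
      using sum_mono[of "{1..n}" "\<lambda>_. 1" k] k2 by force
    then have fN: "f \<in> Nalg {1..n}" by (intro homogenize_in_Nalg[OF F f])
    obtain h c where h: "h \<in> Nalg {1..n}" "c \<noteq> 0"
        "\<And>i. i \<in> {1..n} \<Longrightarrow> flag_hw i (int (k i) - 3) 0 (int (k i)) h"
      and hf: "\<And>\<zeta>. (\<And>i e. i \<in> {1..n} \<Longrightarrow> e < 3 \<Longrightarrow> \<zeta> (GL i e) = crs (\<lambda>c. \<zeta> (GA i c)) (\<lambda>c. \<zeta> (GV i c)) e) \<Longrightarrow>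
        pev \<zeta> h = c * pev \<zeta> f"
      by (rule eliminate_vectors[where k = k, OF finite_atLeastAtMost fN k2 hw]) (assumption, assumption, rule that, assumption+, blast)
    obtain K d where K: "finite K" "h = (\<Sum>w\<in>K. PC (d w) * wval w)"
      "\<And>w g. w \<in> K \<Longrightarrow> g \<in># w \<Longrightarrow> gidx g \<subseteq> {1..n}"
      "\<And>w i. w \<in> K \<Longrightarrow> i \<in> {1..n} \<Longrightarrow> int (wdeg (symdeg (SA i)) w) = int (k i) - 3 \<and>
        int (wdeg (symdeg (SV i)) w) = 0 \<and> int (wdeg (ldeg i) w) = int (k i)"
      by (rule Nalg_words_of_degree[OF finite_atLeastAtMost h(1) h(3)]) (assumption, rule that)
    have neg: "- x \<in> S" if "x \<in> S" for x using S(3)[OF that, of "-1"] by (simp add: PC_uminus PC_1)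
    have "jw w \<in> S" if w: "w \<in> K" for w
    proof (rule word_in_span[OF S(1,2) neg S(4)])
      show "gidx g \<subseteq> {1..n}" if "g \<in># w" for g using K(3)[OF w that] .
      show "wdeg (symdeg (SV i)) w = 0" if "i \<in> {1..n}" for i using K(4)[OF w that] by simp
      show "wdeg (ldeg i) w = wdeg (symdeg (SA i)) w + 3" if "i \<in> {1..n}" for i using K(4)[OF w that] by simp
    qed
    then have "PC (d w / c) * jw w \<in> S" if "w \<in> K" for w using that S(3) by blast
    then have "(\<Sum>w\<in>K. PC (d w / c) * jw w) \<in> S"
      by (intro sum_closed S(1,2))
    moreover have "F = (\<Sum>w\<in>K. PC (d w / c) * jw w)"
    proof (rule pev_positive_eqI)
      fix z :: "jvar \<Rightarrow> real"
      have "c * pev z F = pev (pt z) h" unfolding Ff by (rule hf[symmetric]) (rule pt_crs)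
      also have "\<dots> = (\<Sum>w\<in>K. d w * pev z (jw w))" by (simp add: K(2) pev_jw)
      finally show "pev z F = pev z (\<Sum>w\<in>K. PC (d w / c) * jw w)"
        using h(2) by (simp add: sum_divide_distrib[symmetric] field_simps)
    qed
    ultimately show ?thesis by simp
  qed
qed

theorem corollary4p1:
  fixes n :: nat
  assumes "n \<ge> 3"
  shows "finitely_generated_over (absolute_invariants n) (relative_invariants n (-1))
    \<and> finite (reduced_pairs n)
    \<and> relative_invariants n (-1) = sum_module (absolute_invariants n) (reduced_pairs n) (Ppol n)"
proof -
  let ?A = "absolute_invariants n" and ?R = "relative_invariants n (-1)"
  let ?S = "sum_module ?A (reduced_pairs n) (Ppol n)"
  note fin = finite_reduced_pairs[of n]
  have A0: "0 \<in> ?A" using absolute_invariants_PC[of 0 n] by (simp add: PC_0)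
  have A1: "1 \<in> ?A" using absolute_invariants_PC[of 1 n] by (simp add: PC_1)
  have PR: "Ppol n p \<in> ?R" if "p \<in> reduced_pairs n" for p
    using that by (cases p) (auto simp: reduced_pairs_def intro: Ppol_relative_invariant)
  have S0: "0 \<in> ?S"
    using A0 unfolding sum_module_def by (intro CollectI exI[of _ "\<lambda>_. 0"]) simp
  have Sadd: "x + y \<in> ?S" if "x \<in> ?S" "y \<in> ?S" for x y
    using sum_module_add[OF _ that] absolute_invariants_add by blast
  have Sscale: "PC c * x \<in> ?S" if "x \<in> ?S" for c x
  proof -
    obtain h where "x = (\<Sum>p\<in>reduced_pairs n. h p * Ppol n p)" "\<forall>p\<in>reduced_pairs n. h p \<in> ?A"
      using \<open>x \<in> ?S\<close> by (auto simp: sum_module_def)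
    then show ?thesis unfolding sum_module_def
      by (intro CollectI exI[of _ "\<lambda>p. PC c * h p"])
        (auto simp: sum_distrib_left mult.assoc intro: absolute_invariants_mult absolute_invariants_PC)
  qed
  have Sgen: "Ppol n (b, a) \<in> ?S" if "admissible n (b, a)" for b a
    using admissible_in_module[OF fin that A1] by simp
  have RS: "?R \<subseteq> ?S"
  proof
    fix F assume "F \<in> ?R"
    then obtain K G where K: "finite K" "F = (\<Sum>\<kappa>\<in>K. G \<kappa>)" "\<And>\<kappa>. G \<kappa> \<in> ?R"
      "\<And>\<kappa> i. i \<in> {1..n} \<Longrightarrow> homog {JP i, JQ i} (int (Poly_Mapping.lookup \<kappa> i)) (G \<kappa>)"
      using relative_invariants_homogeneous_parts by metis
    have GS: "G \<kappa> \<in> ?S" for \<kappa>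
      by (rule homogeneous_in_span[OF K(3,4) S0 Sadd Sscale Sgen])
    show "F \<in> ?S"
      unfolding K(2) by (intro sum_closed S0 Sadd GS)
  qed
  have SR: "?S \<subseteq> ?R"
    by (rule sum_module_subset) (auto intro: relative_invariants_0 relative_invariants_add relative_invariants_mult PR)
  \<comment> \<open>Generators must form a set of polynomials, while \<open>Ppol n\<close> is not
    known to be injective on pairs; the sum over pairs is therefore compared with the sum over the
    image by a chain of inclusions.\<close>
  let ?G = "Ppol n ` reduced_pairs n"
  have "?S \<subseteq> sum_module ?A ?G (\<lambda>g. g)"
  proof (rule sum_module_subset)
    show "0 \<in> sum_module ?A ?G (\<lambda>g. g)"
      using A0 unfolding sum_module_def by (intro CollectI exI[of _ "\<lambda>_. 0"]) simp
    show "x + y \<in> sum_module ?A ?G (\<lambda>g. g)" if "x \<in> sum_module ?A ?G (\<lambda>g. g)" "y \<in> sum_module ?A ?G (\<lambda>g. g)" for x y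
      using sum_module_add[OF _ that] absolute_invariants_add by blast
    show "x * Ppol n p \<in> sum_module ?A ?G (\<lambda>g. g)" if "x \<in> ?A" "p \<in> reduced_pairs n" for x p
      using sum_module_gen[of ?A ?G "Ppol n p" x "\<lambda>g. g"] A0 fin that by auto
  qed
  moreover have "sum_module ?A ?G (\<lambda>g. g) \<subseteq> ?R"
    by (rule sum_module_subset) (auto intro: relative_invariants_0 relative_invariants_add relative_invariants_mult PR)
  ultimately have "?R = sum_module ?A ?G (\<lambda>g. g)" using RS by blast
  then have "finitely_generated_over ?A ?R"
    unfolding finitely_generated_over_def using fin PR by (intro exI[of _ ?G]) auto
  then show ?thesis using fin RS SR by blast
qed

end
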